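(* Let $m,n\ge 1$, let $T$ be an $mn$-homogeneous $m$-linear Calderón–Zygmund operator on $\mathbb{R}^n$, let $1\le l\le m$, let $b\in L^1_{loc}(\mathbb{R}^n)$, $0<\alpha<n$, let $1<p_1,\dots,p_m<\infty$ and $q<\infty$ satisfy $\frac1{p_1}+\cdots+\frac1{p_m}-\frac1q=\frac\alpha n$, and let $\vec\omega=(\omega_1,\dots,\omega_m)\in A_{\vec P,q}$. Then $$\|b\|_{Lip_\alpha(\mathbb{R}^n)}\approx\|[b,T]_l\|_{L^{p_1}(\omega_1^{p_1})\times\cdots\times L^{p_m}(\omega_m^{p_m})\to L^q(\mu_{\vec\omega})},$$ with implicit constants independent of $b$.
   Context: An $m$-linear Calderón–Zygmund operator $T$ is an $m$-linear operator bounded from $L^{s_1}(\mathbb{R}^n)\times\cdots\times L^{s_m}(\mathbb{R}^n)$ to $L^{s}(\mathbb{R}^n)$ for some $1<s_1,\dots,s_m<\infty$ with $\frac1s=\sum_i\frac1{s_i}$, such that $$T(f_1,\dots,f_m)(x)=\int_{(\mathbb{R}^n)^m}K(x,y_1,\dots,y_m)f_1(y_1)\cdots f_m(y_m)\,dy_1\cdots dy_m\quad\text{for }x\notin\bigcap_{i=1}^m\operatorname{supp}f_i,$$ where $K$, defined off the diagonal $y_0=y_1=\cdots=y_m$ of $(\mathbb{R}^n)^{m+1}$, satisfies: (1) $|K(y_0,\dots,y_m)|\le C\big(\sum_{k=1}^m|y_k-y_0|\big)^{-mn}$; (2) for some $\gamma>0$ and every $0\le i\le m$, if $|y_i-y_i'|\le\frac12\max_{0\le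 k\le m}|y_0-y_k|$ then $|K(y_0,\dots,y_i,\dots,y_m)-K(y_0,\dots,y_i',\dots,y_m)|\le C|y_i-y_i'|^\gamma\big(\sum_{k=1}^m|y_k-y_0|\big)^{-mn-\gamma}$. $T$ is $mn$-homogeneous if the following lower bound holds: for each $A\ge1$ there are $C>0$ and $N_0$ such that for all $N\ge N_0$, $r>0$ and all balls $B(y_0,r),\dots,B(y_m,r)$ with $A^{-1}Nr\le|y_0-y_l|\le ANr$ for $l=1,\dots,m$, one has $|K(x_0,\dots,x_m)|\ge C(Nr)^{-mn}$ for all $x_i\in B(y_i,r)$, $0\le i\le m$. The $l$-th commutator is $[b,T]_l(f_1,\dots,f_m)(x)=b(x)T(f_1,\dots,f_m)(x)-T(f_1,\dots,bf_l,\dots,f_m)(x)$. The Lipschitz seminorm is $\|f\|_{Lip_\alpha(\mathbb{R}^n)}=\sup_{x,h\in\mathbb{R}^n,\,h\ne0}\frac{|f(x+h)-f(x)|}{|h|^\alpha}$ (functions identified when equal almost everywhere). A weight is a nonnegative measurable function; $L^s(w)$ has (quasi-)norm $(\int|f|^sw\,dx)^{1/s}$. For $\vec P=(p_1,\dots,p_m)$ with $1<p_i<\infty$, $\frac1p=\sum_i\frac1{p_i}$ and $\frac1m<p\le q<\infty$, $\vec\omega\in A_{\vec P,q}$ means that, with $\mu_{\vec\omega}=\prod_{i=1}^m\omega_i^{q}$ and $p_i'$ the conjugate exponent of $p_i$, $$\sup_Q\Big(\frac1{|Q|}\int_Q\mu_{\vec\omega}\,dx\Big)^{1/q}\prod_{i=1}^m\Big(\frac1{|Q|}\int_Q\omega_i^{-p_i'}dx\Big)^{1/p_i'}<\infty,$$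 the supremum being over all cubes $Q\subset\mathbb{R}^n$. *)

theory Defs
  imports "HOL-Analysis.Analysis"
begin

text \<open>
  Throughout, \<open>'n\<close> indexes the coordinates of the Euclidean space (so \<open>n = CARD('n)\<close>) and \<open>'m\<close>
  indexes the arguments of a multilinear operator (so \<open>m = CARD('m)\<close>). A tuple of functions is
  \<open>f :: 'm \<Rightarrow> real^'n \<Rightarrow> complex\<close>; a point of \<open>(real^'n)^'m\<close> is a tuple \<open>(y\<^sub>1, \<dots>, y\<^sub>m)\<close>.
  Functions are honest functions, and identities between elements of function spaces are stated
  almost everywhere.
\<close>

section \<open>Weighted Lebesgue spaces\<close>

text \<open>Positive powers of extended nonnegative reals; only used for \<open>a > 0\<close>.\<close>

definition epowr :: "ennreal \<Rightarrow> real \<Rightarrow> ennreal" where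
  "epowr x a = (if x = top then top else ennreal (enn2real x powr a))"

definition weight :: "('a::euclidean_space \<Rightarrow> real) \<Rightarrow> bool" where
  "weight w \<longleftrightarrow> w \<in> borel_measurable lebesgue \<and> (\<forall>x. 0 \<le> w x)"

definition Lp_norm :: "real \<Rightarrow> ('a::euclidean_space \<Rightarrow> real) \<Rightarrow> ('a \<Rightarrow> complex) \<Rightarrow> ennreal" where
  "Lp_norm s w f = epowr (\<integral>\<^sup>+x. ennreal (norm (f x) powr s * w x) \<partial>lebesgue) (1 / s)"

definition Lp_space :: "real \<Rightarrow> ('a::euclidean_space \<Rightarrow> real) \<Rightarrow> ('a \<Rightarrow> complex) set" where
  "Lp_space s w = {f. f \<in> borel_measurable lebesgue \<and> Lp_norm s w f < top}"

definition locally_integrable :: "('a::euclidean_space \<Rightarrow> complex) \<Rightarrow> bool" where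
  "locally_integrable b \<longleftrightarrow> (\<forall>S. compact S \<longrightarrow> b absolutely_integrable_on S)"

section \<open>The Lipschitz seminorm\<close>

definition Lip_sup :: "real \<Rightarrow> ('a::euclidean_space \<Rightarrow> complex) \<Rightarrow> ennreal" where
  "Lip_sup \<alpha> f = (SUP (x, h) \<in> {(x, h). h \<noteq> 0}. ennreal (norm (f (x + h) - f x) / norm h powr \<alpha>))"

text \<open>
  Functions are identified when equal almost everywhere, so the seminorm of a class is that of its
  best representative. (If it is finite, the class has exactly one continuous representative,
  and it attains the infimum.)
\<close>

definition Lip_seminorm :: "real \<Rightarrow> ('a::euclidean_space \<Rightarrow> complex) \<Rightarrow> ennreal" where
  "Lip_seminorm \<alpha> f = (INF g \<in> {g. AE x in lebesgue. g x = f x}. Lip_sup \<alpha> g)"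

section \<open>Multiple weights\<close>

definition cubes :: "(real^'n) set set" where
  "cubes = {cbox a (\<chi> i. a $ i + h) | a h. 0 < h}"

definition average :: "(real^'n) set \<Rightarrow> (real^'n \<Rightarrow> real) \<Rightarrow> ennreal" where
  "average Q g = (\<integral>\<^sup>+x\<in>Q. ennreal (g x) \<partial>lebesgue) / emeasure lebesgue Q"

definition conj_exp :: "real \<Rightarrow> real" where
  "conj_exp p = p / (p - 1)"

definition mu_weight :: "real \<Rightarrow> ('m::finite \<Rightarrow> 'a \<Rightarrow> real) \<Rightarrow> 'a \<Rightarrow> real" where
  "mu_weight q \<omega> x = (\<Prod>i\<in>UNIV. \<omega> i x powr q)"

text \<open>
  The negative powers in the condition below only make sense for weights that are positive almost
  everywhere. As \<open>0 powr a = 0\<close> in HOL, this has to be required explicitly; otherwise, e.g., the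
  zero weight would qualify. By positivity no product \<open>0 * \<infinity>\<close> can occur.
\<close>

definition A_class :: "('m::finite \<Rightarrow> real) \<Rightarrow> real \<Rightarrow> ('m \<Rightarrow> real^'n \<Rightarrow> real) set" where
  "A_class p q = {\<omega>.
     (\<forall>i. 1 < p i) \<and>
     1 / real CARD('m) < 1 / (\<Sum>i\<in>UNIV. 1 / p i) \<and> 1 / (\<Sum>i\<in>UNIV. 1 / p i) \<le> q \<and>
     (\<forall>i. weight (\<omega> i) \<and> (AE x in lebesgue. 0 < \<omega> i x)) \<and>
     (SUP Q\<in>cubes. epowr (average Q (mu_weight q \<omega>)) (1 / q) *
        (\<Prod>i\<in>UNIV. epowr (average Q (\<lambda>x. \<omega> i x powr (- conj_exp (p i)))) (1 / conj_exp (p i)))) < top}"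

section \<open>Multilinear Calderon--Zygmund operators\<close>

text \<open>
  A kernel is written \<open>K y\<^sub>0 y\<close> with \<open>y = (y\<^sub>1, \<dots>, y\<^sub>m)\<close>. It matters only off the diagonal. The
  index \<open>0\<close> contributes nothing to the maximum of the \<open>|y\<^sub>0 - y\<^sub>k|\<close>. In the regularity
  conditions the moved point stays off the diagonal automatically.
\<close>

type_synonym ('n, 'm) kernel = "real^'n \<Rightarrow> (real^'n)^'m \<Rightarrow> complex"

definition off_diagonal :: "real^'n \<Rightarrow> (real^'n)^'m \<Rightarrow> bool" where
  "off_diagonal y0 y \<longleftrightarrow> (\<exists>k. y $ k \<noteq> y0)"

definition spread :: "real^'n \<Rightarrow> (real^'n)^'m::finite \<Rightarrow> real" where
  "spread y0 y = (\<Sum>k\<in>UNIV. norm (y $ k - y0))"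

definition max_dist :: "real^'n \<Rightarrow> (real^'n)^'m::finite \<Rightarrow> real" where
  "max_dist y0 y = Max (range (\<lambda>k. norm (y0 - y $ k)))"

definition mn :: "'n itself \<Rightarrow> 'm itself \<Rightarrow> real" where
  "mn _ _ = real (CARD('m) * CARD('n))"

definition CZ_kernel :: "('n::finite, 'm::finite) kernel \<Rightarrow> bool" where
  "CZ_kernel K \<longleftrightarrow> (\<exists>C>0. \<exists>\<gamma>>0.
     (\<forall>y0 y. off_diagonal y0 y \<longrightarrow>
        norm (K y0 y) \<le> C * spread y0 y powr (- mn TYPE('n) TYPE('m))) \<and>
     (\<forall>y0 y y0'. off_diagonal y0 y \<longrightarrow> norm (y0 - y0') \<le> max_dist y0 y / 2 \<longrightarrow>
        norm (K y0 y - K y0' y)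
          \<le> C * norm (y0 - y0') powr \<gamma> * spread y0 y powr (- mn TYPE('n) TYPE('m) - \<gamma>)) \<and>
     (\<forall>y0 y i yi'. off_diagonal y0 y \<longrightarrow> norm (y $ i - yi') \<le> max_dist y0 y / 2 \<longrightarrow>
        norm (K y0 y - K y0 (\<chi> j. if j = i then yi' else y $ j))
          \<le> C * norm (y $ i - yi') powr \<gamma> * spread y0 y powr (- mn TYPE('n) TYPE('m) - \<gamma>)))"

definition mn_homogeneous :: "('n::finite, 'm::finite) kernel \<Rightarrow> bool" where
  "mn_homogeneous K \<longleftrightarrow> (\<forall>A\<ge>1. \<exists>C>0. \<exists>N0. \<forall>N\<ge>N0. \<forall>r>0. \<forall>y0 y.
     (\<forall>k. N * r / A \<le> norm (y0 - y $ k) \<and> norm (y0 - y $ k) \<le> A * N * r) \<longrightarrow>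
     (\<forall>x0 x. x0 \<in> ball y0 r \<and> (\<forall>k. x $ k \<in> ball (y $ k) r) \<longrightarrow>
        C * (N * r) powr (- mn TYPE('n) TYPE('m)) \<le> norm (K x0 x)))"

type_synonym ('n, 'm) operator = "('m \<Rightarrow> real^'n \<Rightarrow> complex) \<Rightarrow> real^'n \<Rightarrow> complex"

definition Lp_tuples :: "('m \<Rightarrow> real) \<Rightarrow> ('m \<Rightarrow> 'a::euclidean_space \<Rightarrow> complex) set" where
  "Lp_tuples s = {f. \<forall>i. f i \<in> Lp_space (s i) (\<lambda>_. 1)}"

definition multilinear_on_Lp :: "('m \<Rightarrow> real) \<Rightarrow> ('n::finite, 'm) operator \<Rightarrow> bool" where
  "multilinear_on_Lp s T \<longleftrightarrow> (\<forall>f \<in> Lp_tuples s. \<forall>i. \<forall>g \<in> Lp_space (s i) (\<lambda>_. 1).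
     (AE x in lebesgue. T (f(i := \<lambda>z. f i z + g z)) x = T f x + T (f(i := g)) x) \<and>
     (\<forall>c. AE x in lebesgue. T (f(i := \<lambda>z. c * f i z)) x = c * T f x))"

text \<open>
  \<open>T\<close> is an operator on \<open>L\<^sup>s\<^sup>1 \<times> \<dots> \<times> L\<^sup>s\<^sup>m\<close>; its values elsewhere are irrelevant. Linearity and
  boundedness make it compatible with almost everywhere equality, so that closures of nonzero sets
  of representatives may serve as supports.
\<close>

definition CZ_operator ::
  "('m::finite \<Rightarrow> real) \<Rightarrow> ('n::finite, 'm) operator \<Rightarrow> ('n, 'm) kernel \<Rightarrow> bool" where
  "CZ_operator s T K \<longleftrightarrow>
     (\<forall>i. 1 < s i) \<and>
     multilinear_on_Lp s T \<and>
     (\<exists>C>0. \<forall>f \<in> Lp_tuples s.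
        T f \<in> borel_measurable lebesgue \<and>
        Lp_norm (1 / (\<Sum>i\<in>UNIV. 1 / s i)) (\<lambda>_. 1) (T f)
          \<le> ennreal C * (\<Prod>i\<in>UNIV. Lp_norm (s i) (\<lambda>_. 1) (f i))) \<and>
     CZ_kernel K \<and>
     (\<forall>f \<in> Lp_tuples s. AE x in lebesgue.
        x \<notin> (\<Inter>i. closure {z. f i z \<noteq> 0}) \<longrightarrow>
        T f x = (LINT y|lebesgue. K x y * (\<Prod>i\<in>UNIV. f i (y $ i))))"

section \<open>Commutators\<close>

definition commutator ::
  "(real^'n \<Rightarrow> complex) \<Rightarrow> ('n, 'm) operator \<Rightarrow> 'm \<Rightarrow> ('n, 'm) operator" where
  "commutator b T l f = (\<lambda>x. b x * T f x - T (f(l := \<lambda>z. b z * f l z)) x)"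

text \<open>
  For merely locally integrable \<open>b\<close>, the commutator of an operator \<open>T\<close> on
  \<open>L\<^sup>s\<^sup>1 \<times> \<dots> \<times> L\<^sup>s\<^sup>m\<close> is densely defined: its domain consists of the tuples for which both terms
  are values of \<open>T\<close>.
\<close>

definition commutator_domain ::
  "('m \<Rightarrow> real) \<Rightarrow> ('a::euclidean_space \<Rightarrow> complex) \<Rightarrow> 'm \<Rightarrow> ('m \<Rightarrow> 'a \<Rightarrow> complex) set" where
  "commutator_domain s b l = {f \<in> Lp_tuples s. f(l := \<lambda>z. b z * f l z) \<in> Lp_tuples s}"

text \<open>
  The norm of a densely defined multilinear operator with domain \<open>D\<close> from
  \<open>L\<^sup>p\<^sup>1(w\<^sub>1) \<times> \<dots> \<times> L\<^sup>p\<^sup>m(w\<^sub>m)\<close> to \<open>L\<^sup>q(\<mu>)\<close>, i.e. the norm of its continuous extension, or \<open>\<infinity>\<close>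
  if there is none. See \<open>commutator_domain_dense\<close> below for the density in case of the commutator.
\<close>

definition operator_norm ::
  "('m::finite \<Rightarrow> real^'n \<Rightarrow> complex) set \<Rightarrow> ('m \<Rightarrow> real) \<Rightarrow> ('m \<Rightarrow> real^'n \<Rightarrow> real) \<Rightarrow>
   real \<Rightarrow> (real^'n \<Rightarrow> real) \<Rightarrow> ('n, 'm) operator \<Rightarrow> ennreal" where
  "operator_norm D p w q \<mu> S =
     Inf {C. \<forall>f \<in> D. (\<forall>i. f i \<in> Lp_space (p i) (w i)) \<longrightarrow>
               Lp_norm q \<mu> (S f) \<le> C * (\<Prod>i\<in>UNIV. Lp_norm (p i) (w i) (f i))}"

definition commutator_norm ::
  "('m::finite \<Rightarrow> real) \<Rightarrow> ('n::finite, 'm) operator \<Rightarrow> 'm \<Rightarrow> ('m \<Rightarrow> real) \<Rightarrow> real \<Rightarrow>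
   ('m \<Rightarrow> real^'n \<Rightarrow> real) \<Rightarrow> (real^'n \<Rightarrow> complex) \<Rightarrow> ennreal" where
  "commutator_norm s T l p q \<omega> b =
     operator_norm (commutator_domain s b l) p (\<lambda>i x. \<omega> i x powr p i) q (mu_weight q \<omega>)
       (commutator b T l)"

lemma epowr_tendsto_0:
  assumes "(u \<longlongrightarrow> 0) F" "0 < a"
  shows "((\<lambda>k. epowr (u k) a) \<longlongrightarrow> 0) F"
proof -
  have fin: "\<forall>\<^sub>F k in F. u k < top"
    by (rule order_tendstoD(2)[OF assms(1)]) simp
  have "((\<lambda>k. enn2real (u k)) \<longlongrightarrow> 0) F"
    using tendsto_enn2real[of u 0 F] assms(1) by simp
  then have "((\<lambda>k. enn2real (u k) powr a) \<longlongrightarrow> 0) F"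
    by (rule tendsto_zero_powrI[where b = a]) (use assms in auto)
  then have "((\<lambda>k. ennreal (enn2real (u k) powr a)) \<longlongrightarrow> ennreal 0) F"
    by (rule tendsto_ennrealI)
  then have "((\<lambda>k. ennreal (enn2real (u k) powr a)) \<longlongrightarrow> 0) F"
    by simp
  then show ?thesis
    by (rule Lim_transform_eventually) (use fin in eventually_elim, auto simp: epowr_def)
qed

lemma Lp_space_bounded_support:
  fixes g :: "'a::euclidean_space \<Rightarrow> complex"
  assumes "g \<in> borel_measurable lebesgue" "\<And>x. norm (g x) \<le> B" "\<And>x. R < norm x \<Longrightarrow> g x = 0" "0 < s"
  shows "g \<in> Lp_space s (\<lambda>_. 1)"
proof -
  have "(\<integral>\<^sup>+x. ennreal (norm (g x) powr s * 1) \<partial>lebesgue)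
      \<le> (\<integral>\<^sup>+x. ennreal (B powr s) * indicator (cball (0::'a) R) x \<partial>lebesgue)"
  proof (rule nn_integral_mono)
    fix x :: 'a
    show "ennreal (norm (g x) powr s * 1) \<le> ennreal (B powr s) * indicator (cball 0 R) x"
      using assms(2)[of x] assms(3)[of x] assms(4)
      by (cases "norm x \<le> R") (auto intro!: ennreal_leI powr_mono2)
  qed
  also have "\<dots> = ennreal (B powr s) * emeasure lebesgue (cball 0 R :: 'a set)"
    by (subst nn_integral_cmult_indicator) auto
  also have "\<dots> < top"
    using emeasure_lborel_cball_finite[of "0::'a" R] by (simp add: ennreal_mult_less_top)
  finally show ?thesis
    using assms by (simp add: Lp_space_def Lp_norm_def epowr_def less_top)
qed

lemma commutator_domain_dense:
  fixes f b :: "'a::euclidean_space \<Rightarrow> complex"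
  assumes f: "f \<in> Lp_space r w" and w: "weight w" and b: "b \<in> borel_measurable lebesgue"
    and r: "0 < r" and s: "0 < s"
  obtains g where
    "\<And>k::nat. g k \<in> Lp_space r w \<and> g k \<in> Lp_space s (\<lambda>_. 1) \<and> (\<lambda>x. b x * g k x) \<in> Lp_space s (\<lambda>_. 1)"
    "(\<lambda>k. Lp_norm r w (\<lambda>x. f x - g k x)) \<longlonglongrightarrow> 0"
proof -
  have [measurable]: "f \<in> borel_measurable lebesgue" "w \<in> borel_measurable lebesgue"
      "b \<in> borel_measurable lebesgue" "(\<lambda>x::'a. norm x) \<in> borel_measurable lebesgue"
    using f w b by (auto simp: Lp_space_def weight_def intro!: measurable_completion)
  have wp: "0 \<le> w x" for x using w by (auto simp: weight_def)
  define g where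
    "g k x = (if norm x \<le> real k \<and> norm (f x) \<le> real k \<and> norm (b x) \<le> real k then f x else 0)"
    for k x
  have gm[measurable]: "g k \<in> borel_measurable lebesgue" for k
    unfolding g_def by measurable
  have fin: "(\<integral>\<^sup>+x. ennreal (norm (f x) powr r * w x) \<partial>lebesgue) < top"
    using f by (auto simp: Lp_space_def Lp_norm_def epowr_def less_top split: if_splits)
  show thesis
  proof (rule that)
    fix k :: nat
    have "(\<integral>\<^sup>+x. ennreal (norm (g k x) powr r * w x) \<partial>lebesgue)
        \<le> (\<integral>\<^sup>+x. ennreal (norm (f x) powr r * w x) \<partial>lebesgue)"
      using wp by (intro nn_integral_mono ennreal_leI) (auto simp: g_def)
    then have 1: "g k \<in> Lp_space r w"
      using fin by (auto simp: Lp_space_def Lp_norm_def epowr_def less_top top_unique)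
    have 2: "g k \<in> Lp_space s (\<lambda>_. 1)"
      by (rule Lp_space_bounded_support[where B = "real k" and R = "real k"]) (use s in \<open>auto simp: g_def\<close>)
    have 3: "(\<lambda>x. b x * g k x) \<in> Lp_space s (\<lambda>_. 1)"
      by (rule Lp_space_bounded_support[where B = "real k * real k" and R = "real k"])
         (use s in \<open>auto simp: g_def norm_mult intro!: mult_mono\<close>)
    show "g k \<in> Lp_space r w \<and> g k \<in> Lp_space s (\<lambda>_. 1) \<and> (\<lambda>x. b x * g k x) \<in> Lp_space s (\<lambda>_. 1)"
      using 1 2 3 by simp
  next
    have "(\<lambda>k. \<integral>\<^sup>+x. ennreal (norm (f x - g k x) powr r * w x) \<partial>lebesgue)
        \<longlonglongrightarrow> (\<integral>\<^sup>+(x::'a). 0 \<partial>lebesgue)"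
    proof (rule nn_integral_dominated_convergence[where w = "\<lambda>x. ennreal (norm (f x) powr r * w x)"])
      show "AE x in lebesgue. (\<lambda>k. ennreal (norm (f x - g k x) powr r * w x)) \<longlonglongrightarrow> 0"
      proof (rule AE_I2)
        fix x :: 'a
        obtain k0 where "max (norm x) (max (norm (f x)) (norm (b x))) \<le> real k0"
          using real_arch_simple by blast
        then have "\<forall>\<^sub>F k in sequentially. g k x = f x"
          by (intro eventually_sequentiallyI[of k0]) (auto simp: g_def)
        then have "\<forall>\<^sub>F k in sequentially. 0 = ennreal (norm (f x - g k x) powr r * w x)"
          by eventually_elim simp
        then show "(\<lambda>k. ennreal (norm (f x - g k x) powr r * w x)) \<longlonglongrightarrow> 0"
          by (rule Lim_transform_eventually[OF tendsto_const])
      qed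
    qed (use fin wp in \<open>auto simp: g_def intro!: AE_I2 ennreal_leI\<close>)
    then show "(\<lambda>k. Lp_norm r w (\<lambda>x. f x - g k x)) \<longlonglongrightarrow> 0"
      unfolding Lp_norm_def using r by (intro epowr_tendsto_0) auto
  qed
qed

end

(*
Upper bound. If b is Lipschitz, then almost everywhere |[b,T]f| is at most a multiple of the
multilinear fractional integral of |f|: away from the supports this is the size condition on the
kernel, and the contribution of a cube of side t is O(t^alpha) in L^s, hence disappears as t -> 0.
With sigma_i = omega_i^(-p_i') the weight condition bounds the fractional integral by a sum over
dyadic scales k of mu(Q_k)^(-1/q) prod_i sigma_i(Q_k)^(1/p_i) <f_i/sigma_i>, Q_k = Q(x,2^k). Since
mu(Q_k) and sigma_i(Q_k) grow geometrically in k (an A_infinity property) and p < q, Hedberg's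
argument, applied once to this sum and once inside a Carleson-type embedding, gives the bound.

Lower bound. For two cubes Q, Q' of side t at distance N t, N large, the kernel is nearly constant
on Q x Q'^m. Testing the commutator on the truncations of sigma_i to Q' shows that b deviates from
a constant c by more than C t^alpha + tau/2 only on a small part of Q, if it deviates from some
constant by more than tau only on a small part of Q'. Exchanging Q and Q' absorbs tau, and the
oscillation in measure of size t^alpha on all cubes makes b Hoelder continuous. Working with
oscillations in measure allows q <= 1, complex b, and b that is only locally integrable.
*)

theory Submission
  imports Defs
begin

section \<open>Sums along geometrically growing sequences\<close>

text \<open>On the target side q may be at most 1, so there is neither duality nor a triangle
  inequality; all estimates are pointwise bounds or concern powers of norms. What replaces a maximal
  function is the strict inequality 1/q < 1/P, where 1/P is the sum of the 1/p_i: as \<alpha> > 0,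
  there is room for an exponent r between P and q. The exponents 1/q and 1/p_i' of the weights add
  up to (mn - \<alpha>)/n. This one identity matches the weight condition with a fractional kernel
  of order mn - \<alpha> in the upper bound, and produces exactly the power t^\<alpha> in the lower
  bound. T has a kernel only off the common support of its arguments, and the commutator is defined
  only where b f_l is admissible too. So the upper bound splits off a local part that is controlled
  by the unweighted bound of T alone, and the test functions of the lower bound must be bounded and
  avoid large values of b. Homogeneity bounds |K| from below but says nothing about its phase.
  Regularity supplies this: at distance N t the relative oscillation of K on cubes of size t is
  O(N^(-\<gamma>)).\<close>

lemma nn_integral_geometric_bound:
  fixes \<theta> :: real
  assumes "0 \<le> \<theta>" "\<theta> < 1" "0 \<le> c" "\<And>j. 0 \<le> f j" "\<And>j. f j \<le> c * \<theta> ^ j"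
  shows "(\<integral>\<^sup>+j. ennreal (f j) \<partial>count_space (UNIV :: nat set)) \<le> ennreal (c / (1 - \<theta>))"
proof -
  have s: "(\<lambda>j. c * \<theta> ^ j) sums (c / (1 - \<theta>))"
    using sums_mult[OF geometric_sums[of \<theta>], of c] assms by simp
  have "(\<integral>\<^sup>+j. ennreal (f j) \<partial>count_space (UNIV :: nat set)) = (\<Sum>j. ennreal (f j))"
    by (rule nn_integral_count_space_nat)
  also have "\<dots> \<le> (\<Sum>j. ennreal (c * \<theta> ^ j))"
    by (intro suminf_le ennreal_leI assms) auto
  also have "\<dots> = ennreal (c / (1 - \<theta>))"
    using s assms by (intro suminf_ennreal_eq) auto
  finally show ?thesis .
qed

lemma geometric_growth:
  fixes s :: "int \<Rightarrow> real"
  assumes "\<And>k. \<rho> * s k \<le> s (k + 1)" "1 \<le> \<rho>"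
  shows "\<rho> ^ j * s k \<le> s (k + int j)"
proof (induction j)
  case (Suc j)
  have "\<rho> ^ Suc j * s k \<le> \<rho> * s (k + int j)"
    using mult_left_mono[OF Suc, of \<rho>] assms(2) by (simp add: mult.assoc)
  also have "\<dots> \<le> s (k + int (Suc j))"
    using assms(1)[of "k + int j"] by (simp add: ac_simps)
  finally show ?case .
qed simp

text \<open>Iterating the growth forwards makes \<open>s\<close> exceed 1, iterating it backwards
  pushes it down to at most 1. The two regimes of the sums below meet at the crossing index.\<close>

lemma geometric_crossing:
  fixes s :: "int \<Rightarrow> real"
  assumes pos: "\<And>k. 0 < s k" and grow: "\<And>k. \<rho> * s k \<le> s (k + 1)" and \<rho>: "1 < \<rho>"
  obtains k0 where "s k0 \<le> 1" "1 < s (k0 + 1)"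
proof -
  have up: "\<rho> ^ j * s k \<le> s (k + int j)" for j k
    using geometric_growth[of \<rho> s, OF grow] \<rho> by auto
  obtain j where j: "1 / s 0 < \<rho> ^ j" using real_arch_pow[OF \<rho>] by blast
  obtain j' where j': "s 0 < \<rho> ^ j'" using real_arch_pow[OF \<rho>] by blast
  have hi: "1 < s (int j)" using up[of j 0] j pos[of 0] by (simp add: field_simps)
  have "\<rho> ^ j' * s (- int j') < \<rho> ^ j' * 1" using up[of j' "- int j'"] j' by simp
  then have lo: "s (- int j') \<le> 1" using \<rho> by (subst (asm) mult_less_cancel_left_pos) auto
  have "mono s"
  proof (rule monoI)
    fix a b :: int assume "a \<le> b"
    have "1 * s a \<le> \<rho> ^ nat (b - a) * s a"
      by (intro mult_right_mono one_le_power) (use \<rho> pos[of a] in auto)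
    then show "s a \<le> s b" using up[of "nat (b - a)" a] \<open>a \<le> b\<close> by simp
  qed
  \<comment> \<open>The integers have no least element, so the search starts at
    \<open>- int j'\<close>, where \<open>s\<close> is still at most 1. Hence \<open>N\<close> is
    not 0, and its predecessor has not crossed yet.\<close>
  define N where "N = (LEAST i::nat. 1 < s (- int j' + int i))"
  have "1 < s (- int j' + int (j' + j))" using hi by simp
  then have N1: "1 < s (- int j' + int N)" unfolding N_def by (rule LeastI)
  then have "N \<noteq> 0" using lo by (metis add.right_neutral not_less of_nat_0)
  then have "\<not> 1 < s (- int j' + int (N - 1))"
    using not_less_Least[of "N - 1" "\<lambda>i. 1 < s (- int j' + int i)"] unfolding N_def by simp
  then show thesis
    using N1 \<open>N \<noteq> 0\<close> that[of "- int j' + int (N - 1)"] by (simp add: of_nat_diff)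
qed

text \<open>Split at the crossing of level 1. Downwards from it, \<open>s k powr a\<close> decays at
  least like powers of \<open>\<rho> powr (- a)\<close>; upwards, \<open>s k powr (- b)\<close>
  decays at least like powers of \<open>\<rho> powr (- b)\<close>. Both geometric series have first
  term at most 1, whatever the sequence is.\<close>

lemma geometric_sum_min_aux:
  fixes \<rho> a b :: real
  assumes \<rho>: "1 < \<rho>" and a: "0 < a" and b: "0 < b"
    and pos: "\<And>k. 0 < s k" and grow: "\<And>k. \<rho> * s k \<le> s (k + 1)"
  shows "(\<integral>\<^sup>+k. ennreal (min (s k powr a) (s k powr (- b))) \<partial>count_space (UNIV :: int set))
           \<le> ennreal (1 / (1 - \<rho> powr (- a)) + 1 / (1 - \<rho> powr (- b)))"
proof -
  obtain k0 where k0: "s k0 \<le> 1" "1 < s (k0 + 1)"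
    using geometric_crossing[of s \<rho>] pos grow \<rho> by blast
  have up: "\<rho> ^ j * s k \<le> s (k + int j)" for j k
    using geometric_growth[of \<rho> s, OF grow] \<rho> by auto
  define F where "F k = ennreal (min (s k powr a) (s k powr (- b)))" for k
  have lo: "(\<integral>\<^sup>+j. F (k0 - int j) \<partial>count_space (UNIV :: nat set)) \<le> ennreal (1 / (1 - \<rho> powr (- a)))"
    unfolding F_def
  proof (rule nn_integral_geometric_bound)
    fix j
    have "\<rho> ^ j * s (k0 - int j) \<le> 1" using up[of j "k0 - int j"] k0 by simp
    then have "s (k0 - int j) \<le> \<rho> powr (- real j)"
      using \<rho> by (simp add: powr_minus powr_realpow field_simps)
    then have "s (k0 - int j) powr a \<le> (\<rho> powr (- real j)) powr a"
      using pos[of "k0 - int j"] a by (intro powr_mono2) auto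
    also have "\<dots> = 1 * (\<rho> powr (- a)) ^ j"
      using \<rho> by (simp add: powr_powr powr_realpow[symmetric] mult.commute)
    finally show "min (s (k0 - int j) powr a) (s (k0 - int j) powr (- b)) \<le> 1 * (\<rho> powr (- a)) ^ j"
      by simp
  qed (use \<rho> a in \<open>auto simp: powr_less_one\<close>)
  have hi: "(\<integral>\<^sup>+j. F (k0 + 1 + int j) \<partial>count_space (UNIV :: nat set)) \<le> ennreal (1 / (1 - \<rho> powr (- b)))"
    unfolding F_def
  proof (rule nn_integral_geometric_bound)
    fix j
    have "\<rho> ^ j * 1 \<le> \<rho> ^ j * s (k0 + 1)" using k0 \<rho> by (intro mult_left_mono) auto
    then have "\<rho> powr (real j) \<le> s (k0 + 1 + int j)"
      using order_trans[OF _ up[of j "k0 + 1"]] \<rho> by (simp add: powr_realpow)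
    then have "s (k0 + 1 + int j) powr (- b) \<le> (\<rho> powr (real j)) powr (- b)"
      using \<rho> b by (intro powr_mono2') auto
    also have "\<dots> = 1 * (\<rho> powr (- b)) ^ j"
      using \<rho> by (simp add: powr_powr powr_realpow[symmetric] mult.commute)
    finally show "min (s (k0 + 1 + int j) powr a) (s (k0 + 1 + int j) powr (- b)) \<le> 1 * (\<rho> powr (- b)) ^ j"
      by simp
  qed (use \<rho> b in \<open>auto simp: powr_less_one\<close>)
  have b1: "bij_betw (\<lambda>j. k0 - int j) (UNIV :: nat set) {..k0}"
    by (rule bij_betwI[where g = "\<lambda>k. nat (k0 - k)"]) auto
  have b2: "bij_betw (\<lambda>j. k0 + 1 + int j) (UNIV :: nat set) {k0<..}"
    by (rule bij_betwI[where g = "\<lambda>k. nat (k - k0 - 1)"]) auto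
  have "(\<integral>\<^sup>+k. F k \<partial>count_space UNIV)
      = (\<integral>\<^sup>+k. F k * indicator {..k0} k + F k * indicator {k0<..} k \<partial>count_space UNIV)"
    by (intro nn_integral_cong) (auto split: split_indicator)
  also have "\<dots> = (\<integral>\<^sup>+k. F k * indicator {..k0} k \<partial>count_space UNIV)
      + (\<integral>\<^sup>+k. F k * indicator {k0<..} k \<partial>count_space UNIV)"
    by (intro nn_integral_add) auto
  also have "(\<integral>\<^sup>+k. F k * indicator {..k0} k \<partial>count_space UNIV) = (\<integral>\<^sup>+k. F k \<partial>count_space {..k0})"
    by (simp add: nn_integral_count_space_indicator)
  also have "\<dots> = (\<integral>\<^sup>+j. F (k0 - int j) \<partial>count_space (UNIV :: nat set))"
    by (rule nn_integral_bij_count_space[symmetric, OF b1])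
  also have "(\<integral>\<^sup>+k. F k * indicator {k0<..} k \<partial>count_space UNIV) = (\<integral>\<^sup>+k. F k \<partial>count_space {k0<..})"
    by (simp add: nn_integral_count_space_indicator)
  also have "\<dots> = (\<integral>\<^sup>+j. F (k0 + 1 + int j) \<partial>count_space (UNIV :: nat set))"
    by (rule nn_integral_bij_count_space[symmetric, OF b2])
  also have "(\<integral>\<^sup>+j. F (k0 - int j) \<partial>count_space (UNIV :: nat set))
        + (\<integral>\<^sup>+j. F (k0 + 1 + int j) \<partial>count_space (UNIV :: nat set))
      \<le> ennreal (1 / (1 - \<rho> powr (- a))) + ennreal (1 / (1 - \<rho> powr (- b)))"
    by (intro add_mono lo hi)
  also have "\<dots> = ennreal (1 / (1 - \<rho> powr (- a)) + 1 / (1 - \<rho> powr (- b)))"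
    using \<rho> a b by (intro ennreal_plus[symmetric]) (auto simp: powr_less_one less_imp_le)
  finally show ?thesis unfolding F_def .
qed

definition geo_const :: "real \<Rightarrow> real \<Rightarrow> real \<Rightarrow> real" where
  "geo_const \<rho> a b = 1 / (1 - \<rho> powr (- a)) + 1 / (1 - \<rho> powr (- b))"

lemma geo_const_pos: "1 < \<rho> \<Longrightarrow> 0 < a \<Longrightarrow> 0 < b \<Longrightarrow> 0 < geo_const \<rho> a b"
  unfolding geo_const_def by (intro add_pos_pos divide_pos_pos) (auto simp: powr_less_one)

text \<open>The two bounds cross where \<open>s k powr (a + b) = B / A\<close>.\<close>

lemma geometric_sum_min:
  fixes \<rho> a b :: real
  assumes \<rho>: "1 < \<rho>" and a: "0 < a" and b: "0 < b" and A: "0 \<le> A" and B: "0 \<le> B"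
    and pos: "\<And>k. 0 < s k" and grow: "\<And>k. \<rho> * s k \<le> s (k + 1)"
  shows "(\<integral>\<^sup>+k. ennreal (min (A * s k powr a) (B * s k powr (- b))) \<partial>count_space (UNIV :: int set))
           \<le> ennreal (geo_const \<rho> a b * (A powr (b / (a + b)) * B powr (a / (a + b))))"
proof (cases "A = 0 \<or> B = 0")
  case True
  have "min (A * s k powr a) (B * s k powr (- b)) = 0" for k
    using True A B by (elim disjE) (simp_all add: min_absorb1 min_absorb2)
  then show ?thesis by simp
next
  case False
  with A B have A: "0 < A" and B: "0 < B" by auto
  define \<kappa> where "\<kappa> = (B / A) powr (1 / (a + b))"
  \<comment> \<open>The common value of the two bounds at their crossing. Dividing \<open>s\<close>
    by \<open>\<kappa>\<close> moves the crossing to level 1 and pulls out the factor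
    \<open>H\<close>.\<close>
  define H where "H = A powr (b / (a + b)) * B powr (a / (a + b))"
  have \<kappa>: "0 < \<kappa>" using A B by (simp add: \<kappa>_def)
  have ab: "1 - a / (a + b) = b / (a + b)" "1 - b / (a + b) = a / (a + b)"
    using a b by (auto simp: field_simps)
  have H1: "A * \<kappa> powr a = H"
  proof -
    have "A * \<kappa> powr a = A powr 1 * (B powr (a / (a + b)) * A powr (- (a / (a + b))))"
      using A B by (simp add: \<kappa>_def powr_powr powr_divide powr_minus_divide field_simps)
    also have "\<dots> = A powr (1 - a / (a + b)) * B powr (a / (a + b))"
      by (simp only: powr_add diff_conv_add_uminus mult_ac)
    finally show ?thesis by (simp add: ab H_def)
  qed
  have H2: "B * \<kappa> powr (- b) = H"
  proof -
    have "B * \<kappa> powr (- b) = B powr 1 * (B powr (- (b / (a + b))) * A powr (b / (a + b)))"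
      using A B by (simp add: \<kappa>_def powr_powr powr_divide powr_minus_divide field_simps)
    also have "\<dots> = B powr (1 - b / (a + b)) * A powr (b / (a + b))"
      by (simp only: powr_add diff_conv_add_uminus mult_ac)
    finally show ?thesis by (simp add: ab H_def)
  qed
  have H: "0 < H" using A B by (simp add: H_def)
  have eq: "min (A * s k powr a) (B * s k powr (- b))
      = H * min ((s k / \<kappa>) powr a) ((s k / \<kappa>) powr (- b))" for k
  proof -
    have "A * s k powr a = H * (s k / \<kappa>) powr a"
      using pos[of k] \<kappa> unfolding H1[symmetric] by (simp add: powr_divide)
    moreover have "B * s k powr (- b) = H * (s k / \<kappa>) powr (- b)"
      using pos[of k] \<kappa> unfolding H2[symmetric] by (simp add: powr_divide)
    ultimately show ?thesis using H by (simp add: min_mult_distrib_left)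
  qed
  have "(\<integral>\<^sup>+k. ennreal (min (A * s k powr a) (B * s k powr (- b))) \<partial>count_space (UNIV :: int set))
     = (\<integral>\<^sup>+k. ennreal H * ennreal (min ((s k / \<kappa>) powr a) ((s k / \<kappa>) powr (- b))) \<partial>count_space (UNIV :: int set))"
    using H by (simp add: eq ennreal_mult)
  also have "\<dots> = ennreal H * (\<integral>\<^sup>+k. ennreal (min ((s k / \<kappa>) powr a) ((s k / \<kappa>) powr (- b))) \<partial>count_space (UNIV :: int set))"
    by (rule nn_integral_cmult) auto
  also have "\<dots> \<le> ennreal H * ennreal (geo_const \<rho> a b)"
    unfolding geo_const_def
    by (intro mult_left_mono geometric_sum_min_aux[OF \<rho> a b])
       (use pos grow \<kappa> in \<open>auto simp: divide_simps\<close>)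
  also have "\<dots> = ennreal (geo_const \<rho> a b * H)"
    using H by (simp add: ennreal_mult'[symmetric] mult.commute)
  finally show ?thesis unfolding H_def .
qed

section \<open>Centred cubes\<close>

text \<open>A closed ball of the maximum norm, with side \<open>2 * t\<close>. Indexing cubes by
  their centres makes membership symmetric in the two points, and every exchange of integrals below
  rests on this symmetry.\<close>

definition ccube :: "real^'n::finite \<Rightarrow> real \<Rightarrow> (real^'n) set" where
  "ccube x t = {y. \<forall>i. \<bar>y $ i - x $ i\<bar> \<le> t}"

lemma ccube_eq_cbox: "ccube x t = cbox (\<chi> i. x $ i - t) (\<chi> i. x $ i + t)"
  by (auto simp: ccube_def mem_box_cart abs_le_iff algebra_simps)

lemma ccube_sets[measurable]: "ccube x t \<in> sets lebesgue"
  by (simp add: ccube_eq_cbox)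

lemma closed_ccube: "closed (ccube x t)"
  unfolding ccube_eq_cbox by (rule closed_cbox)

lemma bounded_ccube: "bounded (ccube x t)"
  by (simp add: ccube_eq_cbox)

lemma ccube_lmeasurable: "ccube x t \<in> lmeasurable"
  by (simp add: ccube_eq_cbox)

lemma emeasure_ccube_finite: "emeasure lebesgue (ccube x t) < \<infinity>"
  using ccube_lmeasurable by (simp add: fmeasurable_def)

lemma measure_ccube:
  fixes x :: "real^'n"
  assumes "0 \<le> t"
  shows "measure lebesgue (ccube x t) = (2 * t) ^ CARD('n)"
proof -
  have "(\<chi> i. x $ i - t) \<in> cbox (\<chi> i. x $ i - t) (\<chi> i. x $ i + t)"
    using assms by (auto simp: mem_box_cart)
  then show ?thesis
    unfolding ccube_eq_cbox using content_cbox_cart[of "\<chi> i. x $ i - t" "\<chi> i. x $ i + t"] by auto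
qed

lemma emeasure_ccube:
  fixes x :: "real^'n"
  assumes "0 \<le> t"
  shows "emeasure lebesgue (ccube x t) = ennreal ((2 * t) ^ CARD('n))"
  using measure_ccube[OF assms, of x] emeasure_ccube_finite[of x t]
  by (simp add: emeasure_eq_ennreal_measure)

lemma ccube_in_cubes:
  fixes x :: "real^'n"
  assumes "0 < t" shows "ccube x t \<in> cubes"
proof -
  have "ccube x t = cbox (\<chi> i. x $ i - t) (\<chi> i. (\<chi> i. x $ i - t) $ i + 2 * t)"
    by (simp add: ccube_eq_cbox algebra_simps)
  then show ?thesis unfolding cubes_def using assms by fastforce
qed

lemma mem_ccube_commute: "y \<in> ccube x t \<longleftrightarrow> x \<in> ccube y t"
  by (simp add: ccube_def abs_minus_commute)

lemma ccube_subset: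
  assumes "y \<in> ccube x t" shows "ccube y u \<subseteq> ccube x (t + u)"
proof
  fix z assume z: "z \<in> ccube y u"
  show "z \<in> ccube x (t + u)" unfolding ccube_def
  proof (rule CollectI, rule allI)
    fix i
    have "\<bar>y $ i - x $ i\<bar> \<le> t" "\<bar>z $ i - y $ i\<bar> \<le> u" using z assms by (auto simp: ccube_def)
    then show "\<bar>z $ i - x $ i\<bar> \<le> t + u" by linarith
  qed
qed

lemma ccube_mono: "t \<le> u \<Longrightarrow> ccube x t \<subseteq> ccube x u"
  unfolding ccube_def by (auto intro: order_trans)

lemma norm_le_imp_ccube: "norm (y - x) \<le> t \<Longrightarrow> y \<in> ccube x t"
  unfolding ccube_def using component_le_norm_cart[of "y - x"] order_trans by fastforce

lemma ccube_norm_le: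
  fixes x :: "real^'n"
  assumes "y \<in> ccube x t" shows "norm (y - x) \<le> real CARD('n) * t"
proof -
  have "norm (y - x) \<le> (\<Sum>i\<in>UNIV. \<bar>(y - x) $ i\<bar>)" by (rule norm_le_l1_cart)
  also have "\<dots> \<le> (\<Sum>i\<in>(UNIV :: 'n set). t)"
    using assms by (intro sum_mono) (auto simp: ccube_def)
  finally show ?thesis by simp
qed

lemma vec_nth_lebesgue_measurable[measurable]: "(\<lambda>x::real^'n. x $ i) \<in> borel_measurable lebesgue"
  by (rule measurable_completion) (simp add: borel_measurable_continuous_onI continuous_on_component)

lemma pred_ccube[measurable]:
  fixes f g :: "'a \<Rightarrow> real^'n"
  assumes [measurable]: "f \<in> measurable M lebesgue" "g \<in> measurable M lebesgue"
  shows "Measurable.pred M (\<lambda>w. g w \<in> ccube (f w) t)"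
proof -
  have [measurable]: "(\<lambda>w. f w $ i) \<in> borel_measurable M" "(\<lambda>w. g w $ i) \<in> borel_measurable M" for i
    using measurable_compose[OF assms(1) vec_nth_lebesgue_measurable]
      measurable_compose[OF assms(2) vec_nth_lebesgue_measurable] by auto
  show ?thesis unfolding ccube_def by simp measurable
qed

lemma sigma_finite_lebesgue: "sigma_finite_measure (lebesgue :: 'a::euclidean_space measure)"
proof -
  obtain A :: "'a set set" where "countable A" "A \<subseteq> sets lborel" "\<Union>A = space lborel" "\<forall>a\<in>A. emeasure lborel a \<noteq> \<infinity>"
    using lborel.sigma_finite_countable by blast
  then show ?thesis
    by (intro sigma_finite_measure.intro exI[of _ A]) (auto simp: emeasure_completion)
qed

lemma pair_sigma_finite_density:
  assumes "u \<in> borel_measurable lebesgue" "v \<in> borel_measurable lebesgue"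
  shows "pair_sigma_finite (density lebesgue (\<lambda>x::'a::euclidean_space. ennreal (u x))) 
     (density lebesgue (\<lambda>x::'b::euclidean_space. ennreal (v x)))"
proof -
  have 1: "sigma_finite_measure (density lebesgue (\<lambda>x::'c::euclidean_space. ennreal (w x)))" 
    if "w \<in> borel_measurable lebesgue" for w
    using sigma_finite_measure.sigma_finite_iff_density_finite[OF sigma_finite_lebesgue, of "\<lambda>x. ennreal (w x)"] that
    by auto
  show ?thesis
    by (intro pair_sigma_finite.intro 1 assms)
qed

lemma ccube_nn_integral_measurable[measurable]:
  fixes h :: "real^'n \<Rightarrow> ennreal"
  assumes [measurable]: "h \<in> borel_measurable lebesgue"
  shows "(\<lambda>x. \<integral>\<^sup>+y\<in>ccube x t. h y \<partial>lebesgue) \<in> borel_measurable lebesgue"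
proof -
  interpret sigma_finite_measure "lebesgue :: (real^'n) measure" by (rule sigma_finite_lebesgue)
  \<comment> \<open>The set in the indicator moves with the outer variable. Written as a
    conditional, the integrand is jointly measurable by \<open>pred_ccube\<close>.\<close>
  have eq: "h y * indicator (ccube x t) y = (if y \<in> ccube x t then h y else 0)" for x y by simp
  show ?thesis unfolding eq by measurable
qed

lemma emeasure_density_ccube_measurable[measurable]:
  fixes w :: "real^'n \<Rightarrow> ennreal"
  assumes [measurable]: "w \<in> borel_measurable lebesgue"
  shows "(\<lambda>x. emeasure (density lebesgue w) (ccube x t)) \<in> borel_measurable lebesgue"
  by (subst emeasure_density) auto

text \<open>Averaging over the centre of the cube takes the place of a covering argument.\<close>

lemma emeasure_le_if_ccube_le:
  fixes W :: "(real^'n) set" and h :: "real^'n \<Rightarrow> ennreal"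
  assumes [measurable]: "W \<in> sets lebesgue" "h \<in> borel_measurable lebesgue" and t: "0 < t" "0 \<le> c"
    and le: "\<And>x. emeasure lebesgue (W \<inter> ccube x t) \<le> ennreal c * (\<integral>\<^sup>+y\<in>ccube x (3 * t). h y \<partial>lebesgue)"
  shows "emeasure lebesgue W \<le> ennreal (c * 3 ^ CARD('n)) * (\<integral>\<^sup>+y. h y \<partial>lebesgue)"
proof -
  interpret pair_sigma_finite "lebesgue :: (real^'n) measure" "lebesgue :: (real^'n) measure"
    by (intro pair_sigma_finite.intro sigma_finite_lebesgue)
  \<comment> \<open>A point \<open>y\<close> lies in \<open>ccube x r\<close> for a set of centres
    \<open>x\<close> of measure \<open>(2 * r) ^ CARD('n)\<close>, so integration over the centre
    counts all points equally.\<close>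
  have swap: "(\<integral>\<^sup>+x. (\<integral>\<^sup>+y\<in>ccube x r. g y \<partial>lebesgue) \<partial>lebesgue) = (\<integral>\<^sup>+y. g y \<partial>lebesgue) * ennreal ((2 * r) ^ CARD('n))"
    if [measurable]: "g \<in> borel_measurable lebesgue" and r: "0 < r" for g :: "real^'n \<Rightarrow> ennreal" and r
  proof -
    have eq: "g y * indicator (ccube x r) y = (if y \<in> ccube x r then g y else 0)" for x y by simp
    have "(\<integral>\<^sup>+x. (\<integral>\<^sup>+y\<in>ccube x r. g y \<partial>lebesgue) \<partial>lebesgue)
        = (\<integral>\<^sup>+y. \<integral>\<^sup>+x. g y * indicator (ccube x r) y \<partial>lebesgue \<partial>lebesgue)"
      unfolding eq by (rule Fubini'[symmetric]) measurable
    also have "\<dots> = (\<integral>\<^sup>+y. \<integral>\<^sup>+x. g y * indicator (ccube y r) x \<partial>lebesgue \<partial>lebesgue)"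
      by (simp add: indicator_def mem_ccube_commute)
    also have "\<dots> = (\<integral>\<^sup>+y. g y * ennreal ((2 * r) ^ CARD('n)) \<partial>lebesgue)"
      using r by (intro nn_integral_cong) (simp only: nn_integral_cmult_indicator[OF ccube_sets] emeasure_ccube less_imp_le)
    finally show ?thesis by (simp add: nn_integral_multc)
  qed
  have "emeasure lebesgue W * ennreal ((2 * t) ^ CARD('n))
      = (\<integral>\<^sup>+x. emeasure lebesgue (W \<inter> ccube x t) \<partial>lebesgue)"
  proof -
    have "(\<integral>\<^sup>+y\<in>ccube x t. indicator W y \<partial>lebesgue) = emeasure lebesgue (W \<inter> ccube x t)" for x
      unfolding nn_integral_indicator[OF sets.Int[OF assms(1) ccube_sets], symmetric]
      by (intro nn_integral_cong) (simp split: split_indicator)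
    then show ?thesis
      using swap[of "indicator W" t] t by (simp only: nn_integral_indicator[OF assms(1)] borel_measurable_indicator[OF assms(1)] simp_thms)
  qed
  also have "\<dots> \<le> (\<integral>\<^sup>+x. ennreal c * (\<integral>\<^sup>+y\<in>ccube x (3 * t). h y \<partial>lebesgue) \<partial>lebesgue)"
    by (intro nn_integral_mono le)
  also have "\<dots> = ennreal c * ((\<integral>\<^sup>+y. h y \<partial>lebesgue) * ennreal ((2 * (3 * t)) ^ CARD('n)))"
    using swap[of h "3 * t"] t by (subst nn_integral_cmult) auto
  \<comment> \<open>The larger cubes count each point \<open>3 ^ CARD('n)\<close> times as much as
    the smaller ones; nothing else is lost.\<close>
  also have "(2 * (3 * t)) ^ CARD('n) = 3 ^ CARD('n) * (2 * t) ^ CARD('n)"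
    by (simp only: mult.left_commute[of 2 3] power_mult_distrib)
  also have "ennreal c * ((\<integral>\<^sup>+y. h y \<partial>lebesgue) * ennreal (3 ^ CARD('n) * (2 * t) ^ CARD('n)))
      = (ennreal (c * 3 ^ CARD('n)) * (\<integral>\<^sup>+y. h y \<partial>lebesgue)) * ennreal ((2 * t) ^ CARD('n))"
    using t by (simp add: ennreal_mult mult_ac)
  finally have "ennreal ((2 * t) ^ CARD('n)) * emeasure lebesgue W
      \<le> ennreal ((2 * t) ^ CARD('n)) * (ennreal (c * 3 ^ CARD('n)) * (\<integral>\<^sup>+y. h y \<partial>lebesgue))"
    by (simp only: mult.commute)
  then show ?thesis
    by (rule ennreal_mult_le_mult_iff[THEN iffD1, rotated 2]) (use t in auto)
qed

section \<open>Lebesgue measure on tuples of vectors\<close>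

lemma prod_Basis_vec:
  fixes f :: "'a::euclidean_space^'m::finite \<Rightarrow> real"
  shows "(\<Prod>b\<in>Basis. f b) = (\<Prod>i\<in>UNIV. \<Prod>u\<in>Basis. f (axis i u))"
proof -
  have "bij_betw (\<lambda>(i, u). axis i u) (UNIV \<times> Basis) (Basis :: ('a^'m) set)"
    unfolding bij_betw_def Basis_vec_def
    by (auto simp: inj_on_def axis_eq_axis nonzero_Basis)
  then have "(\<Prod>b\<in>Basis. f b) = (\<Prod>(i, u)\<in>UNIV \<times> Basis. f (axis i u))"
    by (simp add: prod.reindex_bij_betw[symmetric] case_prod_unfold)
  then show ?thesis by (simp add: prod.cartesian_product)
qed

lemma vec_lambda_measurable:
  "(\<lambda>f. \<chi> i. f i) \<in> measurable (PiM UNIV (\<lambda>_::'m::finite. lborel :: 'a::euclidean_space measure)) borel"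
proof -
  have "(\<lambda>f. (\<chi> i. f i) \<bullet> b) \<in> borel_measurable (PiM UNIV (\<lambda>_::'m. lborel :: 'a measure))"
    if bB: "b \<in> Basis" for b :: "'a^'m"
  proof -
    obtain i u where b: "b = axis i u" "u \<in> Basis" using bB by (auto simp: Basis_vec_def)
    have "(\<lambda>f. f i \<bullet> u) \<in> borel_measurable (PiM UNIV (\<lambda>_::'m. lborel :: 'a measure))"
      by measurable
    then show ?thesis by (simp add: b inner_axis)
  qed
  then show ?thesis by (subst borel_measurable_euclidean_space) auto
qed

text \<open>Lebesgue measure is determined by its values on boxes, and a box of tuples is a product
  of boxes. Product formulas for integrals over tuples are thereby inherited from the product
  measure.\<close>

lemma lborel_vec:
  "(lborel :: ('a::euclidean_space^'m::finite) measure) = distr (PiM UNIV (\<lambda>_. lborel)) borel (\<lambda>f. \<chi> i. f i)"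
proof (rule lborel_eqI)
  interpret product_sigma_finite "\<lambda>_::'m. lborel :: 'a measure" ..
  fix l u :: "'a^'m" assume lu: "\<And>b. b \<in> Basis \<Longrightarrow> l \<bullet> b \<le> u \<bullet> b"
  have lu': "l $ i \<bullet> b \<le> u $ i \<bullet> b" if "b \<in> Basis" for i b
    using lu[of "axis i b"] that by (auto simp: inner_axis Basis_vec_def)
  have "(\<lambda>f. \<chi> i. f i) -` box l u \<inter> space (PiM UNIV (\<lambda>_::'m. lborel :: 'a measure))
      = Pi\<^sub>E UNIV (\<lambda>i. box (l $ i) (u $ i))"
    by (auto simp: space_PiM mem_box Basis_vec_def inner_axis PiE_iff)
  then have "emeasure (distr (PiM UNIV (\<lambda>_. lborel)) borel (\<lambda>f. \<chi> i. f i)) (box l u)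
     = emeasure (PiM UNIV (\<lambda>_::'m. lborel :: 'a measure)) (Pi\<^sub>E UNIV (\<lambda>i. box (l $ i) (u $ i)))"
    by (subst emeasure_distr[OF vec_lambda_measurable]) auto
  also have "\<dots> = (\<Prod>i\<in>UNIV. emeasure lborel (box (l $ i) (u $ i)))"
    by (rule emeasure_PiM) auto
  also have "\<dots> = (\<Prod>i\<in>UNIV. ennreal (\<Prod>b\<in>Basis. (u $ i - l $ i) \<bullet> b))"
    using lu' by (simp add: emeasure_lborel_box_eq)
  also have "\<dots> = ennreal (\<Prod>i\<in>UNIV. \<Prod>b\<in>Basis. (u $ i - l $ i) \<bullet> b)"
    using lu' by (intro prod_ennreal prod_nonneg) (auto simp: inner_diff_left)
  also have "(\<Prod>i\<in>UNIV. \<Prod>b\<in>Basis. (u $ i - l $ i) \<bullet> b) = (\<Prod>b\<in>Basis. (u - l) \<bullet> b)"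
    by (simp add: prod_Basis_vec inner_axis)
  finally show "emeasure (distr (PiM UNIV (\<lambda>_. lborel)) borel (\<lambda>f. \<chi> i. f i)) (box l u)
     = ennreal (\<Prod>b\<in>Basis. (u - l) \<bullet> b)" .
qed simp

lemma vec_nth_borel_measurable[measurable]:
  "(\<lambda>y::'a::euclidean_space^'m::finite. y $ i) \<in> borel_measurable borel"
  by (simp add: borel_measurable_continuous_onI continuous_on_component)

text \<open>A cylinder over a null set is a product set with one factor of measure 0. The other
  factors are infinite, but 0 times infinity is 0 in \<open>ennreal\<close>.\<close>

lemma null_sets_vec_nth:
  fixes N :: "'a::euclidean_space set"
  assumes N: "N \<in> null_sets lborel"
  shows "{y::'a^'m::finite. y $ i \<in> N} \<in> null_sets lborel"
proof (rule null_setsI)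
  interpret product_sigma_finite "\<lambda>_::'m. lborel :: 'a measure" ..
  have [measurable]: "N \<in> sets borel" using N by (auto simp: null_sets_def)
  show s: "{y::'a^'m. y $ i \<in> N} \<in> sets lborel"
    using measurable_sets[OF vec_nth_borel_measurable, of N i] by (simp add: vimage_def)
  have mem: "(\<forall>j. f j \<in> (if j = i then N else UNIV)) \<longleftrightarrow> f i \<in> N" for f :: "'m \<Rightarrow> 'a"
  proof
    assume "\<forall>j. f j \<in> (if j = i then N else UNIV)"
    from spec[OF this, of i] show "f i \<in> N" by simp
  qed simp
  have "(\<lambda>f. \<chi> i. f i) -` {y. y $ i \<in> N} \<inter> space (PiM UNIV (\<lambda>_::'m. lborel :: 'a measure))
      = {f. f i \<in> N}"
    by (auto simp: space_PiM)
  also have "\<dots> = Pi\<^sub>E UNIV (\<lambda>j. if j = i then N else UNIV)"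
    unfolding PiE_UNIV_domain Pi_def by (simp only: mem UNIV_I simp_thms)
  finally have eq: "(\<lambda>f. \<chi> i. f i) -` {y. y $ i \<in> N} \<inter> space (PiM UNIV (\<lambda>_::'m. lborel :: 'a measure))
      = Pi\<^sub>E UNIV (\<lambda>j. if j = i then N else UNIV)" .
  have "emeasure (lborel :: ('a^'m) measure) {y. y $ i \<in> N}
     = emeasure (PiM UNIV (\<lambda>_::'m. lborel :: 'a measure)) (Pi\<^sub>E UNIV (\<lambda>j. if j = i then N else UNIV))"
    using s by (subst lborel_vec, subst emeasure_distr[OF vec_lambda_measurable]) (simp_all only: eq sets_lborel)
  also have "\<dots> = (\<Prod>j\<in>UNIV. emeasure lborel (if j = i then N else UNIV))"
    by (rule emeasure_PiM) auto
  also have "\<dots> = 0"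
    using N by (intro prod_zero bexI[of _ i]) auto
  finally show "emeasure (lborel :: ('a^'m) measure) {y. y $ i \<in> N} = 0" .
qed

lemma AE_vec_nth:
  fixes P :: "'a::euclidean_space \<Rightarrow> bool"
  assumes "AE x in lebesgue. P x"
  shows "AE y in (lebesgue :: ('a^'m::finite) measure). P (y $ i)"
proof -
  have "AE x in lborel. P x" using assms by (simp add: AE_completion_iff)
  then obtain N where "N \<in> null_sets lborel" "{x. \<not> P x} \<subseteq> N"
    by (auto simp: eventually_ae_filter)
  then have "AE y in (lborel :: ('a^'m) measure). P (y $ i)"
    by (intro AE_I'[OF null_sets_vec_nth[of N i]]) auto
  then show ?thesis by (simp add: AE_completion_iff)
qed

text \<open>Borel measurability of the projection is not enough for the completed measure. A
  Lebesgue set is a Borel set together with a part of a null set, and the preimage of that null set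
  is null again.\<close>

lemma measurable_vec_nth_lebesgue[measurable]:
  "(\<lambda>y::'a::euclidean_space^'m::finite. y $ i) \<in> measurable lebesgue lebesgue"
proof (rule measurableI)
  fix A :: "'a set" assume "A \<in> sets lebesgue"
  then obtain S N N' where A: "A = S \<union> N" "N \<subseteq> N'" "N' \<in> null_sets lborel" "S \<in> sets lborel"
    by (rule sets_completionE)
  have "{y::'a^'m. y $ i \<in> S} \<in> sets lborel"
    using measurable_sets[OF vec_nth_borel_measurable, of S i] A by (simp add: vimage_def)
  then have "{y::'a^'m. y $ i \<in> S} \<union> {y. y $ i \<in> N} \<in> sets lebesgue"
    using A null_sets_vec_nth[OF A(3), of i]
    by (intro sets_completionI[of _ "{y. y $ i \<in> S}" "{y. y $ i \<in> N}" "{y. y $ i \<in> N'}"]) auto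
  moreover have "(\<lambda>y::'a^'m. y $ i) -` A \<inter> space lebesgue = {y. y $ i \<in> S} \<union> {y. y $ i \<in> N}"
    using A by auto
  ultimately show "(\<lambda>y::'a^'m. y $ i) -` A \<inter> space lebesgue \<in> sets lebesgue" by simp
qed simp

text \<open>Each factor is replaced by a Borel function that agrees with it almost everywhere,
  because the product measure is built from \<open>lborel\<close>; \<open>AE_vec_nth\<close> carries
  the exceptional sets over to the tuples.\<close>

lemma nn_integral_prod_vec:
  fixes f :: "'m::finite \<Rightarrow> 'a::euclidean_space \<Rightarrow> ennreal"
  assumes "\<And>i. f i \<in> borel_measurable lebesgue"
  shows "(\<integral>\<^sup>+y. (\<Prod>i\<in>UNIV. f i (y $ i)) \<partial>lebesgue) = (\<Prod>i\<in>UNIV. \<integral>\<^sup>+x. f i x \<partial>lebesgue)"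
proof -
  interpret product_sigma_finite "\<lambda>_::'m. lborel :: 'a measure" ..
  have "\<forall>i. \<exists>g. g \<in> borel_measurable borel \<and> (AE x in lborel. f i x = g x)"
    using completion_ex_borel_measurable[OF assms] by (simp add: Bex_def)
  then obtain g where "\<forall>i. g i \<in> borel_measurable borel \<and> (AE x in lborel. f i x = g i x)"
    unfolding choice_iff by blast
  then have [measurable]: "\<And>i. g i \<in> borel_measurable borel"
    and ae: "\<And>i. AE x in lborel. f i x = g i x"
    by blast+
  have "(\<integral>\<^sup>+y. (\<Prod>i\<in>UNIV. f i (y $ i)) \<partial>lebesgue) = (\<integral>\<^sup>+(y::'a^'m). (\<Prod>i\<in>UNIV. g i (y $ i)) \<partial>lebesgue)"
  proof (rule nn_integral_cong_AE)
    have "AE y in (lebesgue :: ('a^'m) measure). \<forall>i\<in>UNIV. f i (y $ i) = g i (y $ i)"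
      by (intro AE_finite_allI AE_vec_nth) (use ae in \<open>auto simp: AE_completion_iff\<close>)
    then show "AE y in (lebesgue :: ('a^'m) measure). (\<Prod>i\<in>UNIV. f i (y $ i)) = (\<Prod>i\<in>UNIV. g i (y $ i))"
      by eventually_elim simp
  qed
  also have "\<dots> = (\<integral>\<^sup>+(y::'a^'m). (\<Prod>i\<in>UNIV. g i (y $ i)) \<partial>lborel)"
    by (rule nn_integral_completion)
  also have "\<dots> = (\<integral>\<^sup>+y. (\<Prod>i\<in>UNIV. g i (y i)) \<partial>PiM UNIV (\<lambda>_. lborel))"
    by (subst lborel_vec, subst nn_integral_distr[OF vec_lambda_measurable]) auto
  also have "\<dots> = (\<Prod>i\<in>UNIV. \<integral>\<^sup>+x. g i x \<partial>lborel)"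
    by (rule product_nn_integral_prod) auto
  also have "\<dots> = (\<Prod>i\<in>UNIV. \<integral>\<^sup>+x. f i x \<partial>lborel)"
  proof (intro prod.cong nn_integral_cong_AE refl)
    show "AE x in lborel. g i x = f i x" for i
      using ae[of i] by eventually_elim simp
  qed
  finally show ?thesis by (simp add: nn_integral_completion)
qed

lemma complex_lebesgue_ex_borel:
  fixes f :: "'a::euclidean_space \<Rightarrow> complex"
  assumes "f \<in> borel_measurable lebesgue"
  shows "\<exists>g\<in>borel_measurable borel. AE x in lborel. f x = g x"
proof -
  have "(\<lambda>x. Re (f x)) \<in> borel_measurable lebesgue" "(\<lambda>x. Im (f x)) \<in> borel_measurable lebesgue"
    using assms by simp_all
  from this[THEN completion_ex_borel_measurable_real]
  obtain u v where [measurable]: "u \<in> borel_measurable borel" "v \<in> borel_measurable borel"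
    and ae: "AE x in lborel. Re (f x) = u x" "AE x in lborel. Im (f x) = v x"
    by auto
  have "(\<lambda>x. Complex (u x) (v x)) \<in> borel_measurable borel"
    unfolding Complex_eq by measurable
  moreover have "AE x in lborel. f x = Complex (u x) (v x)"
    using ae by eventually_elim (simp add: complex_eq_iff)
  ultimately show ?thesis by (intro bexI[of _ "\<lambda>x. Complex (u x) (v x)"])
qed

lemma
  fixes f :: "'m::finite \<Rightarrow> 'a::euclidean_space \<Rightarrow> complex"
  assumes f: "\<And>i. integrable lebesgue (f i)"
  shows integrable_prod_vec: "integrable lebesgue (\<lambda>y. \<Prod>i\<in>UNIV. f i (y $ i))" (is ?int)
    and integral_prod_vec: "(LINT y|lebesgue. (\<Prod>i\<in>UNIV. f i (y $ i))) = (\<Prod>i\<in>UNIV. (LINT x|lebesgue. f i x))" (is ?eq)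
proof -
  interpret product_sigma_finite "\<lambda>_::'m. lborel :: 'a measure" ..
  have [measurable]: "f i \<in> borel_measurable lebesgue" for i using f by auto
  have "f i \<in> borel_measurable lebesgue" for i using f by auto
  then have "\<forall>i. \<exists>g. g \<in> borel_measurable borel \<and> (AE x in lborel. f i x = g x)"
    using complex_lebesgue_ex_borel by blast
  then obtain g where "\<forall>i. g i \<in> borel_measurable borel \<and> (AE x in lborel. f i x = g i x)"
    unfolding choice_iff by blast
  then have g[measurable]: "\<And>i. g i \<in> borel_measurable borel"
    and ae: "\<And>i. AE x in lborel. f i x = g i x"
    by blast+
  have gl: "g i \<in> borel_measurable lebesgue" for i by (simp add: measurable_completion)
  have ael: "AE x in lebesgue. f i x = g i x" for i
    using ae[of i] by (simp add: AE_completion_iff)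
  have gi: "integrable lborel (g i)" for i
  proof -
    have "integrable lebesgue (g i)"
      by (rule integrable_cong_AE_imp[OF f[of i] gl ael])
    then show ?thesis by (subst (asm) integrable_completion) auto
  qed
  have ae': "AE y in (lebesgue :: ('a^'m) measure). (\<Prod>i\<in>UNIV. f i (y $ i)) = (\<Prod>i\<in>UNIV. g i (y $ i))"
  proof -
    have "AE y in (lebesgue :: ('a^'m) measure). \<forall>i\<in>UNIV. f i (y $ i) = g i (y $ i)"
      by (intro AE_finite_allI AE_vec_nth ael) simp
    then show ?thesis by eventually_elim simp
  qed
  then have ae'': "AE y in (lebesgue :: ('a^'m) measure). (\<Prod>i\<in>UNIV. g i (y $ i)) = (\<Prod>i\<in>UNIV. f i (y $ i))"
    by eventually_elim simp
  have m1: "(\<lambda>y::'a^'m. \<Prod>i\<in>UNIV. g i (y $ i)) \<in> borel_measurable borel" by measurable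
  have m2: "(\<lambda>y::'a^'m. \<Prod>i\<in>UNIV. f i (y $ i)) \<in> borel_measurable lebesgue" by measurable
  have "integrable (PiM UNIV (\<lambda>_. lborel)) (\<lambda>y. \<Prod>i\<in>UNIV. g i (y i))"
    by (rule product_integrable_prod) (use gi in auto)
  then have "integrable (lborel :: ('a^'m) measure) (\<lambda>y. \<Prod>i\<in>UNIV. g i (y $ i))"
    by (subst lborel_vec, subst integrable_distr_eq[OF vec_lambda_measurable]) auto
  then have "integrable (lebesgue :: ('a^'m) measure) (\<lambda>y. \<Prod>i\<in>UNIV. g i (y $ i))"
    using m1 by (subst integrable_completion) auto
  then show ?int
    by (rule integrable_cong_AE_imp[OF _ m2 ae''])
  have "(LINT y|lebesgue. (\<Prod>i\<in>UNIV. f i (y $ i))) = (LINT (y::'a^'m)|lebesgue. (\<Prod>i\<in>UNIV. g i (y $ i)))"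
    by (rule integral_cong_AE[OF m2 _ ae']) (use m1 in \<open>simp add: measurable_completion\<close>)
  also have "\<dots> = (LINT (y::'a^'m)|lborel. (\<Prod>i\<in>UNIV. g i (y $ i)))"
    using m1 by (intro integral_completion) auto
  also have "\<dots> = (LINT y|PiM UNIV (\<lambda>_. lborel). (\<Prod>i\<in>UNIV. g i (y i)))"
    by (subst lborel_vec, subst integral_distr[OF vec_lambda_measurable]) auto
  also have "\<dots> = (\<Prod>i\<in>UNIV. (LINT x|lborel. g i x))"
    by (rule product_integral_prod) (use gi in auto)
  also have "\<dots> = (\<Prod>i\<in>UNIV. (LINT x|lebesgue. f i x))"
  proof (intro prod.cong refl)
    fix i
    have "(LINT x|lborel. g i x) = (LINT x|lebesgue. g i x)"
      by (intro integral_completion[symmetric]) auto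
    also have "\<dots> = (LINT x|lebesgue. f i x)"
      using ael[of i] by (intro integral_cong_AE gl) (auto simp: eq_commute)
    finally show "(LINT x|lborel. g i x) = (LINT x|lebesgue. f i x)" .
  qed
  finally show ?eq .
qed

section \<open>Weights\<close>

declare emeasure_completion [simp del]

text \<open>Jensen's inequality for \<open>exp\<close> at the points \<open>ln (x i)\<close>.
  Integrated, it serves below as Hoelder's inequality with any finite number of exponents.\<close>

lemma weighted_AM_GM:
  fixes x t :: "'i \<Rightarrow> real"
  assumes "finite I" "\<And>i. i \<in> I \<Longrightarrow> 0 \<le> t i" "(\<Sum>i\<in>I. t i) = 1" "\<And>i. i \<in> I \<Longrightarrow> 0 \<le> x i"
  shows "(\<Prod>i\<in>I. x i powr t i) \<le> (\<Sum>i\<in>I. t i * x i)"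
proof (cases "\<exists>i\<in>I. x i = 0")
  case True
  \<comment> \<open>\<open>0 powr t\<close> is 0 even for \<open>t = 0\<close>, so a single
    vanishing \<open>x i\<close> kills the product.\<close>
  then have z: "(\<Prod>i\<in>I. x i powr t i) = 0"
    using assms(1) by (intro prod_zero) auto
  show ?thesis unfolding z using assms by (intro sum_nonneg mult_nonneg_nonneg) auto
next
  case False
  then have pos: "0 < x i" if "i \<in> I" for i using assms(4) that by (simp add: less_le)
  have "(\<Prod>i\<in>I. x i powr t i) = exp (\<Sum>i\<in>I. t i *\<^sub>R ln (x i))"
    using pos assms(1) by (simp add: exp_sum) (intro prod.cong, auto simp: powr_def dest: pos)
  also have "\<dots> \<le> (\<Sum>i\<in>I. t i * exp (ln (x i)))"
    by (rule convex_on_sum[OF assms(1) _ exp_convex]) (use assms False in auto)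
  also have "\<dots> = (\<Sum>i\<in>I. t i * x i)" by (intro sum.cong) (auto simp: pos)
  finally show ?thesis .
qed

definition wdens :: "('a::euclidean_space \<Rightarrow> real) \<Rightarrow> 'a measure" where
  "wdens w = density lebesgue (\<lambda>x. ennreal (w x))"

lemma sets_wdens[simp, measurable_cong]: "sets (wdens w) = sets lebesgue"
  by (simp add: wdens_def)

lemma space_wdens[simp]: "space (wdens w) = UNIV"
  by (simp add: wdens_def)

lemma weight_nonneg: "weight w \<Longrightarrow> 0 \<le> w x"
  by (simp add: weight_def)

lemma nn_integral_wdens:
  assumes "weight w" "h \<in> borel_measurable lebesgue"
  shows "(\<integral>\<^sup>+x. h x \<partial>wdens w) = (\<integral>\<^sup>+x. ennreal (w x) * h x \<partial>lebesgue)"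
  unfolding wdens_def using assms by (intro nn_integral_density) (auto simp: weight_def)

lemma emeasure_wdens:
  assumes "weight w" "A \<in> sets lebesgue"
  shows "emeasure (wdens w) A = (\<integral>\<^sup>+x\<in>A. ennreal (w x) \<partial>lebesgue)"
  unfolding wdens_def using assms by (intro emeasure_density) (auto simp: weight_def)

lemma emeasure_wdens_pos:
  assumes w: "weight w" "AE x in lebesgue. 0 < w x" and A: "A \<in> sets lebesgue" "0 < emeasure lebesgue A"
  shows "0 < emeasure (wdens w) A"
proof (rule ccontr)
  have [measurable]: "w \<in> borel_measurable lebesgue" "A \<in> sets lebesgue" using w A by (auto simp: weight_def)
  assume "\<not> 0 < emeasure (wdens w) A"
  then have "(\<integral>\<^sup>+x\<in>A. ennreal (w x) \<partial>lebesgue) = 0"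
    using w A by (simp add: emeasure_wdens)
  then have "AE x in lebesgue. ennreal (w x) * indicator A x = 0"
    by (subst (asm) nn_integral_0_iff_AE) auto
  then have "AE x in lebesgue. x \<notin> A"
    using w(2) by eventually_elim (auto split: split_indicator_asm)
  then have "A \<in> null_sets lebesgue"
    using A by (subst (asm) AE_iff_null_sets[symmetric]) auto
  then show False using A by auto
qed

text \<open>Exactly what the dyadic sums use: reverse doubling with rate \<open>\<rho>\<close> makes
  the masses of concentric cubes grow geometrically, and \<open>D\<close> permits moving the centre
  within a cube after integrals have been exchanged.\<close>

definition doubling_weight :: "real \<Rightarrow> real \<Rightarrow> (real^'n::finite \<Rightarrow> real) \<Rightarrow> bool" where
  "doubling_weight D \<rho> w \<longleftrightarrow> weight w \<and> (AE x in lebesgue. 0 < w x) \<and> 1 \<le> D \<and> 1 < \<rho> \<and>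
     (\<forall>x. \<forall>t>0. 0 < measure (wdens w) (ccube x t) \<and> emeasure (wdens w) (ccube x t) < \<infinity> \<and>
        \<rho> * measure (wdens w) (ccube x t) \<le> measure (wdens w) (ccube x (2 * t)) \<and>
        (\<forall>y\<in>ccube x t. measure (wdens w) (ccube y t) \<le> D * measure (wdens w) (ccube x t)))"

text \<open>Of the many equivalent forms of the A_infinity condition, the one in which a fixed
  proportion of the volume carries a fixed proportion of the mass.\<close>

definition A_infinity :: "(real^'n::finite \<Rightarrow> real) \<Rightarrow> bool" where
  "A_infinity w \<longleftrightarrow> weight w \<and> (AE x in lebesgue. 0 < w x) \<and>
     (\<forall>x. \<forall>t>0. emeasure (wdens w) (ccube x t) < \<infinity>) \<and>
     (\<forall>\<theta>>0. \<exists>c>0. \<forall>x. \<forall>t>0. \<forall>F\<in>sets lebesgue. F \<subseteq> ccube x t \<longrightarrow>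
        \<theta> * (2 * t) ^ CARD('n) \<le> measure lebesgue F \<longrightarrow>
        c * measure (wdens w) (ccube x t) \<le> measure (wdens w) F)"

text \<open>Doubling: \<open>ccube x t\<close> is a fixed proportion of
  \<open>ccube x (2 * t)\<close>. Reverse doubling: \<open>ccube x (2 * t)\<close> also contains a
  cube of comparable size that misses \<open>ccube x t\<close> and hence carries mass of its
  own.\<close>

lemma A_infinity_doubling:
  fixes w :: "real^'n::finite \<Rightarrow> real"
  assumes "A_infinity w"
  shows "\<exists>D \<rho>. doubling_weight D \<rho> w"
proof -
  have w: "weight w" and ae: "AE x in lebesgue. 0 < w x"
    and fin: "emeasure (wdens w) (ccube x t) < \<infinity>" if "0 < t" for x t
    using assms that unfolding A_infinity_def by auto
  have pos: "0 < measure (wdens w) (ccube x t)" if t: "0 < t" for x t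
  proof -
    have "0 < emeasure (wdens w) (ccube x t)"
      using t by (intro emeasure_wdens_pos[OF w ae]) (simp_all add: emeasure_ccube)
    then show ?thesis using fin[OF t, of x] by (simp add: measure_def enn2real_positive_iff)
  qed
  have A: "\<exists>c>0. \<forall>x. \<forall>t>0. \<forall>F\<in>sets lebesgue. F \<subseteq> ccube x t \<longrightarrow>
        \<theta> * (2 * t) ^ CARD('n) \<le> measure lebesgue F \<longrightarrow>
        c * measure (wdens w) (ccube x t) \<le> measure (wdens w) F" if "0 < \<theta>" for \<theta> :: real
    using assms that unfolding A_infinity_def by auto
  obtain c1 where c1: "0 < c1" and A1: "\<And>x t F. 0 < t \<Longrightarrow> F \<in> sets lebesgue \<Longrightarrow> F \<subseteq> ccube x t \<Longrightarrow>
        (1/2) ^ CARD('n) * (2 * t) ^ CARD('n) \<le> measure lebesgue F \<Longrightarrow>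
        c1 * measure (wdens w) (ccube x t) \<le> measure (wdens w) F"
    using A[of "(1/2) ^ CARD('n)"] by auto
  obtain c2 where c2: "0 < c2" and A2: "\<And>x t F. 0 < t \<Longrightarrow> F \<in> sets lebesgue \<Longrightarrow> F \<subseteq> ccube x t \<Longrightarrow>
        (1/8) ^ CARD('n) * (2 * t) ^ CARD('n) \<le> measure lebesgue F \<Longrightarrow>
        c2 * measure (wdens w) (ccube x t) \<le> measure (wdens w) F"
    using A[of "(1/8) ^ CARD('n)"] by auto
  have scale: "measure lebesgue (ccube x (a * t)) = a ^ CARD('n) * (2 * t) ^ CARD('n)" if "0 \<le> a * t" for a t and x :: "real^'n"
  proof -
    have eq: "2 * (a * t) = a * (2 * t)" by simp
    show ?thesis unfolding measure_ccube[OF that] eq by (rule power_mult_distrib)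
  qed
  have doubl: "measure (wdens w) (ccube y t) \<le> max 1 (1 / c1) * measure (wdens w) (ccube x t)"
    if t: "0 < t" and y: "y \<in> ccube x t" for x y t
  proof -
    have "c1 * measure (wdens w) (ccube x (2 * t)) \<le> measure (wdens w) (ccube x t)"
    proof (rule A1)
      show "(1/2) ^ CARD('n) * (2 * (2 * t)) ^ CARD('n) \<le> measure lebesgue (ccube x t)"
        using t scale[of "1/2" "2 * t" x] by simp
    qed (use t ccube_mono[of t "2 * t" x] in auto)
    moreover have le: "measure (wdens w) (ccube y t) \<le> measure (wdens w) (ccube x (2 * t))"
      using ccube_subset[OF y, of t] t fin[of "2 * t" x]
      by (intro measure_mono_fmeasurable) (auto simp: fmeasurable_def)
    ultimately have "c1 * measure (wdens w) (ccube y t) \<le> measure (wdens w) (ccube x t)"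
      using mult_left_mono[OF le, of c1] c1 by linarith
    then have "measure (wdens w) (ccube y t) \<le> (1 / c1) * measure (wdens w) (ccube x t)"
      using c1 by (simp add: pos_le_divide_eq mult.commute)
    also have "\<dots> \<le> max 1 (1 / c1) * measure (wdens w) (ccube x t)"
      by (intro mult_right_mono) auto
    finally show ?thesis .
  qed
  have rev: "measure (wdens w) (ccube x t) \<le> (1 - c2) * measure (wdens w) (ccube x (2 * t))"
    if t: "0 < t" for x t
  proof -
    obtain i0 :: 'n where True by blast
    \<comment> \<open>A shift by \<open>3/2 * t\<close> in one coordinate: there the cube of
      half-side \<open>t/4\<close> runs from \<open>5/4 * t\<close> to \<open>7/4 * t\<close>,
      between the inner and the outer cube.\<close>
    define x' where "x' = (\<chi> i. if i = i0 then x $ i + 3/2 * t else x $ i)"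
    have x'2: "x' \<in> ccube x (3/2 * t)" using t by (auto simp: ccube_def x'_def)
    have sub: "ccube x' (t/4) \<subseteq> ccube x (2 * t)"
      using ccube_subset[OF x'2, of "t/4"] ccube_mono[of "3/2*t + t/4" "2*t" x] t by auto
    have dis: "ccube x t \<inter> ccube x' (t/4) = {}"
    proof (rule equals0I)
      fix y assume "y \<in> ccube x t \<inter> ccube x' (t/4)"
      then have "\<bar>y $ i0 - x $ i0\<bar> \<le> t" "\<bar>y $ i0 - x' $ i0\<bar> \<le> t/4" by (auto simp: ccube_def)
      moreover have "x' $ i0 = x $ i0 + 3/2 * t" by (simp add: x'_def)
      ultimately show False using t by linarith
    qed
    have "c2 * measure (wdens w) (ccube x (2 * t)) \<le> measure (wdens w) (ccube x' (t/4))"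
    proof (rule A2)
      show "(1/8) ^ CARD('n) * (2 * (2 * t)) ^ CARD('n) \<le> measure lebesgue (ccube x' (t/4))"
        using t scale[of "1/8" "2 * t" x'] by simp
    qed (use t sub in auto)
    moreover have "measure (wdens w) (ccube x t) + measure (wdens w) (ccube x' (t/4))
        = measure (wdens w) (ccube x t \<union> ccube x' (t/4))"
      using fin t dis by (intro measure_Union[symmetric]) (auto simp: less_top)
    moreover have "\<dots> \<le> measure (wdens w) (ccube x (2 * t))"
      using sub t fin[of "2 * t" x] ccube_mono[of t "2 * t" x]
      by (intro measure_mono_fmeasurable) (auto simp: fmeasurable_def)
    ultimately show ?thesis by (simp add: algebra_simps)
  qed
  \<comment> \<open>The inner cube has positive mass, so the factor \<open>1 - c2\<close> in
    \<open>rev\<close> must be positive.\<close>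
  have c2': "c2 < 1"
    using order_less_le_trans[OF pos[of 1 0] rev[of 1 0]] pos[of "2*1" 0] by (simp add: zero_less_mult_iff)
  have rev': "1 / (1 - c2) * measure (wdens w) (ccube x t) \<le> measure (wdens w) (ccube x (2 * t))"
    if t: "0 < t" for x t
    using rev[OF t, of x] c2' by (simp add: field_simps)
  have "doubling_weight (max 1 (1 / c1)) (1 / (1 - c2)) w"
    unfolding doubling_weight_def
    using w ae pos fin doubl rev' c2 c2' by (auto simp: less_divide_eq)
  then show ?thesis by blast
qed

text \<open>
  In the application the family consists of \<open>\<mu>\<^sub>\<omega>\<close> and the dual weights \<open>\<omega>\<^sub>i\<close> to the power \<open>- p\<^sub>i'\<close>.
  The condition is symmetric in all of them, which gives the \<open>A\<^sub>\<infinity>\<close> property for all at once.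
\<close>

locale balanced_weights =
  fixes v :: "'k::finite \<Rightarrow> real^'n::finite \<Rightarrow> real" and \<theta> :: "'k \<Rightarrow> real" and C :: real
  assumes wt: "weight (v k)" and ae_pos: "AE x in lebesgue. 0 < v k x"
    and th: "0 < \<theta> k" and C: "0 < C"
    and prod1: "AE x in lebesgue. (\<Prod>k\<in>UNIV. v k x powr \<theta> k) = 1"
    and fin: "0 < t \<Longrightarrow> emeasure (wdens (v k)) (ccube x t) < \<infinity>"
    and bal: "0 < t \<Longrightarrow> (\<Prod>k\<in>UNIV. measure (wdens (v k)) (ccube x t) powr \<theta> k)
                \<le> C * ((2 * t) ^ CARD('n)) powr (\<Sum>k\<in>UNIV. \<theta> k)"
begin

abbreviation "vm k A \<equiv> measure (wdens (v k)) A"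
abbreviation "\<Theta> \<equiv> (\<Sum>k\<in>UNIV. \<theta> k)"

lemma Theta_pos: "0 < \<Theta>"
  by (intro sum_pos th) auto

lemma v_measurable[measurable]: "v k \<in> borel_measurable lebesgue"
  using wt by (simp add: weight_def)

lemma vm_mono: "A \<subseteq> ccube x t \<Longrightarrow> A \<in> sets lebesgue \<Longrightarrow> 0 < t \<Longrightarrow> vm k A \<le> vm k (ccube x t)"
  using fin[of t k x] by (intro measure_mono_fmeasurable) (auto simp: fmeasurable_def)

lemma vm_emeasure:
  assumes "F \<subseteq> ccube x t" "0 < t" "F \<in> sets lebesgue"
  shows "emeasure (wdens (v k)) F = ennreal (vm k F)"
proof -
  have "emeasure (wdens (v k)) F \<le> emeasure (wdens (v k)) (ccube x t)"
    using assms by (intro emeasure_mono) auto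
  then have "emeasure (wdens (v k)) F < \<infinity>"
    using fin[of t k x] assms by (auto intro: le_less_trans)
  then show ?thesis by (simp add: emeasure_eq_ennreal_measure)
qed

lemma vm_pos:
  assumes "F \<subseteq> ccube x t" "0 < t" "F \<in> sets lebesgue" "0 < measure lebesgue F"
  shows "0 < vm k F"
proof -
  have "0 < emeasure lebesgue F" using assms(4) by (simp add: measure_def enn2real_positive_iff)
  then have "0 < emeasure (wdens (v k)) F"
    using assms by (intro emeasure_wdens_pos wt ae_pos)
  then show ?thesis using vm_emeasure[OF assms(1-3)] by simp
qed

text \<open>By \<open>prod1\<close> the constant 1 is a product of powers of the weights. Hoelder's
  inequality for its integral over \<open>F\<close> is the claim.\<close>

lemma Holder_lower:
  assumes F: "F \<subseteq> ccube x t" "0 < t" "F \<in> sets lebesgue" "0 < measure lebesgue F"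
  shows "measure lebesgue F powr \<Theta> \<le> (\<Prod>k\<in>UNIV. vm k F powr \<theta> k)"
proof -
  \<comment> \<open>Each weight is divided by its mean over \<open>F\<close>. After integration the
    terms of the AM-GM inequality then add up to \<open>measure lebesgue F\<close>, which forces
    \<open>P\<close> to be at least 1.\<close>
  define a where "a k = vm k F / measure lebesgue F" for k
  have a: "0 < a k" for k using vm_pos[OF F] F by (simp add: a_def)
  have vF: "vm k F \<noteq> 0" for k using vm_pos[OF F, of k] by simp
  define P where "P = (\<Prod>k\<in>UNIV. a k powr (\<theta> k / \<Theta>))"
  have P: "0 < P" unfolding P_def by (intro prod_pos) (metis a less_irrefl powr_gt_zero)
  have fF: "emeasure lebesgue F = ennreal (measure lebesgue F)"
    using F emeasure_mono[of F "ccube x t" lebesgue] emeasure_ccube_finite[of x t]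
    by (intro emeasure_eq_ennreal_measure) (auto simp: top_unique)
  have le: "AE y in lebesgue. ennreal (1 / P) * indicator F y
      \<le> (\<Sum>k\<in>UNIV. ennreal (\<theta> k / \<Theta> / a k) * (ennreal (v k y) * indicator F y))"
    using prod1
  proof eventually_elim
    fix y assume y: "(\<Prod>k\<in>UNIV. v k y powr \<theta> k) = 1"
    have vn: "0 \<le> v k y" for k using wt by (simp add: weight_def)
    have "1 / P = (\<Prod>k\<in>UNIV. v k y powr \<theta> k) powr (1 / \<Theta>) / P" by (simp add: y)
    also have "\<dots> = (\<Prod>k\<in>UNIV. (v k y / a k) powr (\<theta> k / \<Theta>))"
      unfolding P_def using a vn less_imp_le[OF a]
      by (subst prod_powr_distrib) (auto simp: powr_powr powr_divide prod_dividef[symmetric])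
    also have "\<dots> \<le> (\<Sum>k\<in>UNIV. \<theta> k / \<Theta> * (v k y / a k))"
      using less_imp_le[OF th] Theta_pos less_imp_le[OF a] vn
      by (intro weighted_AM_GM) (auto simp: sum_divide_distrib[symmetric])
    finally have "ennreal (1 / P) \<le> ennreal (\<Sum>k\<in>UNIV. \<theta> k / \<Theta> / a k * v k y)"
      by (intro ennreal_leI) simp
    also have "\<dots> = (\<Sum>k\<in>UNIV. ennreal (\<theta> k / \<Theta> / a k * v k y))"
      using less_imp_le[OF th] Theta_pos less_imp_le[OF a] vn by (intro sum_ennreal[symmetric]) auto
    also have "\<dots> = (\<Sum>k\<in>UNIV. ennreal (\<theta> k / \<Theta> / a k) * ennreal (v k y))"
      using less_imp_le[OF th] Theta_pos less_imp_le[OF a] vn by (intro sum.cong ennreal_mult) auto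
    finally show "ennreal (1 / P) * indicator F y
        \<le> (\<Sum>k\<in>UNIV. ennreal (\<theta> k / \<Theta> / a k) * (ennreal (v k y) * indicator F y))"
      by (auto split: split_indicator)
  qed
  have "ennreal (1 / P) * ennreal (measure lebesgue F) = (\<integral>\<^sup>+y. ennreal (1 / P) * indicator F y \<partial>lebesgue)"
    using F by (simp add: nn_integral_cmult_indicator fF)
  also have "\<dots> \<le> (\<integral>\<^sup>+y. (\<Sum>k\<in>UNIV. ennreal (\<theta> k / \<Theta> / a k) * (ennreal (v k y) * indicator F y)) \<partial>lebesgue)"
    by (rule nn_integral_mono_AE[OF le])
  also have "\<dots> = (\<Sum>k\<in>UNIV. ennreal (\<theta> k / \<Theta> / a k) * (\<integral>\<^sup>+y. ennreal (v k y) * indicator F y \<partial>lebesgue))"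
    using F by (subst nn_integral_sum) (auto intro!: sum.cong nn_integral_cmult)
  also have "\<dots> = (\<Sum>k\<in>UNIV. ennreal (\<theta> k / \<Theta> / a k) * ennreal (vm k F))"
    using F by (simp add: emeasure_wdens[OF wt, symmetric] vm_emeasure[OF F(1-3)])
  also have "\<dots> = (\<Sum>k\<in>UNIV. ennreal (\<theta> k / \<Theta> * measure lebesgue F))"
    using less_imp_le[OF th] Theta_pos F vF
    by (intro sum.cong refl) (auto simp: a_def ennreal_mult'[symmetric])
  also have "\<dots> = ennreal (\<Sum>k\<in>UNIV. \<theta> k / \<Theta> * measure lebesgue F)"
    using less_imp_le[OF th] Theta_pos F by (intro sum_ennreal) auto
  also have "(\<Sum>k\<in>UNIV. \<theta> k / \<Theta> * measure lebesgue F) = measure lebesgue F"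
    using Theta_pos by (simp add: sum_distrib_right[symmetric] sum_divide_distrib[symmetric])
  finally have "1 / P * measure lebesgue F \<le> measure lebesgue F"
    using P F by (simp add: ennreal_mult'[symmetric])
  then have "1 \<le> P" using P F by (simp add: field_simps)
  then have "1 \<le> P powr \<Theta>" using Theta_pos by (intro ge_one_powr_ge_zero) auto
  also have "P powr \<Theta> = (\<Prod>k\<in>UNIV. a k powr \<theta> k)"
    unfolding P_def using Theta_pos by (subst prod_powr_distrib) (auto simp: powr_powr)
  also have "\<dots> = (\<Prod>k\<in>UNIV. vm k F powr \<theta> k) / measure lebesgue F powr \<Theta>"
    unfolding a_def using F by (simp add: powr_divide powr_sum prod_dividef)
  finally show ?thesis using F by (simp add: field_simps)
qed

text \<open>\<open>Holder_lower\<close> bounds the product of the masses of \<open>F\<close> from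
  below, \<open>bal\<close> bounds that of the cube from above. Enlarging \<open>F\<close> to the
  cube in all factors but the k-th isolates the ratio of the two masses of the k-th weight.\<close>

lemma A_infinity_v: "A_infinity (v k)"
proof -
  have "\<exists>c>0. \<forall>x. \<forall>t>0. \<forall>F\<in>sets lebesgue. F \<subseteq> ccube x t \<longrightarrow>
        \<eta> * (2 * t) ^ CARD('n) \<le> measure lebesgue F \<longrightarrow> c * vm k (ccube x t) \<le> vm k F"
    if \<eta>: "0 < \<eta>" for \<eta>
  proof (intro exI[of _ "(\<eta> powr \<Theta> / C) powr (1 / \<theta> k)"] conjI allI impI ballI)
    show "0 < (\<eta> powr \<Theta> / C) powr (1 / \<theta> k)" using C \<eta> by simp
    fix x :: "real^'n" and t :: real and F
    assume t: "0 < t" and F: "F \<in> sets lebesgue" "F \<subseteq> ccube x t" "\<eta> * (2 * t) ^ CARD('n) \<le> measure lebesgue F"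
    define q where "q = (2 * t) ^ CARD('n)"
    have q: "0 < q" using t by (simp add: q_def)
    have Fp: "0 < measure lebesgue F" using F(3) q \<eta> by (smt (verit) q_def mult_pos_pos)
    have vQ: "0 < vm j (ccube x t)" for j
      using t by (intro vm_pos[of _ x t]) (auto simp: measure_ccube)
    have vF: "0 < vm k F" using vm_pos[OF F(2) t F(1) Fp] .
    have "(\<eta> * q) powr \<Theta> \<le> measure lebesgue F powr \<Theta>"
      using F(3) \<eta> q Theta_pos unfolding q_def by (intro powr_mono2) auto
    also have "\<dots> \<le> (\<Prod>j\<in>UNIV. vm j F powr \<theta> j)" by (rule Holder_lower[OF F(2) t F(1) Fp])
    also have "\<dots> = vm k F powr \<theta> k * (\<Prod>j\<in>UNIV-{k}. vm j F powr \<theta> j)"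
      by (rule prod.remove) auto
    also have "\<dots> \<le> vm k F powr \<theta> k * (\<Prod>j\<in>UNIV-{k}. vm j (ccube x t) powr \<theta> j)"
      using vm_mono[OF F(2,1) t] less_imp_le[OF th]
      by (intro mult_left_mono prod_mono conjI powr_mono2) auto
    finally have H: "(\<eta> * q) powr \<Theta> \<le> vm k F powr \<theta> k * (\<Prod>j\<in>UNIV-{k}. vm j (ccube x t) powr \<theta> j)" .
    have "(\<eta> * q) powr \<Theta> * vm k (ccube x t) powr \<theta> k
        \<le> vm k F powr \<theta> k * (vm k (ccube x t) powr \<theta> k * (\<Prod>j\<in>UNIV-{k}. vm j (ccube x t) powr \<theta> j))"
      using mult_right_mono[OF H, of "vm k (ccube x t) powr \<theta> k"] by (simp add: mult_ac)
    also have "vm k (ccube x t) powr \<theta> k * (\<Prod>j\<in>UNIV-{k}. vm j (ccube x t) powr \<theta> j)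
        = (\<Prod>j\<in>UNIV. vm j (ccube x t) powr \<theta> j)"
      by (rule prod.remove[symmetric]) auto
    also have "\<dots> \<le> C * q powr \<Theta>" using bal[OF t] by (simp add: q_def)
    finally have "(\<eta> * q) powr \<Theta> * vm k (ccube x t) powr \<theta> k \<le> vm k F powr \<theta> k * (C * q powr \<Theta>)"
      by (simp add: mult_left_mono)
    then have "(\<eta> powr \<Theta> / C) * vm k (ccube x t) powr \<theta> k \<le> vm k F powr \<theta> k"
      using \<eta> q C by (simp add: powr_mult field_simps)
    then have le: "((\<eta> powr \<Theta> / C) * vm k (ccube x t) powr \<theta> k) powr (1 / \<theta> k) \<le> (vm k F powr \<theta> k) powr (1 / \<theta> k)"
      using \<eta> C th[of k] by (intro powr_mono2) auto
    show "(\<eta> powr \<Theta> / C) powr (1 / \<theta> k) * vm k (ccube x t) \<le> vm k F"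
    proof -
      have "((\<eta> powr \<Theta> / C) * vm k (ccube x t) powr \<theta> k) powr (1 / \<theta> k)
          = (\<eta> powr \<Theta> / C) powr (1 / \<theta> k) * (vm k (ccube x t) powr \<theta> k) powr (1 / \<theta> k)"
        by (rule powr_mult)
      moreover have "(vm k F powr \<theta> k) powr (1 / \<theta> k) = vm k F"
        "(vm k (ccube x t) powr \<theta> k) powr (1 / \<theta> k) = vm k (ccube x t)"
        using th[of k] vF vQ[of k] by (simp_all add: powr_powr)
      ultimately show ?thesis using le by simp
    qed
  qed
  then show ?thesis unfolding A_infinity_def using wt ae_pos fin by blast
qed

text \<open>The sets may differ from weight to weight, so Hoelder on a common set does not apply
  directly. The A_infinity property first compares each \<open>F k\<close> with the whole cube, and
  Hoelder is used there. In the lower bound the target weight lives on one cube and the dual weights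
  on a distant one.\<close>

lemma prod_lower_bound:
  assumes \<eta>: "0 < \<eta>"
  shows "\<exists>c>0. \<forall>x t (F :: 'k \<Rightarrow> (real^'n) set). 0 < t \<longrightarrow> (\<forall>k. F k \<in> sets lebesgue \<and> F k \<subseteq> ccube x t \<and>
      \<eta> * (2 * t) ^ CARD('n) \<le> measure lebesgue (F k)) \<longrightarrow>
      c * ((2 * t) ^ CARD('n)) powr \<Theta> \<le> (\<Prod>k\<in>UNIV. vm k (F k) powr \<theta> k)"
proof -
  have "\<forall>k. \<exists>c>0. \<forall>x. \<forall>t>0. \<forall>F\<in>sets lebesgue. F \<subseteq> ccube x t \<longrightarrow>
        \<eta> * (2 * t) ^ CARD('n) \<le> measure lebesgue F \<longrightarrow> c * vm k (ccube x t) \<le> vm k F"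
    using A_infinity_v \<eta> unfolding A_infinity_def by auto
  then obtain c where c: "\<And>k. 0 < c k" and le: "\<And>k x t F. 0 < t \<Longrightarrow> F \<in> sets lebesgue \<Longrightarrow> F \<subseteq> ccube x t \<Longrightarrow>
        \<eta> * (2 * t) ^ CARD('n) \<le> measure lebesgue F \<Longrightarrow> c k * vm k (ccube x t) \<le> vm k F"
    by (subst (asm) choice_iff) blast
  show ?thesis
  proof (intro exI[of _ "\<Prod>k\<in>UNIV. c k powr \<theta> k"] conjI allI impI)
    show "0 < (\<Prod>k\<in>UNIV. c k powr \<theta> k)" by (intro prod_pos) (metis c less_irrefl powr_gt_zero)
    fix x :: "real^'n" and t :: real and F :: "'k \<Rightarrow> (real^'n) set"
    assume t: "0 < t" and F: "\<forall>k. F k \<in> sets lebesgue \<and> F k \<subseteq> ccube x t \<and>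
      \<eta> * (2 * t) ^ CARD('n) \<le> measure lebesgue (F k)"
    have "((2 * t) ^ CARD('n)) powr \<Theta> \<le> (\<Prod>k\<in>UNIV. vm k (ccube x t) powr \<theta> k)"
      using Holder_lower[of "ccube x t" x t] t by (simp add: measure_ccube)
    then have "(\<Prod>k\<in>UNIV. c k powr \<theta> k) * ((2 * t) ^ CARD('n)) powr \<Theta>
        \<le> (\<Prod>k\<in>UNIV. c k powr \<theta> k) * (\<Prod>k\<in>UNIV. vm k (ccube x t) powr \<theta> k)"
      using c by (intro mult_left_mono prod_nonneg) auto
    also have "\<dots> = (\<Prod>k\<in>UNIV. (c k * vm k (ccube x t)) powr \<theta> k)"
      using c by (simp add: powr_mult less_imp_le prod.distrib)
    also have "\<dots> \<le> (\<Prod>k\<in>UNIV. vm k (F k) powr \<theta> k)"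
      using le[OF t] F c less_imp_le[OF th]
      by (intro prod_mono conjI powr_mono2) (auto simp: less_imp_le)
    finally show "(\<Prod>k\<in>UNIV. c k powr \<theta> k) * ((2 * t) ^ CARD('n)) powr \<Theta>
        \<le> (\<Prod>k\<in>UNIV. vm k (F k) powr \<theta> k)" .
  qed
qed

end

section \<open>Averages over dyadic scales\<close>

definition scale :: "int \<Rightarrow> real" where
  "scale k = 2 powr real_of_int k"

lemma scale_pos[simp]: "0 < scale k"
  by (simp add: scale_def)

lemma scale_Suc: "scale (k + 1) = 2 * scale k"
  by (simp add: scale_def powr_add)

definition cube_mass :: "(real^'n::finite \<Rightarrow> real) \<Rightarrow> real^'n \<Rightarrow> int \<Rightarrow> real" where
  "cube_mass w x k = measure (wdens w) (ccube x (scale k))"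

lemma cube_mass_measurable[measurable]:
  assumes "weight w"
  shows "(\<lambda>x. cube_mass w x k) \<in> borel_measurable lebesgue"
proof -
  have [measurable]: "(\<lambda>x. ennreal (w x)) \<in> borel_measurable lebesgue"
    using assms by (auto simp: weight_def)
  show ?thesis unfolding cube_mass_def wdens_def measure_def by measurable
qed

context
  fixes D \<rho> :: real and w :: "real^'n::finite \<Rightarrow> real"
  assumes w: "doubling_weight D \<rho> w"
begin

lemma doubling_weightD: "weight w" "1 \<le> D" "1 < \<rho>" "AE x in lebesgue. 0 < w x"
  using w by (auto simp: doubling_weight_def)

lemma cube_mass_pos: "0 < cube_mass w x k"
  using w by (auto simp: doubling_weight_def cube_mass_def)

lemma cube_mass_grow: "\<rho> * cube_mass w x k \<le> cube_mass w x (k + 1)"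
  using w by (auto simp: doubling_weight_def cube_mass_def scale_Suc)

lemma cube_mass_doubling: "y \<in> ccube x (scale k) \<Longrightarrow> cube_mass w y k \<le> D * cube_mass w x k"
  using w by (auto simp: doubling_weight_def cube_mass_def)

lemma emeasure_cube_mass: "emeasure (wdens w) (ccube x (scale k)) = ennreal (cube_mass w x k)"
  using w unfolding cube_mass_def by (intro emeasure_eq_ennreal_measure) (auto simp: doubling_weight_def less_top)

text \<open>Young's inequality, applied at the right level and integrated over the cube, gives
  Hoelder's inequality with constant 1 without knowing beforehand that the left side is
  finite.\<close>

lemma cube_integral_Holder:
  fixes g :: "real^'n \<Rightarrow> real"
  assumes [measurable]: "g \<in> borel_measurable lebesgue" and g0: "\<And>x. 0 \<le> g x" and p: "1 < p" and N: "0 < N"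
    and gN: "(\<integral>\<^sup>+x. ennreal (g x powr p) \<partial>wdens w) \<le> ennreal (N powr p)"
  shows "(\<integral>\<^sup>+y\<in>ccube x (scale k). ennreal (g y) \<partial>wdens w) \<le> ennreal (N * cube_mass w x k powr (1 - 1 / p))"
proof -
  let ?V = "cube_mass w x k" and ?Q = "ccube x (scale k)"
  \<comment> \<open>The constant function \<open>\<kappa>\<close> on the cube satisfies
    \<open>\<kappa> powr p * ?V = N powr p\<close>; it is the case of equality.\<close>
  define \<kappa> where "\<kappa> = N * ?V powr (- (1 / p))"
  have V: "0 < ?V" by (rule cube_mass_pos)
  have \<kappa>: "0 < \<kappa>" using N V by (simp add: \<kappa>_def)
  have young: "g y \<le> \<kappa> / p / \<kappa> powr p * g y powr p + \<kappa> * (1 - 1 / p)" for y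
  proof -
    have "g y / \<kappa> * 1 \<le> (g y / \<kappa>) powr p / p + 1 powr (p / (p - 1)) / (p / (p - 1))"
      by (rule Youngs_inequality) (use p \<kappa> g0[of y] in \<open>auto simp: field_simps\<close>)
    also have "\<dots> = g y powr p / \<kappa> powr p / p + (1 - 1 / p)"
      using p \<kappa> g0[of y] by (simp add: powr_divide field_simps)
    finally have "\<kappa> * (g y / \<kappa>) \<le> \<kappa> * (g y powr p / \<kappa> powr p / p + (1 - 1 / p))"
      using \<kappa> by (intro mult_left_mono) auto
    then show ?thesis using \<kappa> by (simp add: field_simps)
  qed
  define c1 where "c1 = \<kappa> / p / \<kappa> powr p"
  define c2 where "c2 = \<kappa> * (1 - 1 / p)"
  have c0: "0 \<le> c1" "0 \<le> c2" using \<kappa> p by (auto simp: c1_def c2_def)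
  have "ennreal (g y) \<le> ennreal c1 * ennreal (g y powr p) + ennreal c2" for y
  proof -
    have "ennreal (g y) \<le> ennreal (c1 * g y powr p + c2)"
      unfolding c1_def c2_def by (rule ennreal_leI[OF young])
    also have "\<dots> = ennreal c1 * ennreal (g y powr p) + ennreal c2"
      using c0 by (simp add: ennreal_mult)
    finally show ?thesis .
  qed
  then have "(\<integral>\<^sup>+y\<in>?Q. ennreal (g y) \<partial>wdens w)
      \<le> (\<integral>\<^sup>+y. ennreal c1 * ennreal (g y powr p) + ennreal c2 * indicator ?Q y \<partial>wdens w)"
    by (intro nn_integral_mono) (simp split: split_indicator)
  also have "\<dots> = ennreal (c1) * (\<integral>\<^sup>+y. ennreal (g y powr p) \<partial>wdens w) + ennreal (c2) * ennreal ?V"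
    by (simp add: nn_integral_add nn_integral_cmult nn_integral_cmult_indicator emeasure_cube_mass)
  also have "\<dots> \<le> ennreal (c1) * ennreal (N powr p) + ennreal (c2) * ennreal ?V"
    by (intro add_mono mult_left_mono gN) auto
  also have "\<dots> = ennreal (c1 * N powr p + c2 * ?V)"
    using c0 V by (simp add: ennreal_mult[symmetric] ennreal_plus[symmetric] del: ennreal_plus)
  also have "c1 * N powr p + c2 * ?V = \<kappa> * ?V"
  proof -
    have "\<kappa> powr p = N powr p / ?V"
      using N V p by (simp add: \<kappa>_def powr_minus_divide powr_divide powr_powr)
    then have "N powr p / \<kappa> powr p = ?V" using N V by simp
    moreover have "c1 * N powr p = \<kappa> / p * (N powr p / \<kappa> powr p)" by (simp add: c1_def)
    ultimately have "c1 * N powr p = \<kappa> / p * ?V" by simp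
    then show ?thesis using p by (simp add: c2_def field_simps)
  qed
  also have "\<kappa> * ?V = N * ?V powr (1 - 1 / p)"
    using V by (simp add: \<kappa>_def powr_diff powr_minus_divide)
  finally show ?thesis .
qed

end

text \<open>\<open>enn2real\<close> sends an infinite integral to 0. Wherever the value is used,
  \<open>cube_integral_Holder\<close> excludes this case.\<close>

definition cube_integral :: "(real^'n::finite \<Rightarrow> real) \<Rightarrow> (real^'n \<Rightarrow> real) \<Rightarrow> real^'n \<Rightarrow> int \<Rightarrow> real" where
  "cube_integral w g x k = enn2real (\<integral>\<^sup>+y\<in>ccube x (scale k). ennreal (g y) \<partial>wdens w)"

lemma cube_integral_nonneg: "0 \<le> cube_integral w g x k"
  by (simp add: cube_integral_def)

lemma wdens_ccube_nn_integral_measurable[measurable]: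
  fixes h :: "real^'n::finite \<Rightarrow> ennreal"
  assumes "weight w" and [measurable]: "h \<in> borel_measurable lebesgue"
  shows "(\<lambda>x. \<integral>\<^sup>+y\<in>ccube x t. h y \<partial>wdens w) \<in> borel_measurable lebesgue"
proof -
  have [measurable]: "w \<in> borel_measurable lebesgue"
    using assms by (auto simp: weight_def)
  have "(\<integral>\<^sup>+y\<in>ccube x t. h y \<partial>wdens w) = (\<integral>\<^sup>+y\<in>ccube x t. ennreal (w y) * h y \<partial>lebesgue)" for x
    using assms by (subst nn_integral_wdens) (auto simp: mult_ac)
  then show ?thesis by simp
qed

lemma cube_integral_measurable[measurable]:
  assumes "weight w" "g \<in> borel_measurable lebesgue"
  shows "(\<lambda>x. cube_integral w g x k) \<in> borel_measurable lebesgue"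
  unfolding cube_integral_def using assms by measurable

text \<open>Tonelli's theorem; the symmetry of membership turns the cube around \<open>x\<close>
  into one around \<open>y\<close>.\<close>

lemma swap_ccube_integral:
  fixes u v :: "real^'n::finite \<Rightarrow> real"
  assumes u: "weight u" and v: "weight v" and [measurable]: "h \<in> borel_measurable lebesgue"
  shows "(\<integral>\<^sup>+x. (\<integral>\<^sup>+y\<in>ccube x t. h y \<partial>wdens v) \<partial>wdens u) = (\<integral>\<^sup>+y. h y * emeasure (wdens u) (ccube y t) \<partial>wdens v)"
proof -
  interpret pair_sigma_finite "wdens u" "wdens v"
    unfolding wdens_def by (rule pair_sigma_finite_density) (use u v in \<open>auto simp: weight_def\<close>)
  have eq: "h y * indicator (ccube x t) y = (if y \<in> ccube x t then h y else 0)" for x y by simp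
  have "(\<integral>\<^sup>+x. (\<integral>\<^sup>+y\<in>ccube x t. h y \<partial>wdens v) \<partial>wdens u)
      = (\<integral>\<^sup>+y. \<integral>\<^sup>+x. h y * indicator (ccube x t) y \<partial>wdens u \<partial>wdens v)"
    unfolding eq by (rule Fubini'[symmetric]) measurable
  also have "\<dots> = (\<integral>\<^sup>+y. \<integral>\<^sup>+x. h y * indicator (ccube y t) x \<partial>wdens u \<partial>wdens v)"
    by (simp add: indicator_def mem_ccube_commute)
  also have "\<dots> = (\<integral>\<^sup>+y. h y * emeasure (wdens u) (ccube y t) \<partial>wdens v)"
    by (intro nn_integral_cong nn_integral_cmult_indicator) simp
  finally show ?thesis .
qed

text \<open>
  Only the part of \<open>g\<close> above half of its average over a cube matters for that average. Hence,
  after exchanging the integrals, at each point \<open>y\<close> only averages below \<open>2 * g y\<close> occur, and these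
  are summed by Hedberg's argument. No maximal function is needed since \<open>r > p\<close>.
\<close>

lemma fractional_Carleson_embedding:
  fixes u v :: "real^'n::finite \<Rightarrow> real"
  assumes u: "doubling_weight Du \<rho>u u" and v: "doubling_weight Dv \<rho>v v" and p: "1 < p" and r: "p < r"
  shows "\<exists>C>0. \<forall>g N. g \<in> borel_measurable lebesgue \<longrightarrow> (\<forall>x. 0 \<le> g x) \<longrightarrow> 0 < N \<longrightarrow>
     (\<integral>\<^sup>+x. ennreal (g x powr p) \<partial>wdens v) \<le> ennreal (N powr p) \<longrightarrow>
     (\<integral>\<^sup>+x. \<integral>\<^sup>+k. ennreal ((cube_mass v x k powr (1 / p) * (cube_integral v g x k / cube_mass v x k)) powr r
          / cube_mass u x k) \<partial>count_space UNIV \<partial>wdens u) \<le> ennreal (C * N powr r)"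
proof -
  define a where "a = r / p - 1"
  define b where "b = 1 - 1 / p"
  \<comment> \<open>The 2 comes from discarding the small values of \<open>g\<close>;
    \<open>Du\<close> and \<open>Dv powr (a + b)\<close> come from moving the centre of the cube
    from \<open>x\<close> to \<open>y\<close>.\<close>
  define c0 where "c0 = 2 * Du * Dv powr (a + b)"
  note u' = doubling_weightD[OF u] and v' = doubling_weightD[OF v]
  note [measurable] = cube_mass_measurable[OF u'(1)] cube_mass_measurable[OF v'(1)]
  have a: "0 < a" and b: "0 < b" using p r by (auto simp: a_def b_def field_simps)
  have ab: "a + b = (r - 1) / p" using p by (simp add: a_def b_def field_simps)
  have c0: "0 < c0" using u' v' by (simp add: c0_def)
  define C where "C = c0 * (geo_const \<rho>v a b * 2 powr (p - 1))"
  have geo: "0 < geo_const \<rho>v a b" by (rule geo_const_pos) (use v' a b in auto)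
  show ?thesis
  proof (intro exI[of _ C] conjI allI impI)
    show "0 < C" using c0 geo by (simp add: C_def)
    fix g :: "real^'n \<Rightarrow> real" and N :: real
    assume gm[measurable]: "g \<in> borel_measurable lebesgue" and "\<forall>x. 0 \<le> g x" and N: "0 < N"
      and gN: "(\<integral>\<^sup>+x. ennreal (g x powr p) \<partial>wdens v) \<le> ennreal (N powr p)"
    then have g0: "0 \<le> g x" for x by auto
    define m where "m x k = cube_mass v x k" for x k
    define W where "W x k = cube_mass u x k" for x k
    define G where "G x k = cube_integral v g x k" for x k
    have m: "0 < m x k" and W: "0 < W x k" for x k
      unfolding m_def W_def by (rule cube_mass_pos[OF v] cube_mass_pos[OF u])+
    have G0: "0 \<le> G x k" for x k by (simp add: G_def cube_integral_nonneg)
    have Hol: "(\<integral>\<^sup>+y\<in>ccube x (scale k). ennreal (g y) \<partial>wdens v) \<le> ennreal (N * m x k powr b)" for x k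
      unfolding m_def b_def by (rule cube_integral_Holder[OF v gm g0 p N gN])
    have GE: "(\<integral>\<^sup>+y\<in>ccube x (scale k). ennreal (g y) \<partial>wdens v) = ennreal (G x k)" for x k
      unfolding G_def cube_integral_def
      by (rule ennreal_enn2real[symmetric]) (rule le_less_trans[OF Hol[of x k]], simp)
    have avg_le: "G x k / m x k \<le> N * m x k powr (- (1 / p))" for x k
    proof -
      have "G x k \<le> N * m x k powr b"
        using Hol[of x k] N unfolding GE by (subst (asm) ennreal_le_iff) auto
      then have "G x k / m x k \<le> N * m x k powr b / m x k"
        using m[of x k] by (intro divide_right_mono) auto
      also have "\<dots> = N * m x k powr (- (1 / p))"
        using m[of x k] by (simp add: b_def powr_diff powr_minus_divide)
      finally show ?thesis .
    qed
    \<comment> \<open>The majorant after recentring at \<open>y\<close>. In the minimum, the first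
      entry uses that the average is below \<open>2 * g y\<close>, the second uses the Hoelder bound
      \<open>avg_le\<close>; the exponents \<open>a\<close> and \<open>- b\<close> of opposite sign
      make the sum over \<open>k\<close> converge.\<close>
    define H where "H k y = c0 * (g y / W y k) *
        min ((2 * g y) powr (r - 1) * m y k powr a) (N powr (r - 1) * m y k powr (- b))" for k y
    have Hm[measurable]: "(\<lambda>y. H k y) \<in> borel_measurable lebesgue" for k
      unfolding H_def W_def m_def by measurable
    have H0: "0 \<le> H k y" for k y unfolding H_def using c0 g0[of y] W[of y k] by simp
    \<comment> \<open>Where \<open>2 * g y\<close> is at most the average, \<open>g\<close>
      contributes at most half of \<open>G x k\<close>, and this half is absorbed on the left. The
      remaining integral might be infinite, hence the case distinction.\<close>
    have half: "ennreal (G x k) \<le> ennreal 2 * (\<integral>\<^sup>+y\<in>ccube x (scale k). (if G x k / m x k < 2 * g y then ennreal (g y) else 0) \<partial>wdens v)"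
      (is "_ \<le> _ * ?I") for x k
    proof -
      have "ennreal (G x k) \<le> (\<integral>\<^sup>+y. ennreal (G x k / m x k / 2) * indicator (ccube x (scale k)) y +
         (if G x k / m x k < 2 * g y then ennreal (g y) else 0) * indicator (ccube x (scale k)) y \<partial>wdens v)"
        unfolding GE[symmetric] by (intro nn_integral_mono) (auto split: split_indicator intro!: ennreal_leI)
      also have "\<dots> = ennreal (G x k / m x k / 2) * ennreal (m x k) + ?I"
        by (subst nn_integral_add) (simp_all add: nn_integral_cmult_indicator emeasure_cube_mass[OF v] m_def)
      also have "ennreal (G x k / m x k / 2) * ennreal (m x k) = ennreal (G x k / 2)"
        using m[of x k] G0[of x k] by (simp add: ennreal_mult'[symmetric])
      finally have le: "ennreal (G x k) \<le> ennreal (G x k / 2) + ?I" .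
      show ?thesis
      proof (cases ?I)
        case (real i)
        then have "G x k \<le> G x k / 2 + i"
          using le G0[of x k] by (simp add: ennreal_plus[symmetric] del: ennreal_plus)
        then have "ennreal (G x k) \<le> ennreal (2 * i)" by (intro ennreal_leI) simp
        also have "\<dots> = ennreal 2 * ennreal i" by (rule ennreal_mult') simp
        finally show ?thesis using real by simp
      qed (simp add: ennreal_mult_top)
    qed
    have term_le: "ennreal ((m x k powr (1 / p) * (G x k / m x k)) powr r / W x k)
        \<le> (\<integral>\<^sup>+y\<in>ccube x (scale k). ennreal (H k y) \<partial>wdens v)" for x k
    proof -
      define A where "A = G x k / m x k"
      have A0: "0 \<le> A" using G0[of x k] m[of x k] by (simp add: A_def)
      define E where "E = m x k powr a * A powr (r - 1) / W x k"
      have E0: "0 \<le> E" using W[of x k] by (simp add: E_def)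
      \<comment> \<open>One factor \<open>A\<close> is kept as the integral \<open>G x k\<close>, so
        that it can be exchanged with the outer integral; only \<open>A powr (r - 1)\<close> is
        estimated pointwise.\<close>
      have "(m x k powr (1 / p) * A) powr r = m x k powr (r / p) * (A powr (r - 1) * A)"
        using A0 m[of x k] r p by (cases "A = 0") (auto simp: powr_mult powr_powr powr_diff)
      also have "m x k powr (r / p) = m x k powr a * m x k"
        using m[of x k] by (simp add: a_def powr_diff)
      finally have eq: "(m x k powr (1 / p) * A) powr r / W x k = E * G x k"
        using m[of x k] by (simp add: E_def A_def)
      have ptw: "2 * E * g y \<le> H k y" if y: "y \<in> ccube x (scale k)" and Ag: "A < 2 * g y" for y
      proof -
        have x: "x \<in> ccube y (scale k)" using y mem_ccube_commute by blast
        have mm: "m x k \<le> Dv * m y k" "m y k \<le> Dv * m x k"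
          unfolding m_def by (rule cube_mass_doubling[OF v] x y)+
        have WW: "W y k \<le> Du * W x k" unfolding W_def by (rule cube_mass_doubling[OF u y])
        have p1: "A powr (r - 1) \<le> (2 * g y) powr (r - 1)"
          using A0 Ag p r by (intro powr_mono2) auto
        have "m x k powr a \<le> (Dv * m y k) powr a"
          using m[of x k] a mm by (intro powr_mono2) auto
        also have "\<dots> = Dv powr a * m y k powr a"
          by (rule powr_mult)
        also have "\<dots> \<le> Dv powr (a + b) * m y k powr a"
          using v'(2) b by (intro mult_right_mono powr_mono) auto
        finally have ma: "m x k powr a \<le> Dv powr (a + b) * m y k powr a" .
        have "m x k powr (- b) \<le> (m y k / Dv) powr (- b)"
          using m[of x k] m[of y k] b mm v'(2) by (intro powr_mono2') (auto simp: field_simps)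
        also have "\<dots> = Dv powr b * m y k powr (- b)"
          using v'(2) m[of y k] by (simp add: powr_divide powr_minus_divide)
        also have "\<dots> \<le> Dv powr (a + b) * m y k powr (- b)"
          using v'(2) a by (intro mult_right_mono powr_mono) auto
        finally have mb: "m x k powr (- b) \<le> Dv powr (a + b) * m y k powr (- b)" .
        have l1: "m x k powr a * A powr (r - 1) \<le> Dv powr (a + b) * ((2 * g y) powr (r - 1) * m y k powr a)"
          using mult_mono[OF ma p1] by (simp add: mult_ac)
        have "A powr (r - 1) \<le> (N * m x k powr (- (1 / p))) powr (r - 1)"
          using A0 avg_le[of x k] p r unfolding A_def by (intro powr_mono2) auto
        also have "\<dots> = N powr (r - 1) * m x k powr (- (a + b))"
          by (simp add: powr_mult powr_powr ab)
        finally have "m x k powr a * A powr (r - 1) \<le> m x k powr a * (N powr (r - 1) * m x k powr (- (a + b)))"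
          by (intro mult_left_mono) auto
        also have "\<dots> = N powr (r - 1) * m x k powr (- b)"
          using m[of x k] by (simp add: powr_add[symmetric] mult.left_commute)
        also have "\<dots> \<le> N powr (r - 1) * (Dv powr (a + b) * m y k powr (- b))"
          by (intro mult_left_mono mb) auto
        finally have l2: "m x k powr a * A powr (r - 1) \<le> Dv powr (a + b) * (N powr (r - 1) * m y k powr (- b))"
          by (simp add: mult_ac)
        define M where "M = min ((2 * g y) powr (r - 1) * m y k powr a) (N powr (r - 1) * m y k powr (- b))"
        have M0: "0 \<le> M" by (simp add: M_def)
        have l3: "m x k powr a * A powr (r - 1) \<le> Dv powr (a + b) * M"
          using l1 l2 by (auto simp: M_def min_def)
        have l4: "1 / W x k \<le> Du / W y k" using WW W[of x k] W[of y k] by (simp add: field_simps)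
        have "E \<le> Dv powr (a + b) * M * (Du / W y k)"
          using mult_mono[OF l3 l4] M0 W[of x k] by (simp add: E_def)
        then have "2 * E * g y \<le> 2 * (Dv powr (a + b) * M * (Du / W y k)) * g y"
          using g0[of y] by (intro mult_right_mono mult_left_mono) auto
        also have "\<dots> = H k y" by (simp add: H_def c0_def M_def mult_ac)
        finally show ?thesis .
      qed
      have "ennreal ((m x k powr (1 / p) * (G x k / m x k)) powr r / W x k) = ennreal E * ennreal (G x k)"
        using eq E0 by (simp add: A_def[symmetric] ennreal_mult')
      also have "\<dots> \<le> ennreal E * (ennreal 2 * (\<integral>\<^sup>+y\<in>ccube x (scale k). (if A < 2 * g y then ennreal (g y) else 0) \<partial>wdens v))"
        unfolding A_def by (intro mult_left_mono half) auto
      also have "\<dots> = (\<integral>\<^sup>+y. ennreal (2 * E) * ((if A < 2 * g y then ennreal (g y) else 0) * indicator (ccube x (scale k)) y) \<partial>wdens v)"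
        using E0 by (subst nn_integral_cmult) (auto simp: ennreal_mult' mult_ac)
      also have "\<dots> \<le> (\<integral>\<^sup>+y\<in>ccube x (scale k). ennreal (H k y) \<partial>wdens v)"
        using ptw E0 by (intro nn_integral_mono) (auto simp: ennreal_mult'[symmetric] split: split_indicator intro!: ennreal_leI)
      finally show ?thesis .
    qed
    have HW: "ennreal (H k y) * ennreal (W y k)
        = ennreal (c0 * g y) * ennreal (min ((2 * g y) powr (r - 1) * m y k powr a) (N powr (r - 1) * m y k powr (- b)))" for k y
      using W[of y k] H0[of k y] c0 g0[of y] by (simp add: H_def ennreal_mult'[symmetric])
    have "(\<integral>\<^sup>+x. \<integral>\<^sup>+k. ennreal ((m x k powr (1 / p) * (G x k / m x k)) powr r / W x k) \<partial>count_space UNIV \<partial>wdens u)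
       \<le> (\<integral>\<^sup>+x. \<integral>\<^sup>+k. (\<integral>\<^sup>+y\<in>ccube x (scale k). ennreal (H k y) \<partial>wdens v) \<partial>count_space UNIV \<partial>wdens u)"
      by (intro nn_integral_mono term_le)
    also have "\<dots> = (\<integral>\<^sup>+k. \<integral>\<^sup>+x. (\<integral>\<^sup>+y\<in>ccube x (scale k). ennreal (H k y) \<partial>wdens v) \<partial>wdens u \<partial>count_space UNIV)"
      using wdens_ccube_nn_integral_measurable[OF v'(1)]
      by (intro nn_integral_count_space_nn_integral) (auto cong: measurable_cong_sets)
    also have "\<dots> = (\<integral>\<^sup>+k. \<integral>\<^sup>+y. ennreal (H k y) * ennreal (W y k) \<partial>wdens v \<partial>count_space UNIV)"
      by (simp add: swap_ccube_integral[OF u'(1) v'(1)] emeasure_cube_mass[OF u] W_def)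
    also have "\<dots> = (\<integral>\<^sup>+y. \<integral>\<^sup>+k. ennreal (H k y) * ennreal (W y k) \<partial>count_space UNIV \<partial>wdens v)"
      by (rule nn_integral_count_space_nn_integral[symmetric]) (auto simp: W_def)
    also have "\<dots> \<le> (\<integral>\<^sup>+y. ennreal (C * N powr (r - p)) * ennreal (g y powr p) \<partial>wdens v)"
    proof (rule nn_integral_mono)
      fix y
      have "(\<integral>\<^sup>+k. ennreal (H k y) * ennreal (W y k) \<partial>count_space UNIV)
         = ennreal (c0 * g y) * (\<integral>\<^sup>+k. ennreal (min ((2 * g y) powr (r - 1) * m y k powr a) (N powr (r - 1) * m y k powr (- b))) \<partial>count_space UNIV)"
        unfolding HW by (rule nn_integral_cmult) simp
      \<comment> \<open>The interpolation exponents give \<open>g y\<close> the power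
        \<open>p - 1\<close> and \<open>N\<close> the power \<open>r - p\<close>. With the factor
        \<open>g y\<close> in front, exactly \<open>g y powr p\<close> is left to integrate.\<close>
      also have "\<dots> \<le> ennreal (c0 * g y) * ennreal (geo_const \<rho>v a b *
          (((2 * g y) powr (r - 1)) powr (b / (a + b)) * (N powr (r - 1)) powr (a / (a + b))))"
        unfolding m_def
        by (intro mult_left_mono geometric_sum_min a b v'(3) cube_mass_pos[OF v] cube_mass_grow[OF v]) auto
      also have "((2 * g y) powr (r - 1)) powr (b / (a + b)) = (2 * g y) powr (p - 1)"
      proof -
        have "(r - 1) * (b / (a + b)) = p - 1" using p r unfolding ab by (simp add: b_def field_simps)
        then show ?thesis by (simp add: powr_powr)
      qed
      also have "(N powr (r - 1)) powr (a / (a + b)) = N powr (r - p)"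
      proof -
        have "(r - 1) * (a / (a + b)) = r - p" using p r unfolding ab by (simp add: a_def field_simps)
        then show ?thesis by (simp add: powr_powr)
      qed
      also have "ennreal (c0 * g y) * ennreal (geo_const \<rho>v a b * ((2 * g y) powr (p - 1) * N powr (r - p)))
          = ennreal (c0 * g y * (geo_const \<rho>v a b * ((2 * g y) powr (p - 1) * N powr (r - p))))"
        using c0 g0[of y] by (intro ennreal_mult'[symmetric]) auto
      also have "c0 * g y * (geo_const \<rho>v a b * ((2 * g y) powr (p - 1) * N powr (r - p))) = C * N powr (r - p) * g y powr p"
        using g0[of y] p by (cases "g y = 0") (auto simp: C_def powr_mult powr_diff)
      also have "ennreal (C * N powr (r - p) * g y powr p) = ennreal (C * N powr (r - p)) * ennreal (g y powr p)"
        by (rule ennreal_mult'') simp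
      finally show "(\<integral>\<^sup>+k. ennreal (H k y) * ennreal (W y k) \<partial>count_space UNIV) \<le> ennreal (C * N powr (r - p)) * ennreal (g y powr p)" .
    qed
    also have "\<dots> = ennreal (C * N powr (r - p)) * (\<integral>\<^sup>+y. ennreal (g y powr p) \<partial>wdens v)"
      by (rule nn_integral_cmult) simp
    also have "\<dots> \<le> ennreal (C * N powr (r - p)) * ennreal (N powr p)"
      by (intro mult_left_mono gN) auto
    also have "\<dots> = ennreal (C * N powr r)"
      using N by (simp add: ennreal_mult''[symmetric] powr_diff)
    finally show "(\<integral>\<^sup>+x. \<integral>\<^sup>+k. ennreal ((cube_mass v x k powr (1 / p) * (cube_integral v g x k / cube_mass v x k)) powr r
          / cube_mass u x k) \<partial>count_space UNIV \<partial>wdens u) \<le> ennreal (C * N powr r)"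
      unfolding m_def W_def G_def .
  qed
qed

text \<open>A dyadic model of the multilinear fractional integral with kernel
  \<open>spread x y powr (- \<beta>)\<close>. At each scale the integral over tuples factorises, so
  the weights can be treated one at a time.\<close>

definition frac_sum :: "real \<Rightarrow> ('m::finite \<Rightarrow> real^'n::finite \<Rightarrow> real) \<Rightarrow> real^'n \<Rightarrow> ennreal" where
  "frac_sum \<beta> \<phi> x = (\<integral>\<^sup>+k. ennreal (scale k powr (- \<beta>)) *
      (\<Prod>i\<in>UNIV. \<integral>\<^sup>+y\<in>ccube x (scale k). ennreal (\<phi> i y) \<partial>lebesgue) \<partial>count_space UNIV)"

text \<open>The change of measure from dx to \<sigma> dx, with \<phi> replaced by \<phi>/\<sigma>.
  The division is harmless because \<sigma> is positive almost everywhere.\<close>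

lemma cube_integral_quotient:
  fixes \<sigma> \<phi> :: "real^'n::finite \<Rightarrow> real"
  assumes \<sigma>: "doubling_weight D \<rho> \<sigma>" and [measurable]: "\<phi> \<in> borel_measurable lebesgue" and \<phi>0: "\<And>x. 0 \<le> \<phi> x"
    and p: "1 < p" and N: "0 < N"
    and gN: "(\<integral>\<^sup>+x. ennreal ((\<phi> x / \<sigma> x) powr p) \<partial>wdens \<sigma>) \<le> ennreal (N powr p)"
  shows "(\<integral>\<^sup>+y\<in>ccube x (scale k). ennreal (\<phi> y) \<partial>lebesgue) = ennreal (cube_integral \<sigma> (\<lambda>x. \<phi> x / \<sigma> x) x k)"
    and "cube_integral \<sigma> (\<lambda>x. \<phi> x / \<sigma> x) x k \<le> N * cube_mass \<sigma> x k powr (1 - 1 / p)"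
proof -
  note w = doubling_weightD[OF \<sigma>]
  have [measurable]: "\<sigma> \<in> borel_measurable lebesgue" using w by (auto simp: weight_def)
  have \<sigma>0: "0 \<le> \<sigma> x" for x using w by (auto simp: weight_def)
  have eq: "(\<integral>\<^sup>+y\<in>ccube x (scale k). ennreal (\<phi> y / \<sigma> y) \<partial>wdens \<sigma>) = (\<integral>\<^sup>+y\<in>ccube x (scale k). ennreal (\<phi> y) \<partial>lebesgue)"
  proof (subst nn_integral_wdens[OF w(1)])
    have "AE y in lebesgue. ennreal (\<sigma> y) * (ennreal (\<phi> y / \<sigma> y) * indicator (ccube x (scale k)) y)
        = ennreal (\<phi> y) * indicator (ccube x (scale k)) y"
      using w(4) by eventually_elim (simp add: ennreal_mult'[symmetric] split: split_indicator)
    then show "(\<integral>\<^sup>+y. ennreal (\<sigma> y) * (ennreal (\<phi> y / \<sigma> y) * indicator (ccube x (scale k)) y) \<partial>lebesgue)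
        = (\<integral>\<^sup>+y\<in>ccube x (scale k). ennreal (\<phi> y) \<partial>lebesgue)"
      by (rule nn_integral_cong_AE)
  qed simp
  have Hol: "(\<integral>\<^sup>+y\<in>ccube x (scale k). ennreal (\<phi> y / \<sigma> y) \<partial>wdens \<sigma>) \<le> ennreal (N * cube_mass \<sigma> x k powr (1 - 1 / p))"
    by (rule cube_integral_Holder[OF \<sigma>]) (use \<phi>0 \<sigma>0 p N gN in auto)
  have e: "(\<integral>\<^sup>+y\<in>ccube x (scale k). ennreal (\<phi> y / \<sigma> y) \<partial>wdens \<sigma>) = ennreal (cube_integral \<sigma> (\<lambda>x. \<phi> x / \<sigma> x) x k)"
    unfolding cube_integral_def by (rule ennreal_enn2real[symmetric]) (rule le_less_trans[OF Hol], simp)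
  show "(\<integral>\<^sup>+y\<in>ccube x (scale k). ennreal (\<phi> y) \<partial>lebesgue) = ennreal (cube_integral \<sigma> (\<lambda>x. \<phi> x / \<sigma> x) x k)"
    using eq e by simp
  show "cube_integral \<sigma> (\<lambda>x. \<phi> x / \<sigma> x) x k \<le> N * cube_mass \<sigma> x k powr (1 - 1 / p)"
    using Hol N unfolding e by (subst (asm) ennreal_le_iff) auto
qed

lemma nn_integral_count_space_ge: "f k \<le> (\<integral>\<^sup>+j. f j \<partial>count_space UNIV)"
proof -
  have "f k = (\<integral>\<^sup>+j. f k * indicator {k} j \<partial>count_space UNIV)"
    by (subst nn_integral_cmult_indicator) auto
  also have "\<dots> \<le> (\<integral>\<^sup>+j. f j \<partial>count_space UNIV)"
    by (intro nn_integral_mono) (auto split: split_indicator)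
  finally show ?thesis .
qed

lemma borel_measurable_nn_integral_count_space:
  fixes f :: "'i::countable \<Rightarrow> 'a \<Rightarrow> ennreal"
  assumes "\<And>k. f k \<in> borel_measurable M"
  shows "(\<lambda>x. \<integral>\<^sup>+k. f k x \<partial>count_space UNIV) \<in> borel_measurable M"
proof -
  interpret sigma_finite_measure "count_space (UNIV :: 'i set)"
    by (rule sigma_finite_measure_count_space_countable) simp
  have "(\<lambda>z. f (snd z) (fst z)) \<in> borel_measurable (M \<Otimes>\<^sub>M count_space UNIV)"
    by (rule measurable_compose_countable'[where f = "\<lambda>k z. f k (fst z)" and g = snd and I = UNIV])
       (auto intro: measurable_compose[OF measurable_fst assms])
  then show ?thesis
    using borel_measurable_nn_integral[of "\<lambda>x k. f k x" M] by (simp add: case_prod_unfold)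
qed

text \<open>Each \<open>h k\<close> has two bounds: the uniform bound \<open>B\<close>, good for
  large \<open>w k\<close>, and \<open>S * w k powr (1 / r)\<close>, good for small
  \<open>w k\<close>, since a single term cannot exceed the sum on the right.
  \<open>geometric_sum_min\<close> balances the two.\<close>

lemma Hedberg_pointwise:
  fixes w h :: "int \<Rightarrow> real"
  assumes \<rho>: "1 < \<rho>" and w: "\<And>k. 0 < w k" and grow: "\<And>k. \<rho> * w k \<le> w (k + 1)"
    and r: "0 < r" and q: "r < q" and h0: "\<And>k. 0 \<le> h k" and hB: "\<And>k. h k \<le> B" and B: "0 < B" and c: "0 < c"
    and y: "0 \<le> y" "ennreal y \<le> (\<integral>\<^sup>+k. ennreal (c * w k powr (- (1 / q)) * h k) \<partial>count_space UNIV)"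
  shows "ennreal (y powr q) \<le> ennreal ((geo_const \<rho> (1 / r - 1 / q) (1 / q) * c) powr q * B powr (q - r))
       * (\<integral>\<^sup>+k. ennreal (h k powr r / w k) \<partial>count_space UNIV)" (is "_ \<le> ennreal ?K * ?Z")
proof (cases ?Z)
  case (real z)
  define a where "a = 1 / r - 1 / q"
  define b where "b = 1 / q"
  define S where "S = z powr (1 / r)"
  have a: "0 < a" and b: "0 < b" using r q by (auto simp: a_def b_def field_simps)
  define g where "g = geo_const \<rho> a b"
  have g: "0 < g" unfolding g_def by (rule geo_const_pos) (use \<rho> a b in auto)
  have hS: "h k \<le> S * w k powr (1 / r)" for k
  proof -
    have "ennreal (h k powr r / w k) \<le> ennreal z"
      using nn_integral_count_space_ge[of "\<lambda>k. ennreal (h k powr r / w k)" k] real by simp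
    then have "h k powr r / w k \<le> z" using real by (subst (asm) ennreal_le_iff) auto
    then have "h k powr r \<le> z * w k" using w[of k] by (simp add: field_simps)
    then have "(h k powr r) powr (1 / r) \<le> (z * w k) powr (1 / r)"
      using r by (intro powr_mono2) auto
    then show ?thesis using r h0[of k] by (simp add: powr_powr powr_mult S_def)
  qed
  have "ennreal y \<le> (\<integral>\<^sup>+k. ennreal (min (c * S * w k powr a) (c * B * w k powr (- b))) \<partial>count_space UNIV)"
  proof (rule order_trans[OF y(2)], intro nn_integral_mono ennreal_leI min.boundedI)
    fix k
    have "c * w k powr (- (1 / q)) * h k \<le> c * w k powr (- (1 / q)) * (S * w k powr (1 / r))"
      using c by (intro mult_left_mono hS) auto
    also have "\<dots> = c * S * w k powr a"
      using w[of k] by (simp add: a_def powr_diff powr_minus_divide)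
    finally show "c * w k powr (- (1 / q)) * h k \<le> c * S * w k powr a" .
    have "c * w k powr (- (1 / q)) * h k \<le> c * w k powr (- (1 / q)) * B"
      using c by (intro mult_left_mono hB) auto
    then show "c * w k powr (- (1 / q)) * h k \<le> c * B * w k powr (- b)"
      by (simp add: b_def mult_ac)
  qed
  also have "\<dots> \<le> ennreal (g * ((c * S) powr (b / (a + b)) * (c * B) powr (a / (a + b))))"
    unfolding g_def
    by (rule geometric_sum_min[OF \<rho> a b]) (use c B w grow in \<open>auto simp: S_def\<close>)
  finally have "y \<le> g * ((c * S) powr (b / (a + b)) * (c * B) powr (a / (a + b)))"
    using g by (subst (asm) ennreal_le_iff) auto
  \<comment> \<open>As \<open>S powr r = z\<close>, this exponent makes \<open>z\<close> appear to
    the first power once \<open>y\<close> is raised to the power \<open>q\<close>; the bound is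
    linear in the sum and can be integrated.\<close>
  also have "b / (a + b) = r / q" using r q by (simp add: a_def b_def)
  also have "a / (a + b) = 1 - r / q" using r q by (simp add: a_def b_def field_simps)
  finally have "y powr q \<le> (g * ((c * S) powr (r / q) * (c * B) powr (1 - r / q))) powr q"
    using y r q by (intro powr_mono2) auto
  also have "\<dots> = g powr q * ((c * S) powr r * (c * B) powr (q - r))"
  proof -
    have "(1 - r / q) * q = q - r" using r q by (simp add: field_simps)
    then show ?thesis using r q by (simp add: powr_mult powr_powr)
  qed
  also have "\<dots> = g powr q * (c powr r * c powr (q - r)) * (S powr r * B powr (q - r))"
    by (simp add: powr_mult mult_ac)
  also have "c powr r * c powr (q - r) = c powr q" by (simp add: powr_add[symmetric])
  also have "S powr r = z" using real r by (simp add: S_def powr_powr)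
  also have "g powr q * c powr q * (z * B powr (q - r)) = ?K * z"
    by (simp add: g_def a_def b_def powr_mult mult_ac)
  finally have "ennreal (y powr q) \<le> ennreal (?K * z)" by (rule ennreal_leI)
  also have "\<dots> = ennreal ?K * ?Z" using real by (simp add: ennreal_mult'')
  finally show ?thesis .
next
  case top
  have "0 < geo_const \<rho> (1 / r - 1 / q) (1 / q)"
    using \<rho> r q by (intro geo_const_pos) (auto simp: field_simps)
  then have "ennreal ?K \<noteq> 0" using c B by simp
  then show ?thesis using top by (simp add: ennreal_mult_top)
qed

text \<open>\<open>bal\<close> converts \<open>scale k powr (- \<beta>)\<close> into negative powers
  of the cube masses, which normalise the averages. After the pointwise bound, weighted AM-GM splits
  the product over \<open>i\<close>, so that the linear embedding can be applied to each argument
  separately.\<close>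

lemma fractional_sum_bound:
  fixes \<sigma> :: "'m::finite \<Rightarrow> real^'n::finite \<Rightarrow> real" and p :: "'m \<Rightarrow> real"
  assumes \<mu>: "doubling_weight D0 \<rho>0 \<mu>" and \<sigma>: "\<And>i. doubling_weight (D i) (\<rho> i) (\<sigma> i)"
    and p: "\<And>i. 1 < p i" and q: "0 < q" and pq: "1 / q < (\<Sum>i\<in>UNIV. 1 / p i)"
    and CA: "0 < CA" and bal: "\<And>x k. cube_mass \<mu> x k powr (1 / q) * (\<Prod>i\<in>UNIV. cube_mass (\<sigma> i) x k powr (1 - 1 / p i))
        \<le> CA * scale k powr \<beta>"
  shows "\<exists>C>0. \<forall>\<phi> N \<psi>. (\<forall>i. \<phi> i \<in> borel_measurable lebesgue) \<longrightarrow> (\<forall>i x. 0 \<le> \<phi> i x) \<longrightarrow> (\<forall>i. 0 < N i) \<longrightarrow>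
     (\<forall>i. (\<integral>\<^sup>+x. ennreal ((\<phi> i x / \<sigma> i x) powr p i) \<partial>wdens (\<sigma> i)) \<le> ennreal (N i powr p i)) \<longrightarrow>
     (\<forall>x. 0 \<le> \<psi> x) \<longrightarrow> (AE x in lebesgue. ennreal (\<psi> x) \<le> frac_sum \<beta> \<phi> x) \<longrightarrow>
     (\<integral>\<^sup>+x. ennreal (\<psi> x powr q) \<partial>wdens \<mu>) \<le> ennreal (C * (\<Prod>i\<in>UNIV. N i) powr q)"
proof -
  define P where "P = 1 / (\<Sum>i\<in>UNIV. 1 / p i)"
  have sp: "0 < (\<Sum>i\<in>UNIV. 1 / p i)" using pq q by (smt (verit) divide_pos_pos)
  have P: "0 < P" using sp by (simp add: P_def)
  have "P < q" using pq q sp by (simp add: P_def field_simps)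
  \<comment> \<open>\<open>r < q\<close> is what the pointwise bound needs, and \<open>P < r\<close>
    makes every exponent \<open>R i\<close> exceed \<open>p i\<close>, as the embedding
    requires.\<close>
  then obtain r where r: "P < r" "r < q" using dense by blast
  \<comment> \<open>The share of the i-th argument in \<open>1 / P\<close>; these shares sum to 1
    and are the weights in the AM-GM step.\<close>
  define t where "t i = P / p i" for i
  have t0: "0 < t i" for i using P p[of i] by (simp add: t_def)
  have t1: "(\<Sum>i\<in>UNIV. t i) = 1" using sp by (simp add: t_def P_def sum_divide_distrib[symmetric] divide_inverse sum_distrib_left[symmetric])
  define R where "R i = r / t i" for i
  have R: "p i < R i" for i using P p[of i] r by (simp add: R_def t_def field_simps)
  note \<mu>' = doubling_weightD[OF \<mu>] and \<sigma>' = doubling_weightD[OF \<sigma>]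
  define X where "X g i x k = cube_mass (\<sigma> i) x k powr (1 / p i) * (cube_integral (\<sigma> i) (g i) x k / cube_mass (\<sigma> i) x k)"
    for g i x k
  have "\<forall>i. \<exists>C>0. \<forall>g N. g \<in> borel_measurable lebesgue \<longrightarrow> (\<forall>x. 0 \<le> g x) \<longrightarrow> 0 < N \<longrightarrow>
     (\<integral>\<^sup>+x. ennreal (g x powr p i) \<partial>wdens (\<sigma> i)) \<le> ennreal (N powr p i) \<longrightarrow>
     (\<integral>\<^sup>+x. \<integral>\<^sup>+k. ennreal (X (\<lambda>_. g) i x k powr R i / cube_mass \<mu> x k) \<partial>count_space UNIV \<partial>wdens \<mu>) \<le> ennreal (C * N powr R i)"
    unfolding X_def using fractional_Carleson_embedding[OF \<mu> \<sigma> p R] by blast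
  then obtain Ce where Ce: "\<And>i. 0 < Ce i" and emb: "\<And>i g N. g \<in> borel_measurable lebesgue \<Longrightarrow> (\<And>x. 0 \<le> g x) \<Longrightarrow> 0 < N \<Longrightarrow>
     (\<integral>\<^sup>+x. ennreal (g x powr p i) \<partial>wdens (\<sigma> i)) \<le> ennreal (N powr p i) \<Longrightarrow>
     (\<integral>\<^sup>+x. \<integral>\<^sup>+k. ennreal (X (\<lambda>_. g) i x k powr R i / cube_mass \<mu> x k) \<partial>count_space UNIV \<partial>wdens \<mu>) \<le> ennreal (Ce i * N powr R i)"
    unfolding choice_iff by blast
  define K where "K = (geo_const \<rho>0 (1 / r - 1 / q) (1 / q) * CA) powr q"
  have "0 < geo_const \<rho>0 (1 / r - 1 / q) (1 / q)"
    using \<mu>' r P by (intro geo_const_pos) (auto simp: field_simps)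
  then have K: "0 < K" using CA by (simp add: K_def)
  define C where "C = K * (\<Sum>i\<in>UNIV. t i * Ce i)"
  have sC: "0 < (\<Sum>i\<in>UNIV. t i * Ce i)" using t0 Ce by (intro sum_pos) auto
  show ?thesis
  proof (intro exI[of _ C] conjI allI impI)
    show "0 < C" using K sC by (simp add: C_def)
    fix \<phi> :: "'m \<Rightarrow> real^'n \<Rightarrow> real" and N :: "'m \<Rightarrow> real" and \<psi> :: "real^'n \<Rightarrow> real"
    assume "\<forall>i. \<phi> i \<in> borel_measurable lebesgue" and "\<forall>i x. 0 \<le> \<phi> i x" and "\<forall>i. 0 < N i"
      and "\<forall>i. (\<integral>\<^sup>+x. ennreal ((\<phi> i x / \<sigma> i x) powr p i) \<partial>wdens (\<sigma> i)) \<le> ennreal (N i powr p i)"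
      and "\<forall>x. 0 \<le> \<psi> x" and ae: "AE x in lebesgue. ennreal (\<psi> x) \<le> frac_sum \<beta> \<phi> x"
    then have [measurable]: "\<And>i. \<phi> i \<in> borel_measurable lebesgue" and \<phi>0: "\<And>i x. 0 \<le> \<phi> i x" and N: "\<And>i. 0 < N i"
      and \<phi>N: "\<And>i. (\<integral>\<^sup>+x. ennreal ((\<phi> i x / \<sigma> i x) powr p i) \<partial>wdens (\<sigma> i)) \<le> ennreal (N i powr p i)"
      and \<psi>0: "\<And>x. 0 \<le> \<psi> x" by auto
    have [measurable]: "\<And>i. \<sigma> i \<in> borel_measurable lebesgue" using \<sigma>' by (auto simp: weight_def)
    have \<sigma>0: "0 \<le> \<sigma> i x" for i x using \<sigma>' by (auto simp: weight_def)
    define g where "g i x = \<phi> i x / \<sigma> i x" for i x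
    have gm[measurable]: "g i \<in> borel_measurable lebesgue" for i unfolding g_def by measurable
    have g0: "0 \<le> g i x" for i x using \<phi>0 \<sigma>0 by (simp add: g_def)
    have gN: "(\<integral>\<^sup>+x. ennreal (g i x powr p i) \<partial>wdens (\<sigma> i)) \<le> ennreal (N i powr p i)" for i
      using \<phi>N by (simp add: g_def)
    define B where "B = (\<Prod>i\<in>UNIV. N i)"
    have B: "0 < B" using N by (simp add: B_def prod_pos)
    \<comment> \<open>The \<sigma>-average of \<open>g i\<close>, scaled so that Hoelder's
      inequality bounds it by \<open>N i\<close> at all points and scales.\<close>
    define h where "h i x k = X g i x k" for i x k
    define H where "H x k = (\<Prod>i\<in>UNIV. h i x k)" for x k
    note mpos = cube_mass_pos[OF \<mu>] cube_mass_pos[OF \<sigma>]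
    have hm[measurable]: "(\<lambda>x. h i x k) \<in> borel_measurable lebesgue" for i k
    proof -
      note [measurable] = cube_mass_measurable[OF \<sigma>'(1)] cube_integral_measurable[OF \<sigma>'(1) gm]
      show ?thesis unfolding h_def X_def by measurable
    qed
    note [measurable] = cube_mass_measurable[OF \<mu>'(1)]
    have h0: "0 \<le> h i x k" for i x k
      using mpos(2)[of i x k] cube_integral_nonneg[of "\<sigma> i" "g i" x k] by (simp add: h_def X_def)
    have hN: "h i x k \<le> N i" for i x k
    proof -
      have "cube_integral (\<sigma> i) (g i) x k \<le> N i * cube_mass (\<sigma> i) x k powr (1 - 1 / p i)"
        unfolding g_def by (rule cube_integral_quotient(2)[OF \<sigma>]) (use \<phi>0 p N \<phi>N in auto)
      then have "h i x k \<le> cube_mass (\<sigma> i) x k powr (1 / p i) * (N i * cube_mass (\<sigma> i) x k powr (1 - 1 / p i) / cube_mass (\<sigma> i) x k)"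
        unfolding h_def X_def using mpos(2)[of i x k] by (intro mult_left_mono divide_right_mono) auto
      also have "\<dots> = N i"
        using mpos(2)[of i x k] by (simp add: powr_diff)
      finally show ?thesis .
    qed
    have H0: "0 \<le> H x k" for x k unfolding H_def using h0 by (simp add: prod_nonneg)
    have HB: "H x k \<le> B" for x k unfolding H_def B_def using h0 hN by (intro prod_mono) auto
    have frac_le: "frac_sum \<beta> \<phi> x \<le> (\<integral>\<^sup>+k. ennreal (CA * cube_mass \<mu> x k powr (- (1 / q)) * H x k) \<partial>count_space UNIV)" for x
      unfolding frac_sum_def
    proof (rule nn_integral_mono)
      fix k
      define I where "I i = cube_integral (\<sigma> i) (g i) x k" for i
      have I0: "0 \<le> I i" for i by (simp add: I_def cube_integral_nonneg)
      define s where "s i = cube_mass (\<sigma> i) x k" for i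
      have s: "0 < s i" for i using mpos by (simp add: s_def)
      define m where "m = cube_mass \<mu> x k"
      have m: "0 < m" using mpos by (simp add: m_def)
      have Ieq: "(\<integral>\<^sup>+y\<in>ccube x (scale k). ennreal (\<phi> i y) \<partial>lebesgue) = ennreal (I i)" for i
        unfolding I_def g_def by (rule cube_integral_quotient(1)[OF \<sigma>]) (use \<phi>0 p N \<phi>N in auto)
      have hI: "h i x k = I i * s i powr (- (1 - 1 / p i))" for i
        using s[of i] by (simp add: h_def X_def I_def s_def powr_diff powr_minus_divide)
      have "m powr (1 / q) * (\<Prod>i\<in>UNIV. s i powr (1 - 1 / p i)) \<le> CA * scale k powr \<beta>"
        using bal[of x k] by (simp add: m_def s_def)
      then have "scale k powr (- \<beta>) \<le> CA * (m powr (- (1 / q)) * (\<Prod>i\<in>UNIV. s i powr (- (1 - 1 / p i))))"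
      proof -
        have pp: "0 < m powr (1 / q) * (\<Prod>i\<in>UNIV. s i powr (1 - 1 / p i))"
          using m s by (intro mult_pos_pos prod_pos) (auto simp: less_imp_neq[symmetric])
        have "scale k powr (- \<beta>) = 1 / scale k powr \<beta>" by (rule powr_minus_divide)
        also have "\<dots> \<le> CA / (m powr (1 / q) * (\<Prod>i\<in>UNIV. s i powr (1 - 1 / p i)))"
        proof -
          have "1 / S \<le> CA / X" if "0 < S" "0 < X" "X \<le> CA * S" for S X :: real
            using that by (simp add: field_simps)
          from this[OF _ pp] show ?thesis using bal[of x k] by (simp add: m_def s_def less_imp_neq[OF scale_pos, symmetric])
        qed
        also have "\<dots> = CA * (1 / m powr (1 / q) * (\<Prod>i\<in>UNIV. 1 / s i powr (1 - 1 / p i)))"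
          by (simp add: prod_dividef)
        finally show ?thesis by (simp only: powr_minus_divide)
      qed
      then have "scale k powr (- \<beta>) * (\<Prod>i\<in>UNIV. I i) \<le> CA * (m powr (- (1 / q)) * (\<Prod>i\<in>UNIV. s i powr (- (1 - 1 / p i)))) * (\<Prod>i\<in>UNIV. I i)"
        by (intro mult_right_mono prod_nonneg) (use I0 in auto)
      also have "\<dots> = CA * m powr (- (1 / q)) * H x k"
        by (simp add: H_def hI prod.distrib mult_ac)
      finally have "ennreal (scale k powr (- \<beta>) * (\<Prod>i\<in>UNIV. I i)) \<le> ennreal (CA * m powr (- (1 / q)) * H x k)"
        by (rule ennreal_leI)
      moreover have "ennreal (scale k powr (- \<beta>) * (\<Prod>i\<in>UNIV. I i)) = ennreal (scale k powr (- \<beta>)) * (\<Prod>i\<in>UNIV. ennreal (I i))"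
        using I0 by (simp add: ennreal_mult' prod_ennreal)
      ultimately show "ennreal (scale k powr (- \<beta>)) * (\<Prod>i\<in>UNIV. \<integral>\<^sup>+y\<in>ccube x (scale k). ennreal (\<phi> i y) \<partial>lebesgue)
          \<le> ennreal (CA * cube_mass \<mu> x k powr (- (1 / q)) * H x k)"
        by (simp add: Ieq m_def)
    qed
    define Z where "Z x = (\<integral>\<^sup>+k. ennreal (H x k powr r / cube_mass \<mu> x k) \<partial>count_space UNIV)" for x
    have ptw: "AE x in lebesgue. ennreal (\<psi> x powr q) \<le> ennreal (K * B powr (q - r)) * Z x"
      using ae
    proof eventually_elim
      fix x assume "ennreal (\<psi> x) \<le> frac_sum \<beta> \<phi> x"
      then have "ennreal (\<psi> x) \<le> (\<integral>\<^sup>+k. ennreal (CA * cube_mass \<mu> x k powr (- (1 / q)) * H x k) \<partial>count_space UNIV)"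
        using frac_le order_trans by blast
      then show "ennreal (\<psi> x powr q) \<le> ennreal (K * B powr (q - r)) * Z x"
        unfolding Z_def K_def
        by (intro Hedberg_pointwise[OF \<mu>'(3)])
           (use mpos cube_mass_grow[OF \<mu>] P r H0 HB B CA \<psi>0 in auto)
    qed
    have ptw': "AE x in wdens \<mu>. ennreal (\<psi> x powr q) \<le> ennreal (K * B powr (q - r)) * Z x"
    proof -
      have [measurable]: "\<mu> \<in> borel_measurable lebesgue" using \<mu>' by (auto simp: weight_def)
      show ?thesis unfolding wdens_def using ptw by (subst AE_density) auto
    qed
    have Zle: "(\<integral>\<^sup>+x. Z x \<partial>wdens \<mu>) \<le> ennreal (B powr r * (\<Sum>i\<in>UNIV. t i * Ce i))"
    proof -
      \<comment> \<open>Dividing each \<open>h i\<close> by \<open>N i\<close> before AM-GM keeps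
        the estimate homogeneous: after the embedding every argument contributes the same factor
        \<open>B powr r\<close>.\<close>
      define c where "c i = B powr r * t i * N i powr (- R i)" for i
      have c0: "0 \<le> c i" for i using t0[of i] by (simp add: c_def)
      have termle: "ennreal (H x k powr r / cube_mass \<mu> x k) \<le> (\<Sum>i\<in>UNIV. ennreal (c i) * ennreal (h i x k powr R i / cube_mass \<mu> x k))" for x k
      proof -
        have "H x k powr r = (\<Prod>i\<in>UNIV. h i x k powr r)"
          unfolding H_def using h0 by (subst prod_powr_distrib) auto
        also have "\<dots> = (\<Prod>i\<in>UNIV. N i powr r * ((h i x k / N i) powr R i) powr t i)"
        proof (rule prod.cong[OF refl])
          fix i
          have "((h i x k / N i) powr R i) powr t i = (h i x k / N i) powr r"
            using t0[of i] by (simp add: powr_powr R_def)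
          then show "h i x k powr r = N i powr r * ((h i x k / N i) powr R i) powr t i"
            using N[of i] h0[of i x k] by (simp add: powr_divide)
        qed
        also have "\<dots> = B powr r * (\<Prod>i\<in>UNIV. ((h i x k / N i) powr R i) powr t i)"
          unfolding B_def using N by (subst prod_powr_distrib) (auto simp: prod.distrib less_imp_le)
        also have "\<dots> \<le> B powr r * (\<Sum>i\<in>UNIV. t i * (h i x k / N i) powr R i)"
          using t0 t1 by (intro mult_left_mono weighted_AM_GM) (auto simp: less_imp_le)
        also have "\<dots> = (\<Sum>i\<in>UNIV. c i * h i x k powr R i)"
          unfolding sum_distrib_left
        proof (rule sum.cong[OF refl])
          fix i
          have "(h i x k / N i) powr R i = h i x k powr R i * N i powr (- R i)"
            using N[of i] h0[of i x k] by (simp add: powr_divide powr_minus_divide)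
          then show "B powr r * (t i * (h i x k / N i) powr R i) = c i * h i x k powr R i"
            by (simp add: c_def)
        qed
        finally have "H x k powr r / cube_mass \<mu> x k \<le> (\<Sum>i\<in>UNIV. c i * h i x k powr R i) / cube_mass \<mu> x k"
          using mpos(1)[of x k] by (intro divide_right_mono) auto
        also have "\<dots> = (\<Sum>i\<in>UNIV. c i * (h i x k powr R i / cube_mass \<mu> x k))"
          by (simp add: sum_divide_distrib)
        finally have "ennreal (H x k powr r / cube_mass \<mu> x k) \<le> ennreal (\<Sum>i\<in>UNIV. c i * (h i x k powr R i / cube_mass \<mu> x k))"
          by (rule ennreal_leI)
        also have "\<dots> = (\<Sum>i\<in>UNIV. ennreal (c i * (h i x k powr R i / cube_mass \<mu> x k)))"
          using c0 mpos(1)[of x k] by (intro sum_ennreal[symmetric]) auto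
        also have "\<dots> = (\<Sum>i\<in>UNIV. ennreal (c i) * ennreal (h i x k powr R i / cube_mass \<mu> x k))"
          by (intro sum.cong refl ennreal_mult' c0)
        finally show ?thesis .
      qed
      have "(\<integral>\<^sup>+x. Z x \<partial>wdens \<mu>) \<le> (\<integral>\<^sup>+x. \<integral>\<^sup>+k. (\<Sum>i\<in>UNIV. ennreal (c i) * ennreal (h i x k powr R i / cube_mass \<mu> x k)) \<partial>count_space UNIV \<partial>wdens \<mu>)"
        unfolding Z_def by (intro nn_integral_mono termle)
      also have "\<dots> = (\<integral>\<^sup>+k. \<integral>\<^sup>+x. (\<Sum>i\<in>UNIV. ennreal (c i) * ennreal (h i x k powr R i / cube_mass \<mu> x k)) \<partial>wdens \<mu> \<partial>count_space UNIV)"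
        by (rule nn_integral_count_space_nn_integral) auto
      also have "\<dots> = (\<integral>\<^sup>+k. (\<Sum>i\<in>UNIV. ennreal (c i) * (\<integral>\<^sup>+x. ennreal (h i x k powr R i / cube_mass \<mu> x k) \<partial>wdens \<mu>)) \<partial>count_space UNIV)"
        by (simp add: nn_integral_sum nn_integral_cmult)
      also have "\<dots> = (\<Sum>i\<in>UNIV. ennreal (c i) * (\<integral>\<^sup>+k. \<integral>\<^sup>+x. ennreal (h i x k powr R i / cube_mass \<mu> x k) \<partial>wdens \<mu> \<partial>count_space UNIV))"
        by (simp add: nn_integral_sum nn_integral_cmult)
      also have "\<dots> = (\<Sum>i\<in>UNIV. ennreal (c i) * (\<integral>\<^sup>+x. \<integral>\<^sup>+k. ennreal (h i x k powr R i / cube_mass \<mu> x k) \<partial>count_space UNIV \<partial>wdens \<mu>))"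
        by (subst nn_integral_count_space_nn_integral) auto
      also have "\<dots> \<le> (\<Sum>i\<in>UNIV. ennreal (c i) * ennreal (Ce i * N i powr R i))"
      proof (intro sum_mono mult_left_mono)
        fix i
        have "h i x k = X (\<lambda>_. g i) i x k" for x k by (simp add: h_def X_def)
        then show "(\<integral>\<^sup>+x. \<integral>\<^sup>+k. ennreal (h i x k powr R i / cube_mass \<mu> x k) \<partial>count_space UNIV \<partial>wdens \<mu>) \<le> ennreal (Ce i * N i powr R i)"
          using emb[OF gm g0 N gN, of i] by simp
      qed auto
      also have "\<dots> = (\<Sum>i\<in>UNIV. ennreal (B powr r * (t i * Ce i)))"
        using c0 N by (intro sum.cong refl) (simp add: ennreal_mult'[symmetric] c_def powr_minus_divide less_imp_neq[symmetric])
      also have "\<dots> = ennreal (\<Sum>i\<in>UNIV. B powr r * (t i * Ce i))"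
        using t0 Ce by (intro sum_ennreal) (auto simp: less_imp_le)
      finally show ?thesis by (simp add: sum_distrib_left)
    qed
    have "(\<integral>\<^sup>+x. ennreal (\<psi> x powr q) \<partial>wdens \<mu>) \<le> (\<integral>\<^sup>+x. ennreal (K * B powr (q - r)) * Z x \<partial>wdens \<mu>)"
      by (rule nn_integral_mono_AE[OF ptw'])
    also have "\<dots> = ennreal (K * B powr (q - r)) * (\<integral>\<^sup>+x. Z x \<partial>wdens \<mu>)"
    proof (rule nn_integral_cmult)
      show "Z \<in> borel_measurable (wdens \<mu>)"
        unfolding Z_def H_def by (rule borel_measurable_nn_integral_count_space) measurable
    qed
    also have "\<dots> \<le> ennreal (K * B powr (q - r)) * ennreal (B powr r * (\<Sum>i\<in>UNIV. t i * Ce i))"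
      by (intro mult_left_mono Zle) auto
    also have "\<dots> = ennreal (C * B powr q)"
      using K B by (simp add: ennreal_mult'[symmetric] C_def powr_diff mult_ac)
    finally show "(\<integral>\<^sup>+x. ennreal (\<psi> x powr q) \<partial>wdens \<mu>) \<le> ennreal (C * (\<Prod>i\<in>UNIV. N i) powr q)"
      unfolding B_def .
  qed
qed

section \<open>Calderon--Zygmund kernels\<close>

lemma norm_le_max_dist: "norm (y $ k - x) \<le> max_dist x y"
  unfolding max_dist_def by (rule Max_ge) (auto simp: norm_minus_commute)

lemma max_dist_attained: "\<exists>k. max_dist x y = norm (x - y $ k)"
proof -
  have "max_dist x y \<in> range (\<lambda>k. norm (x - y $ k))"
    unfolding max_dist_def by (rule Max_in) auto
  then show ?thesis by auto
qed

lemma norm_le_spread: "norm (y $ k - x) \<le> spread x y"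
  unfolding spread_def by (rule member_le_sum) auto

lemma max_dist_le_spread: "max_dist x y \<le> spread x y"
  using max_dist_attained[of x y] norm_le_spread[of y _ x] by (auto simp: norm_minus_commute)

lemma off_diagonal_iff_max_dist: "off_diagonal x y \<longleftrightarrow> 0 < max_dist x y"
proof
  assume "off_diagonal x y"
  then obtain k where "y $ k \<noteq> x" by (auto simp: off_diagonal_def)
  then have "0 < norm (y $ k - x)" by simp
  then show "0 < max_dist x y" using norm_le_max_dist[of y k x] by linarith
next
  assume "0 < max_dist x y"
  then show "off_diagonal x y" using max_dist_attained[of x y] by (auto simp: off_diagonal_def)
qed

lemma spread_nonneg: "0 \<le> spread x y"
  by (simp add: spread_def sum_nonneg)

lemma spread_measurable[measurable]: "(\<lambda>y. spread x y) \<in> borel_measurable borel"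
  unfolding spread_def by (intro borel_measurable_continuous_onI continuous_intros)

text \<open>For each tuple a single scale comparable to its spread already dominates the integrand;
  all components lie in the cube of that scale.\<close>

lemma spread_integral_le_frac_sum:
  fixes \<phi> :: "'m::finite \<Rightarrow> real^'n::finite \<Rightarrow> real"
  assumes [measurable]: "\<And>i. \<phi> i \<in> borel_measurable lebesgue" and \<beta>: "0 < \<beta>"
  shows "(\<integral>\<^sup>+y. ennreal (spread x y powr (- \<beta>)) * (\<Prod>i\<in>UNIV. ennreal (\<phi> i (y $ i))) \<partial>lebesgue)
      \<le> ennreal (2 powr \<beta>) * frac_sum \<beta> \<phi> x"
proof -
  define h where "h k i z = ennreal (\<phi> i z) * indicator (ccube x (scale k)) z" for k i z
  have hm[measurable]: "h k i \<in> borel_measurable lebesgue" for k i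
    unfolding h_def by measurable
  have le: "ennreal (spread x y powr (- \<beta>)) * (\<Prod>i\<in>UNIV. ennreal (\<phi> i (y $ i)))
     \<le> (\<integral>\<^sup>+k. ennreal (2 powr \<beta> * scale k powr (- \<beta>)) * (\<Prod>i\<in>UNIV. h k i (y $ i)) \<partial>count_space UNIV)" for y :: "(real^'n)^'m"
  \<comment> \<open>On the diagonal the integrand vanishes, because
    \<open>0 powr (- \<beta>)\<close> is 0; no scale has to be found there.\<close>
  proof (cases "spread x y = 0")
    case False
    then have sp: "0 < spread x y" using spread_nonneg[of x y] by simp
    \<comment> \<open>The least dyadic scale that is not below the spread. It overshoots by at most
      a factor 2, whence \<open>2 powr \<beta>\<close>.\<close>
    define k where "k = \<lceil>log 2 (spread x y)\<rceil>"
    have "log 2 (spread x y) \<le> real_of_int k" by (simp add: k_def)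
    then have "2 powr (log 2 (spread x y)) \<le> scale k" unfolding scale_def by simp
    then have up: "spread x y \<le> scale k" using sp by simp
    have "real_of_int k - 1 \<le> log 2 (spread x y)" unfolding k_def by linarith
    then have "2 powr (real_of_int k - 1) \<le> 2 powr log 2 (spread x y)" by simp
    then have lo: "scale k / 2 \<le> spread x y" using sp by (simp add: scale_def powr_diff)
    have "spread x y powr (- \<beta>) \<le> (scale k / 2) powr (- \<beta>)"
      using lo sp \<beta> by (intro powr_mono2') auto
    also have "\<dots> = 2 powr \<beta> * scale k powr (- \<beta>)"
      by (simp add: powr_divide powr_minus_divide)
    finally have sple: "spread x y powr (- \<beta>) \<le> 2 powr \<beta> * scale k powr (- \<beta>)" .
    have "y $ i \<in> ccube x (scale k)" for i
      using norm_le_spread[of y i x] up by (intro norm_le_imp_ccube) linarith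
    then have "ennreal (spread x y powr (- \<beta>)) * (\<Prod>i\<in>UNIV. ennreal (\<phi> i (y $ i)))
       \<le> ennreal (2 powr \<beta> * scale k powr (- \<beta>)) * (\<Prod>i\<in>UNIV. h k i (y $ i))"
      using sple by (simp add: h_def mult_right_mono ennreal_leI)
    also have "\<dots> \<le> (\<integral>\<^sup>+k. ennreal (2 powr \<beta> * scale k powr (- \<beta>)) * (\<Prod>i\<in>UNIV. h k i (y $ i)) \<partial>count_space UNIV)"
      by (rule nn_integral_count_space_ge)
    finally show ?thesis .
  qed simp
  have hm2[measurable]: "(\<lambda>y. h k i (y $ i)) \<in> borel_measurable lebesgue" for k i
    by (rule measurable_compose[OF measurable_vec_nth_lebesgue hm])
  have "(\<integral>\<^sup>+y. ennreal (spread x y powr (- \<beta>)) * (\<Prod>i\<in>UNIV. ennreal (\<phi> i (y $ i))) \<partial>lebesgue)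
     \<le> (\<integral>\<^sup>+(y::(real^'n)^'m). (\<integral>\<^sup>+k. ennreal (2 powr \<beta> * scale k powr (- \<beta>)) * (\<Prod>i\<in>UNIV. h k i (y $ i)) \<partial>count_space UNIV) \<partial>lebesgue)"
    by (intro nn_integral_mono le)
  also have "\<dots> = (\<integral>\<^sup>+k. (\<integral>\<^sup>+(y::(real^'n)^'m). ennreal (2 powr \<beta> * scale k powr (- \<beta>)) * (\<Prod>i\<in>UNIV. h k i (y $ i)) \<partial>lebesgue) \<partial>count_space UNIV)"
    by (rule nn_integral_count_space_nn_integral) auto
  also have "\<dots> = (\<integral>\<^sup>+k. ennreal (2 powr \<beta>) * (ennreal (scale k powr (- \<beta>)) * (\<Prod>i\<in>UNIV. \<integral>\<^sup>+z. h k i z \<partial>lebesgue)) \<partial>count_space UNIV)"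
    by (subst nn_integral_cmult) (auto simp: nn_integral_prod_vec ennreal_mult mult.assoc)
  also have "\<dots> = ennreal (2 powr \<beta>) * (\<integral>\<^sup>+k. ennreal (scale k powr (- \<beta>)) * (\<Prod>i\<in>UNIV. \<integral>\<^sup>+z. h k i z \<partial>lebesgue) \<partial>count_space UNIV)"
    by (rule nn_integral_cmult) simp
  finally show ?thesis by (simp add: frac_sum_def h_def)
qed

locale CZ_kernel_bounds =
  fixes K :: "('n::finite, 'm::finite) kernel" and CK \<gamma> M :: real
  assumes M: "M = mn TYPE('n) TYPE('m)" and CK: "0 < CK" and \<gamma>: "0 < \<gamma>"
    and size: "off_diagonal y0 y \<Longrightarrow> norm (K y0 y) \<le> CK * spread y0 y powr (- M)"
    and reg0: "off_diagonal y0 y \<Longrightarrow> norm (y0 - y0') \<le> max_dist y0 y / 2 \<Longrightarrow>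
        norm (K y0 y - K y0' y) \<le> CK * norm (y0 - y0') powr \<gamma> * spread y0 y powr (- M - \<gamma>)"
    and reg: "off_diagonal y0 y \<Longrightarrow> norm (y $ i - yi') \<le> max_dist y0 y / 2 \<Longrightarrow>
        norm (K y0 y - K y0 (\<chi> j. if j = i then yi' else y $ j))
          \<le> CK * norm (y $ i - yi') powr \<gamma> * spread y0 y powr (- M - \<gamma>)"
begin

lemma M_pos: "0 < M"
  by (simp add: M mn_def)

text \<open>The arguments are moved one at a time.\<close>

lemma kernel_oscillation:
  assumes x: "norm (x - x') \<le> d" and z: "\<And>i. norm (y $ i - z $ i) \<le> d"
    and d: "6 * d \<le> max_dist x y" and pos: "0 < max_dist x y"
  shows "norm (K x y - K x' z) \<le> (real CARD('m) + 1) * CK * d powr \<gamma> * (max_dist x y / 2) powr (- M - \<gamma>)"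
proof -
  have d0: "0 \<le> d" using x norm_ge_zero order_trans by blast
  define B where "B = CK * d powr \<gamma> * (max_dist x y / 2) powr (- M - \<gamma>)"
  have B_bound: "CK * norm u powr \<gamma> * spread x'' w powr (- M - \<gamma>) \<le> B"
    if "norm u \<le> d" "max_dist x y / 2 \<le> max_dist x'' w" for u :: "real^'n" and x'' :: "real^'n" and w :: "(real^'n)^'m"
    unfolding B_def
  proof (intro mult_mono mult_nonneg_nonneg)
    show "norm u powr \<gamma> \<le> d powr \<gamma>" using that \<gamma> by (intro powr_mono2) auto
    show "spread x'' w powr (- M - \<gamma>) \<le> (max_dist x y / 2) powr (- M - \<gamma>)"
      using that max_dist_le_spread[of x'' w] pos \<gamma> M_pos by (intro powr_mono2') auto
  qed (use CK in auto)
  have 1: "norm (K x y - K x' y) \<le> B"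
    using reg0[of x y x'] B_bound[of "x - x'" x y] x d d0 pos by (auto simp: off_diagonal_iff_max_dist)
  \<comment> \<open>With \<open>6 * d \<le> max_dist x y\<close> at least two thirds of the distance
    survive all moves. This is enough for the half in the definition of \<open>B\<close>, and each
    further move by \<open>d\<close> stays within the half that regularity permits.\<close>
  have far: "max_dist x y - 2 * d \<le> max_dist x' w" if w: "\<And>i. norm (y $ i - w $ i) \<le> d" for w :: "(real^'n)^'m"
  proof -
    obtain k where k: "max_dist x y = norm (x - y $ k)" using max_dist_attained by blast
    have "x - y $ k = (x - x') + (x' - w $ k) + (w $ k - y $ k)" by simp
    then have "norm (x - y $ k) \<le> norm (x - x') + norm (x' - w $ k) + norm (w $ k - y $ k)"
      by (metis norm_triangle_ineq norm_triangle_le add_mono order_refl)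
    also have "\<dots> \<le> d + max_dist x' w + d"
      using x w[of k] norm_le_max_dist[of w k x'] by (intro add_mono) (auto simp: norm_minus_commute)
    finally show ?thesis by (simp add: k)
  qed
  have 2: "norm (K x' y - K x' (\<chi> j. if j \<in> S then z $ j else y $ j)) \<le> real (card S) * B" if "finite S" for S
    using that
  proof induction
    case (insert i S)
    define w where "w = (\<chi> j. if j \<in> S then z $ j else y $ j)"
    have w: "norm (y $ j - w $ j) \<le> d" for j using z[of j] d0 by (simp add: w_def)
    have wi: "w $ i = y $ i" using insert by (simp add: w_def)
    have f: "max_dist x y - 2 * d \<le> max_dist x' w" by (rule far[OF w])
    have eq: "(\<chi> j. if j \<in> insert i S then z $ j else y $ j) = (\<chi> j. if j = i then z $ i else w $ j)"
      by (auto simp: w_def vec_eq_iff)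
    have "norm (K x' w - K x' (\<chi> j. if j = i then z $ i else w $ j))
        \<le> CK * norm (w $ i - z $ i) powr \<gamma> * spread x' w powr (- M - \<gamma>)"
      by (rule reg) (use f d d0 pos z[of i] in \<open>auto simp: off_diagonal_iff_max_dist wi\<close>)
    also have "\<dots> \<le> B" by (rule B_bound) (use f d d0 pos z[of i] in \<open>auto simp: wi\<close>)
    finally have "norm (K x' w - K x' (\<chi> j. if j = i then z $ i else w $ j)) \<le> B" .
    moreover have "norm (K x' y - K x' w) \<le> real (card S) * B" using insert by (simp add: w_def)
    ultimately have "norm (K x' y - K x' (\<chi> j. if j = i then z $ i else w $ j)) \<le> real (card S) * B + B"
      by (rule norm_diff_triangle_le[rotated])
    then show ?case unfolding eq using insert by (simp add: algebra_simps)
  qed simp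
  have zz: "(\<chi> j. if j \<in> UNIV then z $ j else y $ j) = z" by (simp add: vec_eq_iff)
  have 3: "norm (K x' y - K x' z) \<le> real CARD('m) * B"
    using 2[of UNIV] unfolding zz by simp
  have "norm (K x y - K x' z) \<le> B + real CARD('m) * B"
    by (rule norm_diff_triangle_le[OF 1 3])
  then show ?thesis by (simp add: B_def algebra_simps)
qed

text \<open>\<open>kernel_oscillation\<close> with \<open>x' = x\<close> is a local Hoelder estimate
  in the remaining arguments.\<close>

lemma kernel_isCont:
  assumes "off_diagonal x y"
  shows "isCont (K x) y"
proof -
  have pos: "0 < max_dist x y" using assms by (simp add: off_diagonal_iff_max_dist)
  define c where "c = (real CARD('m) + 1) * CK * (max_dist x y / 2) powr (- M - \<gamma>)"
  have lim: "((\<lambda>z. c * norm (y - z) powr \<gamma>) \<longlongrightarrow> 0) (at y)"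
  proof -
    have "((\<lambda>z. norm (y - z)) \<longlongrightarrow> 0) (at y)"
      using tendsto_norm[OF tendsto_diff[OF tendsto_const tendsto_ident_at], of y y UNIV] by simp
    then have "((\<lambda>z. norm (y - z) powr \<gamma>) \<longlongrightarrow> 0) (at y)"
      by (rule tendsto_zero_powrI[where b = \<gamma>]) (use \<gamma> in auto)
    then show ?thesis using tendsto_mult_right_zero by blast
  qed
  have "eventually (\<lambda>z. norm (K x z - K x y) \<le> c * norm (y - z) powr \<gamma>) (at y)"
    unfolding eventually_at
  proof (intro exI[of _ "max_dist x y / 6"] conjI ballI impI)
    fix z assume "z \<noteq> y \<and> dist z y < max_dist x y / 6"
    then have z: "6 * norm (y - z) \<le> max_dist x y" by (simp add: dist_norm norm_minus_commute)
    have "norm (K x y - K x z) \<le> (real CARD('m) + 1) * CK * norm (y - z) powr \<gamma> * (max_dist x y / 2) powr (- M - \<gamma>)"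
      by (rule kernel_oscillation[OF _ _ z pos]) (use Finite_Cartesian_Product.norm_nth_le[of "y - z"] in auto)
    then show "norm (K x z - K x y) \<le> c * norm (y - z) powr \<gamma>"
      by (simp add: c_def mult_ac norm_minus_commute)
  qed (use pos in auto)
  then have "((\<lambda>z. K x z - K x y) \<longlongrightarrow> 0) (at y)"
    by (rule Lim_null_comparison[OF _ lim])
  then show ?thesis by (simp add: isCont_def LIM_zero_iff)
qed

text \<open>\<open>CZ_kernel\<close> does not state measurability. It follows from continuity away
  from a single point: for fixed \<open>x\<close> the diagonal consists of the tuple with all
  components \<open>x\<close>.\<close>

lemma kernel_measurable[measurable]: "K x \<in> borel_measurable borel"
proof (rule borel_measurable_continuous_countable_exceptions[of "{\<chi> i. x}"])
  show "continuous_on (- {\<chi> i. x}) (K x)"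
  proof (intro continuous_at_imp_continuous_on ballI kernel_isCont)
    fix y :: "(real^'n)^'m" assume "y \<in> - {\<chi> i. x}"
    then show "off_diagonal x y" by (auto simp: off_diagonal_def vec_eq_iff)
  qed
qed simp

end

text \<open>The constant \<open>k0\<close> can be pulled out, and then the integral factorises. The
  error is the integral of \<open>(k y - k0)\<close> times the product, which vanishes wherever
  \<open>near\<close> says nothing.\<close>

lemma integral_near_constant_kernel:
  fixes k :: "(real^'n::finite)^'m::finite \<Rightarrow> complex" and f :: "'m \<Rightarrow> real^'n \<Rightarrow> complex"
  assumes [measurable]: "k \<in> borel_measurable lebesgue" and f: "\<And>i. integrable lebesgue (f i)"
    and near: "\<And>y. (\<forall>i. f i (y $ i) \<noteq> 0) \<Longrightarrow> norm (k y - k0) \<le> e" and e: "0 \<le> e"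
  shows "norm ((LINT y|lebesgue. k y * (\<Prod>i\<in>UNIV. f i (y $ i))) - k0 * (\<Prod>i\<in>UNIV. (LINT x|lebesgue. f i x)))
      \<le> e * (\<Prod>i\<in>UNIV. (LINT x|lebesgue. norm (f i x)))"
proof -
  let ?F = "\<lambda>y::(real^'n)^'m. \<Prod>i\<in>UNIV. f i (y $ i)"
  have Fi: "integrable lebesgue ?F" by (rule integrable_prod_vec[OF f])
  have [measurable]: "?F \<in> borel_measurable lebesgue" using Fi by auto
  have b: "norm ((k y - k0) * ?F y) \<le> e * norm (?F y)" for y
  proof (cases "\<forall>i. f i (y $ i) \<noteq> 0")
    case True
    then show ?thesis using near[OF True] by (simp add: norm_mult mult_right_mono)
  next
    case False
    then have "?F y = 0" by (auto simp: prod_zero_iff)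
    then show ?thesis using e by (simp only: mult_zero_right norm_zero)
  qed
  have di: "integrable lebesgue (\<lambda>y. (k y - k0) * ?F y)"
  proof (rule Bochner_Integration.integrable_bound[of _ "\<lambda>y. e * norm (?F y)"])
    show "AE y in lebesgue. norm ((k y - k0) * ?F y) \<le> norm (e * norm (?F y))"
      using b by (intro AE_I2) (metis abs_of_nonneg e mult_nonneg_nonneg norm_ge_zero real_norm_def)
  qed (use Fi in auto)
  have "(LINT y|lebesgue. k y * ?F y) = (LINT y|lebesgue. (k y - k0) * ?F y + k0 * ?F y)"
    by (simp add: algebra_simps)
  also have "\<dots> = (LINT y|lebesgue. (k y - k0) * ?F y) + k0 * (LINT y|lebesgue. ?F y)"
    using di Fi by (subst Bochner_Integration.integral_add) auto
  finally have "(LINT y|lebesgue. k y * ?F y) - k0 * (\<Prod>i\<in>UNIV. (LINT x|lebesgue. f i x)) = (LINT y|lebesgue. (k y - k0) * ?F y)"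
    by (simp add: integral_prod_vec[OF f])
  also have "norm \<dots> \<le> (LINT y|lebesgue. e * norm (?F y))"
    by (rule Bochner_Integration.integral_norm_bound_integral[OF di]) (use Fi b in auto)
  also have "\<dots> = e * (LINT y|lebesgue. norm (?F y))" by simp
  also have "(LINT (y::(real^'n)^'m)|lebesgue. norm (?F y)) = (\<Prod>i\<in>UNIV. (LINT x|lebesgue. norm (f i x)))"
  proof -
    have "integrable lebesgue (\<lambda>x. complex_of_real (norm (f i x)))" for i
      by (intro integrable_of_real integrable_norm f)
    from integral_prod_vec[OF this, of "\<lambda>i. i"]
    have "(LINT (y::(real^'n)^'m)|lebesgue. complex_of_real (norm (?F y))) = complex_of_real (\<Prod>i\<in>UNIV. (LINT x|lebesgue. norm (f i x)))"
      by (simp only: prod_norm[symmetric] of_real_prod integral_complex_of_real)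
    then show ?thesis by (simp only: integral_complex_of_real of_real_eq_iff)
  qed
  finally show ?thesis .
qed

section \<open>Pointwise domination of the commutator\<close>

lemma epowr_less_top_iff: "epowr x a < top \<longleftrightarrow> x < top"
  by (auto simp: epowr_def less_top)

lemma epowr_le: "x \<le> ennreal c \<Longrightarrow> 0 < a \<Longrightarrow> 0 \<le> c \<Longrightarrow> epowr x a \<le> ennreal (c powr a)"
proof -
  assume a: "x \<le> ennreal c" "0 < a" "0 \<le> c"
  then have "x \<noteq> top" by (auto simp: top_unique)
  moreover have "enn2real x \<le> c" using a by (intro enn2real_leI) auto
  ultimately show ?thesis using a by (auto simp: epowr_def intro!: ennreal_leI powr_mono2)
qed

lemma epowr_leD:
  assumes "epowr x a \<le> ennreal c" "0 < a" "0 \<le> c"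
  shows "x \<le> ennreal (c powr (1 / a))"
proof -
  have x: "x \<noteq> top" using assms by (auto simp: epowr_def top_unique)
  then have "enn2real x powr a \<le> c" using assms by (simp add: epowr_def)
  then have "(enn2real x powr a) powr (1 / a) \<le> c powr (1 / a)" using assms by (intro powr_mono2) auto
  then have "enn2real x \<le> c powr (1 / a)" using assms by (simp add: powr_powr)
  then show ?thesis using x by (metis ennreal_enn2real ennreal_leI less_top)
qed

lemma Lp_space_iff:
  "f \<in> Lp_space s w \<longleftrightarrow> f \<in> borel_measurable lebesgue \<and> (\<integral>\<^sup>+x. ennreal (norm (f x) powr s * w x) \<partial>lebesgue) < top"
  by (simp add: Lp_space_def Lp_norm_def epowr_less_top_iff)

definition restr :: "'a set \<Rightarrow> ('a \<Rightarrow> complex) \<Rightarrow> 'a \<Rightarrow> complex" where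
  "restr A u z = (if z \<in> A then u z else 0)"

lemma restr_Lp_space:
  fixes u :: "'a::euclidean_space \<Rightarrow> complex"
  assumes u: "u \<in> Lp_space s (\<lambda>_. 1)" and A: "A \<in> sets lebesgue"
  shows "restr A u \<in> Lp_space s (\<lambda>_. 1)"
proof -
  have [measurable]: "u \<in> borel_measurable lebesgue" "A \<in> sets lebesgue" using u A by (auto simp: Lp_space_iff)
  have "restr A u \<in> borel_measurable lebesgue" unfolding restr_def by measurable
  moreover have "(\<integral>\<^sup>+x. ennreal (norm (restr A u x) powr s * 1) \<partial>lebesgue) \<le> (\<integral>\<^sup>+x. ennreal (norm (u x) powr s * 1) \<partial>lebesgue)"
    by (intro nn_integral_mono ennreal_leI) (auto simp: restr_def)
  ultimately show ?thesis using u by (auto simp: Lp_space_iff)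
qed

lemma cmult_Lp_space:
  fixes u v :: "'a::euclidean_space \<Rightarrow> complex"
  assumes u: "u \<in> Lp_space s (\<lambda>_. 1)" and v: "v \<in> borel_measurable lebesgue"
    and le: "AE x in lebesgue. norm (v x) \<le> c * norm (u x)" and s: "0 < s" and c: "0 \<le> c"
  shows "v \<in> Lp_space s (\<lambda>_. 1)"
    and "(\<integral>\<^sup>+x. ennreal (norm (v x) powr s) \<partial>lebesgue) \<le> ennreal (c powr s) * (\<integral>\<^sup>+x. ennreal (norm (u x) powr s) \<partial>lebesgue)"
proof -
  have [measurable]: "u \<in> borel_measurable lebesgue" using u by (auto simp: Lp_space_iff)
  have "(\<integral>\<^sup>+x. ennreal (norm (v x) powr s) \<partial>lebesgue) \<le> (\<integral>\<^sup>+x. ennreal (c powr s) * ennreal (norm (u x) powr s) \<partial>lebesgue)"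
  proof (rule nn_integral_mono_AE)
    show "AE x in lebesgue. ennreal (norm (v x) powr s) \<le> ennreal (c powr s) * ennreal (norm (u x) powr s)"
      using le
    proof eventually_elim
      fix x assume "norm (v x) \<le> c * norm (u x)"
      then have "norm (v x) powr s \<le> (c * norm (u x)) powr s" using s by (intro powr_mono2) auto
      then show "ennreal (norm (v x) powr s) \<le> ennreal (c powr s) * ennreal (norm (u x) powr s)"
        by (simp add: powr_mult ennreal_mult[symmetric] ennreal_leI)
    qed
  qed
  also have "\<dots> = ennreal (c powr s) * (\<integral>\<^sup>+x. ennreal (norm (u x) powr s) \<partial>lebesgue)"
    by (rule nn_integral_cmult) simp
  finally show le2: "(\<integral>\<^sup>+x. ennreal (norm (v x) powr s) \<partial>lebesgue) \<le> ennreal (c powr s) * (\<integral>\<^sup>+x. ennreal (norm (u x) powr s) \<partial>lebesgue)" .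
  have "ennreal (c powr s) * (\<integral>\<^sup>+x. ennreal (norm (u x) powr s) \<partial>lebesgue) < top"
    using u by (simp add: Lp_space_iff ennreal_mult_less_top)
  with le2 have "(\<integral>\<^sup>+x. ennreal (norm (v x) powr s) \<partial>lebesgue) < top" by (rule le_less_trans)
  then show "v \<in> Lp_space s (\<lambda>_. 1)" using v by (simp add: Lp_space_iff)
qed

locale CZ_op = CZ_kernel_bounds K CK \<gamma> M
  for K :: "('n::finite, 'm::finite) kernel" and CK \<gamma> M :: real +
  fixes T :: "('n, 'm) operator" and s :: "'m \<Rightarrow> real" and CT :: real
  assumes s1: "1 < s i" and multilin: "multilinear_on_Lp s T" and CT: "0 < CT"
    and T_meas: "f \<in> Lp_tuples s \<Longrightarrow> T f \<in> borel_measurable lebesgue"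
    and T_bound: "f \<in> Lp_tuples s \<Longrightarrow> Lp_norm (1 / (\<Sum>i\<in>UNIV. 1 / s i)) (\<lambda>_. 1) (T f)
          \<le> ennreal CT * (\<Prod>i\<in>UNIV. Lp_norm (s i) (\<lambda>_. 1) (f i))"
    and T_repr: "f \<in> Lp_tuples s \<Longrightarrow> AE x in lebesgue. x \<notin> (\<Inter>i. closure {z. f i z \<noteq> 0}) \<longrightarrow>
        T f x = (LINT y|lebesgue. K x y * (\<Prod>i\<in>UNIV. f i (y $ i)))"
begin

definition s0 :: real where "s0 = 1 / (\<Sum>i\<in>UNIV. 1 / s i)"

lemma s0_pos: "0 < s0"
proof -
  have "0 < 1 / s i" for i using s1[of i] by simp
  then have "0 < (\<Sum>i\<in>UNIV. 1 / s i)" by (intro sum_pos) auto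
  then show ?thesis by (simp add: s0_def)
qed

lemma s0_sum: "(\<Sum>i\<in>UNIV. s0 / s i) = 1"
proof -
  have "(\<Sum>i\<in>UNIV. s0 / s i) = s0 * (\<Sum>i\<in>UNIV. 1 / s i)" by (simp add: sum_distrib_left)
  then show ?thesis using s0_pos by (auto simp: s0_def)
qed

text \<open>\<open>s0\<close> may be below 1, where norms cannot be added. The bound is therefore
  stated for the integrals of the powers, with real majorants \<open>a i\<close>.\<close>

lemma T_power_bound:
  assumes f: "f \<in> Lp_tuples s" and a: "\<And>i. 0 \<le> a i"
    and fa: "\<And>i. (\<integral>\<^sup>+x. ennreal (norm (f i x) powr s i) \<partial>lebesgue) \<le> ennreal (a i)"
  shows "(\<integral>\<^sup>+x. ennreal (norm (T f x) powr s0) \<partial>lebesgue) \<le> ennreal (CT powr s0 * (\<Prod>i\<in>UNIV. a i powr (s0 / s i)))"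
proof -
  have si: "0 < s i" for i using s1[of i] by simp
  have "epowr (\<integral>\<^sup>+x. ennreal (norm (T f x) powr s0) \<partial>lebesgue) (1 / s0)
      \<le> ennreal CT * (\<Prod>i\<in>UNIV. epowr (\<integral>\<^sup>+x. ennreal (norm (f i x) powr s i) \<partial>lebesgue) (1 / s i))"
    using T_bound[OF f] by (simp add: Lp_norm_def s0_def)
  also have "\<dots> \<le> ennreal CT * (\<Prod>i\<in>UNIV. ennreal (a i powr (1 / s i)))"
    using si a by (intro mult_left_mono prod_mono_ennreal epowr_le fa) auto
  also have "\<dots> = ennreal (CT * (\<Prod>i\<in>UNIV. a i powr (1 / s i)))"
    using CT by (simp add: ennreal_mult' prod_ennreal)
  finally have "(\<integral>\<^sup>+x. ennreal (norm (T f x) powr s0) \<partial>lebesgue)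
      \<le> ennreal ((CT * (\<Prod>i\<in>UNIV. a i powr (1 / s i))) powr (1 / (1 / s0)))"
    using s0_pos CT by (intro epowr_leD) (auto intro!: mult_nonneg_nonneg prod_nonneg)
  also have "(CT * (\<Prod>i\<in>UNIV. a i powr (1 / s i))) powr (1 / (1 / s0)) = CT powr s0 * (\<Prod>i\<in>UNIV. a i powr (s0 / s i))"
    by (simp add: powr_mult prod_powr_distrib powr_powr)
  finally show ?thesis .
qed

lemma T_add:
  assumes "f \<in> Lp_tuples s" "g \<in> Lp_space (s i) (\<lambda>_. 1)"
  shows "AE x in lebesgue. T (f(i := \<lambda>z. f i z + g z)) x = T f x + T (f(i := g)) x"
  using multilin assms unfolding multilinear_on_Lp_def by blast

lemma T_scale:
  assumes "f \<in> Lp_tuples s"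
  shows "AE x in lebesgue. T (f(i := \<lambda>z. c * f i z)) x = c * T f x"
proof -
  \<comment> \<open>In \<open>multilinear_on_Lp\<close> the scaling rule stands under the quantifier
    over the second summand, so some member of the space is needed.\<close>
  have "(\<lambda>_. 0) \<in> Lp_space (s i) (\<lambda>_. 1)" by (simp add: Lp_space_iff)
  then show ?thesis
    using multilin assms unfolding multilinear_on_Lp_def by blast
qed

lemma Lp_tuples_upd: "f \<in> Lp_tuples s \<Longrightarrow> g \<in> Lp_space (s i) (\<lambda>_. 1) \<Longrightarrow> f(i := g) \<in> Lp_tuples s"
  by (auto simp: Lp_tuples_def)

end

text \<open>Only a representative of \<open>b\<close> is Hoelder continuous, while the commutator
  contains \<open>b\<close> itself; so the estimate is required on a set \<open>S0\<close> of full
  measure. \<open>\<beta>\<close> is the order of the kernel that remains after the difference of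
  \<open>b\<close> has gained \<open>\<alpha>\<close>.\<close>

locale CZ_commutator = CZ_op K CK \<gamma> M T s CT
  for K :: "('n::finite, 'm::finite) kernel" and CK \<gamma> M T s CT +
  fixes b :: "real^'n \<Rightarrow> complex" and l :: 'm and L \<alpha> \<beta> :: real and S0 :: "(real^'n) set"
  assumes b_meas[measurable]: "b \<in> borel_measurable lebesgue"
    and L: "0 < L" and \<alpha>: "0 < \<alpha>" and \<beta>: "0 < \<beta>" and M_eq: "M = \<beta> + \<alpha>"
    and S0: "AE x in lebesgue. x \<in> S0"
    and Hoelder: "x \<in> S0 \<Longrightarrow> y \<in> S0 \<Longrightarrow> norm (b x - b y) \<le> L * norm (x - y) powr \<alpha>"
begin

abbreviation "comm \<equiv> commutator b T l"
abbreviation "cdom \<equiv> commutator_domain s b l"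
abbreviation "bf f \<equiv> f(l := \<lambda>z. b z * f l z)"

lemma dom_iff: "f \<in> cdom \<longleftrightarrow> f \<in> Lp_tuples s \<and> bf f \<in> Lp_tuples s"
  by (simp add: commutator_domain_def)

lemma domD: "f \<in> cdom \<Longrightarrow> f i \<in> Lp_space (s i) (\<lambda>_. 1)" "f \<in> cdom \<Longrightarrow> (\<lambda>z. b z * f l z) \<in> Lp_space (s l) (\<lambda>_. 1)"
  by (auto simp: dom_iff Lp_tuples_def dest: spec[of _ l])

lemma domI: "(\<And>i. f i \<in> Lp_space (s i) (\<lambda>_. 1)) \<Longrightarrow> (\<lambda>z. b z * f l z) \<in> Lp_space (s l) (\<lambda>_. 1) \<Longrightarrow> f \<in> cdom"
  by (auto simp: dom_iff Lp_tuples_def)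

lemma dom_measurable: "f \<in> cdom \<Longrightarrow> f i \<in> borel_measurable lebesgue"
  using domD(1)[of f i] by (simp add: Lp_space_iff)

lemma comm_measurable: "f \<in> cdom \<Longrightarrow> comm f \<in> borel_measurable lebesgue"
  unfolding commutator_def using T_meas[of f] T_meas[of "bf f"] by (auto simp: dom_iff)

lemma dom_restr:
  assumes f: "f \<in> cdom" and A: "A \<in> sets lebesgue"
  shows "f(i := restr A (f i)) \<in> cdom"
proof (rule domI)
  show "(f(i := restr A (f i))) j \<in> Lp_space (s j) (\<lambda>_. 1)" for j
    using domD(1)[OF f, of j] restr_Lp_space[OF domD(1)[OF f] A] by auto
  have "(\<lambda>z. b z * (f(i := restr A (f i))) l z) = (if i = l then restr A (\<lambda>z. b z * f l z) else (\<lambda>z. b z * f l z))"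
    by (auto simp: restr_def)
  then show "(\<lambda>z. b z * (f(i := restr A (f i))) l z) \<in> Lp_space (s l) (\<lambda>_. 1)"
    using domD(2)[OF f] restr_Lp_space[OF domD(2)[OF f] A] by auto
qed

text \<open>In slot \<open>l\<close> the second term of the commutator is additive through
  \<open>b z * g z\<close> and \<open>b z * h z\<close>; in the other slots the factor
  \<open>b\<close> is not affected.\<close>

lemma comm_add:
  assumes g: "f(i := g) \<in> cdom" and h: "f(i := h) \<in> cdom" and f: "f i = (\<lambda>z. g z + h z)"
  shows "AE x in lebesgue. comm f x = comm (f(i := g)) x + comm (f(i := h)) x"
proof -
  have h1: "h \<in> Lp_space (s i) (\<lambda>_. 1)" using domD(1)[OF h, of i] by simp
  have f': "(f(i := g))(i := \<lambda>z. (f(i := g)) i z + h z) = f" using f by auto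
  have 1: "AE x in lebesgue. T f x = T (f(i := g)) x + T (f(i := h)) x"
    using T_add[of "f(i := g)" h i] g h1 unfolding f' by (simp add: dom_iff)
  have 2: "AE x in lebesgue. T (bf f) x = T (bf (f(i := g))) x + T (bf (f(i := h))) x"
  proof (cases "i = l")
    case True
    have e: "(bf (f(i := g)))(l := \<lambda>z. (bf (f(i := g))) l z + b z * h z) = bf f"
      using f True by (auto simp: algebra_simps)
    have e2: "(bf (f(i := g)))(l := \<lambda>z. b z * h z) = bf (f(i := h))" using True by auto
    have "(\<lambda>z. b z * h z) \<in> Lp_space (s l) (\<lambda>_. 1)" using domD(2)[OF h] True by simp
    then show ?thesis
      using T_add[of "bf (f(i := g))" "\<lambda>z. b z * h z" l] g unfolding e e2 by (simp add: dom_iff)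
  next
    case False
    have e: "(bf (f(i := g)))(i := \<lambda>z. (bf (f(i := g))) i z + h z) = bf f"
      using f False by (auto simp: fun_eq_iff)
    have e2: "(bf (f(i := g)))(i := h) = bf (f(i := h))" using False by (auto simp: fun_eq_iff)
    show ?thesis
      using T_add[of "bf (f(i := g))" h i] g h1 unfolding e e2 by (simp add: dom_iff)
  qed
  show ?thesis
    using 1 2 by eventually_elim (simp add: commutator_def algebra_simps)
qed

text \<open>
  Off the support of one argument the two kernel integrals may be combined: they converge whenever
  the fractional integral does, because the singularity of the kernel is avoided.
\<close>

lemma comm_far:
  assumes f: "f \<in> cdom" and t: "0 < t" and off: "\<And>y. y \<in> ccube z (3 * t) \<Longrightarrow> f i y = 0"
  shows "AE x in lebesgue. x \<in> ccube z t \<longrightarrow>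
    ennreal (norm (comm f x)) \<le> ennreal (CK * L * 2 powr \<beta>) * frac_sum \<beta> (\<lambda>i y. norm (f i y)) x"
proof -
  have [measurable]: "f i \<in> borel_measurable lebesgue" for i by (rule dom_measurable[OF f])
  have [measurable]: "K x \<in> borel_measurable lebesgue" for x
    by (rule measurable_completion) (simp add: kernel_measurable)
  have fT: "f \<in> Lp_tuples s" "bf f \<in> Lp_tuples s" using f by (auto simp: dom_iff)
  show ?thesis
    using T_repr[OF fT(1)] T_repr[OF fT(2)] S0
  proof eventually_elim
    fix x
    assume r1: "x \<notin> (\<Inter>i. closure {z. f i z \<noteq> 0}) \<longrightarrow> T f x = (LINT y|lebesgue. K x y * (\<Prod>i\<in>UNIV. f i (y $ i)))"
      and r2: "x \<notin> (\<Inter>i. closure {z. (bf f) i z \<noteq> 0}) \<longrightarrow> T (bf f) x = (LINT y|lebesgue. K x y * (\<Prod>i\<in>UNIV. (bf f) i (y $ i)))"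
      and xS: "x \<in> S0"
    show "x \<in> ccube z t \<longrightarrow>
      ennreal (norm (comm f x)) \<le> ennreal (CK * L * 2 powr \<beta>) * frac_sum \<beta> (\<lambda>i y. norm (f i y)) x"
    proof
      assume x: "x \<in> ccube z t"
      \<comment> \<open>The half-sides \<open>3 * t\<close> and \<open>t\<close> leave a gap of more
        than \<open>t\<close> between \<open>x\<close> and the support of \<open>f i\<close>. One
        such slot suffices, as the representation holds off the intersection of the
        supports.\<close>
      have far: "t < norm (y - x)" if "f i y \<noteq> 0" for y
      proof (rule ccontr)
        assume "\<not> t < norm (y - x)"
        then have "y \<in> ccube x t" by (intro norm_le_imp_ccube) auto
        then have "y \<in> ccube z (3 * t)"
          using ccube_subset[OF x, of t] ccube_mono[of "t + t" "3 * t" z] t by auto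
        then show False using off that by blast
      qed
      have ncl: "x \<notin> closure {y. g y \<noteq> 0}" if g: "\<And>y. g y \<noteq> 0 \<Longrightarrow> f i y \<noteq> 0" for g :: "real^'n \<Rightarrow> complex"
      proof
        assume "x \<in> closure {y. g y \<noteq> 0}"
        then obtain y where "g y \<noteq> 0" "dist y x < t" using t unfolding closure_approachable by blast
        then show False using far[OF g] by (force simp: dist_norm)
      qed
      define F where "F y = (\<Prod>i\<in>UNIV. f i (y $ i))" for y :: "(real^'n)^'m"
      define sp where "sp y = spread x y" for y :: "(real^'n)^'m"
      have [measurable]: "F \<in> borel_measurable lebesgue" unfolding F_def by measurable
      have F0: "t < sp y" if "F y \<noteq> 0" for y
      proof -
        have "f i (y $ i) \<noteq> 0" using that unfolding F_def by (auto simp: prod_zero_iff)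
        then show ?thesis using far[of "y $ i"] norm_le_spread[of y i x] by (simp add: sp_def)
      qed
      have Kb: "norm (K x y) \<le> CK * sp y powr (- M)" if "F y \<noteq> 0" for y
      proof -
        have "off_diagonal x y"
          using F0[OF that] t unfolding off_diagonal_def sp_def spread_def
          by (metis (no_types, lifting) diff_self less_asym norm_zero sum.neutral)
        then show ?thesis unfolding sp_def by (rule size)
      qed
      have T1: "T f x = (LINT y|lebesgue. K x y * F y)"
        using r1 ncl[of "f i"] unfolding F_def by auto
      have bF: "(\<Prod>i\<in>UNIV. (bf f) i (y $ i)) = b (y $ l) * F y" for y
        unfolding F_def by (subst (1 2) prod.remove[of UNIV l]) (auto intro!: prod.cong)
      have "x \<notin> closure {y. (bf f) i y \<noteq> 0}" by (rule ncl) (auto split: if_splits)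
      then have T2: "T (bf f) x = (LINT y|lebesgue. b (y $ l) * (K x y * F y))"
        using r2 unfolding bF by (auto simp: mult_ac)
      define J where "J = (\<integral>\<^sup>+y. ennreal (sp y powr (- \<beta>)) * ennreal (norm (F y)) \<partial>lebesgue)"
      have Jle: "J \<le> ennreal (2 powr \<beta>) * frac_sum \<beta> (\<lambda>i y. norm (f i y)) x"
        unfolding J_def sp_def F_def
        using spread_integral_le_frac_sum[of "\<lambda>i y. norm (f i y)" \<beta> x] \<beta>
        by (simp add: prod_norm[symmetric] prod_ennreal)
      have [measurable]: "sp \<in> borel_measurable lebesgue"
        unfolding sp_def by (rule measurable_completion) simp
      have [measurable]: "(\<lambda>y::(real^'n)^'m. b (y $ l)) \<in> borel_measurable lebesgue"
        by (rule measurable_compose[OF measurable_vec_nth_lebesgue b_meas])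
      show "ennreal (norm (comm f x)) \<le> ennreal (CK * L * 2 powr \<beta>) * frac_sum \<beta> (\<lambda>i y. norm (f i y)) x"
      \<comment> \<open>If the dominating integral diverges, then so does the right-hand side, and
        the claim is trivial. Otherwise it justifies all integrability claims.\<close>
      proof (cases "J = top")
        case True
        then have "frac_sum \<beta> (\<lambda>i y. norm (f i y)) x = top"
          using Jle by (auto simp: top_unique ennreal_mult_eq_top_iff)
        then show ?thesis using CK L by (simp add: ennreal_mult_top)
      next
        case False
        have int_bound: "integrable lebesgue u"
          if [measurable]: "u \<in> borel_measurable lebesgue" and c: "0 \<le> c"
            and le: "AE y in lebesgue. norm (u y) \<le> c * (sp y powr (- \<beta>) * norm (F y))" for u :: "(real^'n)^'m \<Rightarrow> complex" and c
        proof (rule integrableI_bounded)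
          have "(\<integral>\<^sup>+y. ennreal (norm (u y)) \<partial>lebesgue) \<le> (\<integral>\<^sup>+y. ennreal c * (ennreal (sp y powr (- \<beta>)) * ennreal (norm (F y))) \<partial>lebesgue)"
          proof (rule nn_integral_mono_AE)
            show "AE y in lebesgue. ennreal (norm (u y)) \<le> ennreal c * (ennreal (sp y powr (- \<beta>)) * ennreal (norm (F y)))"
              using le
            proof eventually_elim
              fix y assume "norm (u y) \<le> c * (sp y powr (- \<beta>) * norm (F y))"
              then show "ennreal (norm (u y)) \<le> ennreal c * (ennreal (sp y powr (- \<beta>)) * ennreal (norm (F y)))"
                using c by (simp add: ennreal_mult[symmetric] ennreal_leI)
            qed
          qed
          also have "\<dots> = ennreal c * J" unfolding J_def by (rule nn_integral_cmult) simp
          also have "\<dots> < \<infinity>" using False by (simp add: ennreal_mult_less_top less_top)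
          finally show "(\<integral>\<^sup>+y. ennreal (norm (u y)) \<partial>lebesgue) < \<infinity>" .
        qed fact
        \<comment> \<open>Each of the two kernel integrals has the full singularity of order
          \<open>M\<close>. As \<open>sp y > t\<close> on the support, the surplus
          \<open>sp y powr (- \<alpha>)\<close> is bounded, so both converge and may be subtracted;
          this bound depends on \<open>t\<close> but does not enter the final estimate.\<close>
        have split: "sp y powr (- M) = sp y powr (- \<alpha>) * sp y powr (- \<beta>)" for y
          by (simp add: M_eq powr_add[symmetric] add.commute)
        have al: "sp y powr (- \<alpha>) \<le> t powr (- \<alpha>)" if "F y \<noteq> 0" for y
          using F0[OF that] t \<alpha> by (intro powr_mono2') auto
        have Hb: "AE y in lebesgue. norm (b x - b (y $ l)) \<le> L * sp y powr \<alpha>"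
          using AE_vec_nth[OF S0, of l]
        proof eventually_elim
          fix y :: "(real^'n)^'m" assume y: "y $ l \<in> S0"
          have "norm (b x - b (y $ l)) \<le> L * norm (x - y $ l) powr \<alpha>" by (rule Hoelder[OF xS y])
          also have "\<dots> \<le> L * sp y powr \<alpha>"
            using L \<alpha> norm_le_spread[of y l x] by (intro mult_left_mono powr_mono2) (auto simp: sp_def norm_minus_commute)
          finally show "norm (b x - b (y $ l)) \<le> L * sp y powr \<alpha>" .
        qed
        have i1: "integrable lebesgue (\<lambda>y. K x y * F y)"
        proof (rule int_bound[of _ "CK * t powr (- \<alpha>)"])
          show "AE y in lebesgue. norm (K x y * F y) \<le> CK * t powr (- \<alpha>) * (sp y powr (- \<beta>) * norm (F y))"
          proof (rule AE_I2)
            fix y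
            show "norm (K x y * F y) \<le> CK * t powr (- \<alpha>) * (sp y powr (- \<beta>) * norm (F y))"
            proof (cases "F y = 0")
              case False
              have "norm (K x y) \<le> CK * (t powr (- \<alpha>) * sp y powr (- \<beta>))"
                using Kb[OF False] al[OF False] CK unfolding split
                by (meson mult_left_mono mult_right_mono order_trans powr_ge_zero less_imp_le)
              then have "norm (K x y) * norm (F y) \<le> CK * (t powr (- \<alpha>) * sp y powr (- \<beta>)) * norm (F y)"
                by (intro mult_right_mono) auto
              then show ?thesis by (simp add: norm_mult mult_ac)
            qed simp
          qed
        qed (measurable, use CK in simp)
        have diff_le: "AE y in lebesgue. norm ((b x - b (y $ l)) * (K x y * F y)) \<le> CK * L * (sp y powr (- \<beta>) * norm (F y))"
          using Hb
        proof eventually_elim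
          fix y assume h: "norm (b x - b (y $ l)) \<le> L * sp y powr \<alpha>"
          show "norm ((b x - b (y $ l)) * (K x y * F y)) \<le> CK * L * (sp y powr (- \<beta>) * norm (F y))"
          proof (cases "F y = 0")
            case False
            have sp0: "0 < sp y" using F0[OF False] t by simp
            have "norm (b x - b (y $ l)) * norm (K x y) \<le> (L * sp y powr \<alpha>) * (CK * sp y powr (- M))"
              using h Kb[OF False] L by (intro mult_mono) auto
            also have "\<dots> = CK * L * sp y powr (- \<beta>)"
              using sp0 by (simp add: M_eq powr_add[symmetric] mult_ac)
            finally have "norm (b x - b (y $ l)) * norm (K x y) * norm (F y) \<le> CK * L * sp y powr (- \<beta>) * norm (F y)"
              by (intro mult_right_mono) auto
            then show ?thesis by (simp add: norm_mult mult_ac)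
          qed simp
        qed
        have i2: "integrable lebesgue (\<lambda>y. (b x - b (y $ l)) * (K x y * F y))"
          by (rule int_bound[OF _ _ diff_le]) (measurable, use CK L in simp)
        have "comm f x = (LINT y|lebesgue. (b x - b (y $ l)) * (K x y * F y))"
        proof -
          have "(LINT y|lebesgue. b (y $ l) * (K x y * F y)) = (LINT y|lebesgue. b x * (K x y * F y) - (b x - b (y $ l)) * (K x y * F y))"
            by (simp add: algebra_simps)
          also have "\<dots> = b x * (LINT y|lebesgue. K x y * F y) - (LINT y|lebesgue. (b x - b (y $ l)) * (K x y * F y))"
            using i1 i2 by (subst Bochner_Integration.integral_diff) auto
          finally show ?thesis unfolding commutator_def T1 T2 by simp
        qed
        then have "ennreal (norm (comm f x)) \<le> (\<integral>\<^sup>+y. ennreal (norm ((b x - b (y $ l)) * (K x y * F y))) \<partial>lebesgue)"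
          by (simp only: integral_norm_bound_ennreal[OF i2])
        also have "\<dots> \<le> (\<integral>\<^sup>+y. ennreal (CK * L) * (ennreal (sp y powr (- \<beta>)) * ennreal (norm (F y))) \<partial>lebesgue)"
        proof (rule nn_integral_mono_AE)
          show "AE y in lebesgue. ennreal (norm ((b x - b (y $ l)) * (K x y * F y))) \<le> ennreal (CK * L) * (ennreal (sp y powr (- \<beta>)) * ennreal (norm (F y)))"
            using diff_le
          proof eventually_elim
            fix y assume "norm ((b x - b (y $ l)) * (K x y * F y)) \<le> CK * L * (sp y powr (- \<beta>) * norm (F y))"
            then have "ennreal (norm ((b x - b (y $ l)) * (K x y * F y))) \<le> ennreal (CK * L * (sp y powr (- \<beta>) * norm (F y)))"
              by (rule ennreal_leI)
            also have "\<dots> = ennreal (CK * L) * (ennreal (sp y powr (- \<beta>)) * ennreal (norm (F y)))"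
              using CK L by (simp add: ennreal_mult)
            finally show "ennreal (norm ((b x - b (y $ l)) * (K x y * F y))) \<le> ennreal (CK * L) * (ennreal (sp y powr (- \<beta>)) * ennreal (norm (F y)))" .
          qed
        qed
        also have "\<dots> = ennreal (CK * L) * J" unfolding J_def by (rule nn_integral_cmult) simp
        also have "\<dots> \<le> ennreal (CK * L) * (ennreal (2 powr \<beta>) * frac_sum \<beta> (\<lambda>i y. norm (f i y)) x)"
          by (intro mult_left_mono Jle) auto
        also have "\<dots> = ennreal (CK * L * 2 powr \<beta>) * frac_sum \<beta> (\<lambda>i y. norm (f i y)) x"
          using CK L by (simp add: ennreal_mult mult_ac)
        finally show ?thesis .
      qed
    qed
  qed
qed

end

section \<open>Truncating the arguments to small cubes and letting the cubes shrink\<close>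

lemma frac_sum_mono:
  assumes "\<And>i y. \<phi> i y \<le> \<psi> i y"
  shows "frac_sum \<beta> \<phi> x \<le> frac_sum \<beta> \<psi> x"
  unfolding frac_sum_def using assms
  by (intro nn_integral_mono mult_left_mono prod_mono_ennreal mult_right_mono ennreal_leI) auto

lemma frac_sum_measurable:
  fixes \<phi> :: "'m::finite \<Rightarrow> real^'n::finite \<Rightarrow> real"
  assumes [measurable]: "\<And>i. \<phi> i \<in> borel_measurable lebesgue"
  shows "frac_sum \<beta> \<phi> \<in> borel_measurable lebesgue"
  unfolding frac_sum_def[abs_def]
  by (rule borel_measurable_nn_integral_count_space) measurable

context CZ_commutator
begin

text \<open>\<open>S\<close> collects the slots that have been truncated already, which permits
  induction over the slots.\<close>

definition cut :: "(real^'n) set \<Rightarrow> 'm set \<Rightarrow> ('m \<Rightarrow> real^'n \<Rightarrow> complex) \<Rightarrow> 'm \<Rightarrow> real^'n \<Rightarrow> complex" where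
  "cut A S f i = (if i \<in> S then restr A (f i) else f i)"

lemma cut_insert: "cut A (insert i S) f = (cut A S f)(i := restr A (f i))"
  by (auto simp: cut_def)

lemma cut_dom:
  assumes "finite S" "f \<in> cdom" "A \<in> sets lebesgue"
  shows "cut A S f \<in> cdom"
  using assms
proof (induction S)
  case (insert i S)
  have "cut A (insert i S) f = (cut A S f)(i := restr A (cut A S f i))"
    using insert by (auto simp: cut_def)
  then show ?case using dom_restr insert by metis
next
  case empty
  have "cut A {} f = f" by (auto simp: cut_def)
  then show ?case using empty by simp
qed

text \<open>One slot after another: the part of slot \<open>i\<close> outside the cube gives a
  commutator to which \<open>comm_far\<close> applies, and earlier truncations can only decrease the
  fractional sum. Each slot costs one copy of the bound.\<close>

lemma comm_cut_far:
  assumes f: "f \<in> cdom" and t: "0 < t" and S: "finite S"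
  shows "AE x in lebesgue. x \<in> ccube z t \<longrightarrow>
    ennreal (norm (comm f x - comm (cut (ccube z (3 * t)) S f) x))
      \<le> of_nat (card S) * (ennreal (CK * L * 2 powr \<beta>) * frac_sum \<beta> (\<lambda>i y. norm (f i y)) x)"
  using S
proof induction
  case empty
  have "cut (ccube z (3 * t)) {} f = f" by (auto simp: cut_def)
  then show ?case by simp
next
  case (insert i S)
  define A where "A = ccube z (3 * t)"
  define \<phi> where "\<phi> = cut A S f"
  have \<phi>: "\<phi> \<in> cdom" unfolding \<phi>_def A_def by (intro cut_dom insert f) simp
  have \<phi>i: "\<phi> i = f i" using insert by (simp add: \<phi>_def cut_def)
  have A: "A \<in> sets lebesgue" "- A \<in> sets lebesgue"
    using sets.compl_sets[of A lebesgue] by (simp_all add: A_def Compl_eq_Diff_UNIV)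
  have g: "\<phi>(i := restr A (f i)) \<in> cdom" "\<phi>(i := restr (- A) (f i)) \<in> cdom"
    using dom_restr[OF \<phi> A(1), of i] dom_restr[OF \<phi> A(2), of i] by (simp_all add: \<phi>i)
  have add: "AE x in lebesgue. comm \<phi> x = comm (\<phi>(i := restr A (f i))) x + comm (\<phi>(i := restr (- A) (f i))) x"
    by (rule comm_add[OF g]) (auto simp: \<phi>i restr_def)
  have far: "AE x in lebesgue. x \<in> ccube z t \<longrightarrow> ennreal (norm (comm (\<phi>(i := restr (- A) (f i))) x))
      \<le> ennreal (CK * L * 2 powr \<beta>) * frac_sum \<beta> (\<lambda>j y. norm ((\<phi>(i := restr (- A) (f i))) j y)) x"
    by (rule comm_far[OF g(2) t, of _ i]) (auto simp: restr_def A_def)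
  have mono: "frac_sum \<beta> (\<lambda>j y. norm ((\<phi>(i := restr (- A) (f i))) j y)) x \<le> frac_sum \<beta> (\<lambda>i y. norm (f i y)) x" for x
    by (rule frac_sum_mono) (auto simp: \<phi>_def cut_def restr_def)
  have cutm: "cut A (insert i S) f = \<phi>(i := restr A (f i))" by (simp add: cut_insert \<phi>_def)
  show ?case
    using insert(3) add far
  proof eventually_elim
    fix x
    define Fx where "Fx = ennreal (CK * L * 2 powr \<beta>) * frac_sum \<beta> (\<lambda>i y. norm (f i y)) x"
    assume h1: "x \<in> ccube z t \<longrightarrow> ennreal (norm (comm f x - comm (cut (ccube z (3 * t)) S f) x))
          \<le> of_nat (card S) * (ennreal (CK * L * 2 powr \<beta>) * frac_sum \<beta> (\<lambda>i y. norm (f i y)) x)"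
      and h2: "comm \<phi> x = comm (\<phi>(i := restr A (f i))) x + comm (\<phi>(i := restr (- A) (f i))) x"
      and h3: "x \<in> ccube z t \<longrightarrow> ennreal (norm (comm (\<phi>(i := restr (- A) (f i))) x))
        \<le> ennreal (CK * L * 2 powr \<beta>) * frac_sum \<beta> (\<lambda>j y. norm ((\<phi>(i := restr (- A) (f i))) j y)) x"
    show "x \<in> ccube z t \<longrightarrow> ennreal (norm (comm f x - comm (cut (ccube z (3 * t)) (insert i S) f) x))
          \<le> of_nat (card (insert i S)) * (ennreal (CK * L * 2 powr \<beta>) * frac_sum \<beta> (\<lambda>i y. norm (f i y)) x)"
    proof
      assume x: "x \<in> ccube z t"
      have "norm (comm f x - comm (\<phi>(i := restr A (f i))) x)
          = norm ((comm f x - comm \<phi> x) + comm (\<phi>(i := restr (- A) (f i))) x)"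
        using h2 by simp
      also have "\<dots> \<le> norm (comm f x - comm \<phi> x) + norm (comm (\<phi>(i := restr (- A) (f i))) x)"
        by (rule norm_triangle_ineq)
      finally have "ennreal (norm (comm f x - comm (\<phi>(i := restr A (f i))) x))
          \<le> ennreal (norm (comm f x - comm \<phi> x)) + ennreal (norm (comm (\<phi>(i := restr (- A) (f i))) x))"
        by (simp add: ennreal_plus[symmetric] ennreal_leI del: ennreal_plus)
      also have "\<dots> \<le> of_nat (card S) * Fx + Fx"
      proof (rule add_mono)
        show "ennreal (norm (comm f x - comm \<phi> x)) \<le> of_nat (card S) * Fx"
          using h1 x by (simp add: \<phi>_def A_def Fx_def)
        have "ennreal (norm (comm (\<phi>(i := restr (- A) (f i))) x))
            \<le> ennreal (CK * L * 2 powr \<beta>) * frac_sum \<beta> (\<lambda>j y. norm ((\<phi>(i := restr (- A) (f i))) j y)) x"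
          using h3 x by simp
        also have "\<dots> \<le> Fx" unfolding Fx_def by (intro mult_left_mono mono) auto
        finally show "ennreal (norm (comm (\<phi>(i := restr (- A) (f i))) x)) \<le> Fx" .
      qed
      also have "\<dots> = of_nat (card (insert i S)) * Fx"
        using insert by (simp add: distrib_right add.commute)
      finally show "ennreal (norm (comm f x - comm (cut (ccube z (3 * t)) (insert i S) f) x))
          \<le> of_nat (card (insert i S)) * (ennreal (CK * L * 2 powr \<beta>) * frac_sum \<beta> (\<lambda>i y. norm (f i y)) x)"
        unfolding Fx_def by (simp only: cutm A_def[symmetric])
    qed
  qed
qed

text \<open>\<open>2 powr s0\<close> comes from splitting a sum of two terms inside a power, the
  leading 2 from the equal contributions of both terms. Points of a cube of half-side
  \<open>3 * t\<close> differ by at most \<open>6 * t\<close> in each coordinate, hence by at most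
  \<open>CARD('n) * 6 * t\<close> in norm.\<close>

definition local_const :: real where
  "local_const = 2 * 2 powr s0 * (L * (real CARD('n) * 6) powr \<alpha>) powr s0 * CT powr s0"

lemma local_const_nonneg: "0 \<le> local_const"
  by (simp add: local_const_def)

text \<open>On a small cube \<open>b\<close> is nearly constant, and commuting with a constant gives zero.\<close>

lemma comm_local:
  assumes f: "f \<in> cdom" and t: "0 < t"
  shows "(\<integral>\<^sup>+x\<in>ccube z t. ennreal (norm (comm (cut (ccube z (3 * t)) UNIV f) x) powr s0) \<partial>lebesgue)
      \<le> ennreal (local_const * t powr (\<alpha> * s0)) *
        (\<integral>\<^sup>+y\<in>ccube z (3 * t). ennreal (\<Sum>i\<in>UNIV. norm (f i y) powr s i) \<partial>lebesgue)"
proof -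
  have [measurable]: "f i \<in> borel_measurable lebesgue" for i by (rule dom_measurable[OF f])
  have si: "0 < s i" for i using s1[of i] by simp
  define A where "A = ccube z (3 * t)"
  define g where "g = cut A UNIV f"
  have gi: "g i = restr A (f i)" for i by (auto simp: g_def cut_def)
  have g: "g \<in> cdom" unfolding g_def A_def by (intro cut_dom f) auto
  have gT: "g \<in> Lp_tuples s" "bf g \<in> Lp_tuples s" using g by (auto simp: dom_iff)
  have [measurable]: "g i \<in> borel_measurable lebesgue" for i by (rule dom_measurable[OF g])
  define \<Lambda> where "\<Lambda> = L * (real CARD('n) * (6 * t)) powr \<alpha>"
  have \<Lambda>: "0 \<le> \<Lambda>" using L by (simp add: \<Lambda>_def)
  \<comment> \<open>The cube has positive measure and \<open>S0\<close> is of full measure. The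
    value of \<open>b\<close> at such a point serves as the constant.\<close>
  have "\<exists>x0. x0 \<in> S0 \<and> x0 \<in> A"
  proof (rule ccontr)
    assume no: "\<not> (\<exists>x0. x0 \<in> S0 \<and> x0 \<in> A)"
    have "AE x in lebesgue. x \<notin> A" using S0 by eventually_elim (use no in auto)
    then have "A \<in> null_sets lebesgue" by (subst AE_iff_null_sets) (simp_all add: A_def)
    then show False using t emeasure_ccube[of "3 * t" z] by (simp add: A_def null_sets_def)
  qed
  then obtain x0 where x0: "x0 \<in> S0" "x0 \<in> A" by blast
  define c where "c = b x0"
  have bc: "norm (b x - c) \<le> \<Lambda>" if "x \<in> S0" "x \<in> A" for x
  proof -
    have "x0 \<in> ccube z (3 * t)" "z \<in> ccube x0 (3 * t)" using x0 mem_ccube_commute by (auto simp: A_def)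
    then have "x \<in> ccube x0 (3 * t + 3 * t)" using ccube_subset[of z x0 "3 * t" "3 * t"] that by (auto simp: A_def)
    then have "norm (x - x0) \<le> real CARD('n) * (6 * t)" using ccube_norm_le[of x x0 "3 * t + 3 * t"] by simp
    then have "L * norm (x - x0) powr \<alpha> \<le> \<Lambda>" unfolding \<Lambda>_def using L \<alpha> by (intro mult_left_mono powr_mono2) auto
    then show ?thesis using Hoelder[OF that(1) x0(1)] by (simp add: c_def)
  qed
  define u where "u y = (b y - c) * g l y" for y
  have um[measurable]: "u \<in> borel_measurable lebesgue" unfolding u_def by measurable
  have ub: "AE y in lebesgue. norm (u y) \<le> \<Lambda> * norm (g l y)"
    using S0
  proof eventually_elim
    fix y assume "y \<in> S0"
    then show "norm (u y) \<le> \<Lambda> * norm (g l y)"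
      using bc[of y] by (cases "y \<in> A") (auto simp: u_def norm_mult gi restr_def mult_right_mono)
  qed
  note uL = cmult_Lp_space[OF domD(1)[OF g] um ub si \<Lambda>]
  define g1 where "g1 = g(l := u)"
  have g1T: "g1 \<in> Lp_tuples s" unfolding g1_def by (rule Lp_tuples_upd[OF gT(1) uL(1)])
  have cgL: "(\<lambda>y. c * g l y) \<in> Lp_space (s l) (\<lambda>_. 1)"
    by (rule cmult_Lp_space(1)[OF domD(1)[OF g, of l], where c = "norm c"]) (use si in \<open>auto simp: norm_mult\<close>)
  have add: "AE x in lebesgue. T (bf g) x = c * T g x + T g1 x"
  proof -
    define g2 where "g2 = g(l := \<lambda>y. c * g l y)"
    have g2T: "g2 \<in> Lp_tuples s" unfolding g2_def by (rule Lp_tuples_upd[OF gT(1) cgL])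
    have e: "g2(l := \<lambda>y. g2 l y + u y) = bf g" by (auto simp: g2_def u_def algebra_simps)
    have e1: "g2(l := u) = g1" by (auto simp: g2_def g1_def)
    show ?thesis
      using T_add[OF g2T uL(1)] T_scale[OF gT(1), of l c]
      unfolding e e1 by eventually_elim (simp add: g2_def)
  qed
  define a where "a i = enn2real (\<integral>\<^sup>+y. ennreal (norm (g i y) powr s i) \<partial>lebesgue)" for i
  have aE: "(\<integral>\<^sup>+y. ennreal (norm (g i y) powr s i) \<partial>lebesgue) = ennreal (a i)" for i
    unfolding a_def using domD(1)[OF g, of i] by (intro ennreal_enn2real[symmetric]) (simp add: Lp_space_iff)
  have a0: "0 \<le> a i" for i by (simp add: a_def)
  \<comment> \<open>The product of powers \<open>P\<close> is not additive over cubes. AM-GM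
    replaces it by the sum of the \<open>a i\<close>, the integral of one fixed function over the
    cube, as \<open>emeasure_le_if_ccube_le\<close> needs it.\<close>
  define as where "as = (\<Sum>i\<in>UNIV. a i)"
  have as0: "0 \<le> as" using a0 by (simp add: as_def sum_nonneg)
  have asE: "ennreal as = (\<integral>\<^sup>+y\<in>A. ennreal (\<Sum>i\<in>UNIV. norm (f i y) powr s i) \<partial>lebesgue)"
  proof -
    have "ennreal as = (\<Sum>i\<in>UNIV. ennreal (a i))" unfolding as_def using a0 by simp
    also have "\<dots> = (\<integral>\<^sup>+y. (\<Sum>i\<in>UNIV. ennreal (norm (g i y) powr s i)) \<partial>lebesgue)"
      by (subst nn_integral_sum) (auto simp: aE)
    also have "\<dots> = (\<integral>\<^sup>+y\<in>A. ennreal (\<Sum>i\<in>UNIV. norm (f i y) powr s i) \<partial>lebesgue)"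
      using si by (intro nn_integral_cong) (auto simp: gi restr_def split: split_indicator)
    finally show ?thesis .
  qed
  define P where "P = (\<Prod>i\<in>UNIV. a i powr (s0 / s i))"
  have P0: "0 \<le> P" unfolding P_def by (intro prod_nonneg) auto
  have P: "P \<le> as"
  proof -
    have t0: "0 \<le> s0 / s i" for i using s0_pos si[of i] by simp
    have "P \<le> (\<Sum>i\<in>UNIV. s0 / s i * a i)"
      unfolding P_def using a0 s0_sum t0 by (intro weighted_AM_GM) auto
    also have "\<dots> \<le> as" unfolding as_def
    proof (intro sum_mono)
      fix i
      have "s0 / s i \<le> (\<Sum>i\<in>UNIV. s0 / s i)" using t0 by (intro member_le_sum) auto
      then show "s0 / s i * a i \<le> a i" using mult_right_mono[of "s0 / s i" 1 "a i"] a0[of i] by (simp only: s0_sum mult_1)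
    qed
    finally show ?thesis .
  qed
  have I1: "(\<integral>\<^sup>+x. ennreal (norm (T g x) powr s0) \<partial>lebesgue) \<le> ennreal (CT powr s0 * P)"
    unfolding P_def by (rule T_power_bound[OF gT(1) a0]) (simp add: aE)
  have I2: "(\<integral>\<^sup>+x. ennreal (norm (T g1 x) powr s0) \<partial>lebesgue) \<le> ennreal (CT powr s0 * (\<Lambda> powr s0 * P))"
  proof -
    define a' where "a' i = (if i = l then \<Lambda> powr s l * a l else a i)" for i
    have "(\<integral>\<^sup>+x. ennreal (norm (T g1 x) powr s0) \<partial>lebesgue) \<le> ennreal (CT powr s0 * (\<Prod>i\<in>UNIV. a' i powr (s0 / s i)))"
    proof (rule T_power_bound[OF g1T])
      show "0 \<le> a' i" for i using a0 by (simp add: a'_def)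
      show "(\<integral>\<^sup>+x. ennreal (norm (g1 i x) powr s i) \<partial>lebesgue) \<le> ennreal (a' i)" for i
        using uL(2) a0[of l] by (simp add: g1_def a'_def aE ennreal_mult)
    qed
    also have "(\<Prod>i\<in>UNIV. a' i powr (s0 / s i)) = a' l powr (s0 / s l) * (\<Prod>i\<in>UNIV - {l}. a' i powr (s0 / s i))"
      by (rule prod.remove) auto
    also have "(\<Prod>i\<in>UNIV - {l}. a' i powr (s0 / s i)) = (\<Prod>i\<in>UNIV - {l}. a i powr (s0 / s i))"
      by (intro prod.cong) (auto simp: a'_def)
    also have "a' l powr (s0 / s l) = \<Lambda> powr s0 * a l powr (s0 / s l)"
      using si[of l] by (simp add: a'_def powr_mult powr_powr)
    also have "\<Lambda> powr s0 * a l powr (s0 / s l) * (\<Prod>i\<in>UNIV - {l}. a i powr (s0 / s i)) = \<Lambda> powr s0 * P"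
      unfolding P_def by (subst prod.remove[of UNIV l]) auto
    finally show ?thesis .
  qed
  have [measurable]: "T g \<in> borel_measurable lebesgue" "T g1 \<in> borel_measurable lebesgue"
    by (rule T_meas gT g1T)+
  have "(\<integral>\<^sup>+x\<in>ccube z t. ennreal (norm (comm g x) powr s0) \<partial>lebesgue)
     \<le> (\<integral>\<^sup>+x. ennreal (2 powr s0 * \<Lambda> powr s0) * ennreal (norm (T g x) powr s0) + ennreal (2 powr s0) * ennreal (norm (T g1 x) powr s0) \<partial>lebesgue)"
  proof (rule nn_integral_mono_AE)
    show "AE x in lebesgue. ennreal (norm (comm g x) powr s0) * indicator (ccube z t) x
       \<le> ennreal (2 powr s0 * \<Lambda> powr s0) * ennreal (norm (T g x) powr s0) + ennreal (2 powr s0) * ennreal (norm (T g1 x) powr s0)"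
      using add S0
    proof eventually_elim
      fix x assume e: "T (bf g) x = c * T g x + T g1 x" and xS: "x \<in> S0"
      show "ennreal (norm (comm g x) powr s0) * indicator (ccube z t) x
       \<le> ennreal (2 powr s0 * \<Lambda> powr s0) * ennreal (norm (T g x) powr s0) + ennreal (2 powr s0) * ennreal (norm (T g1 x) powr s0)"
      proof (cases "x \<in> ccube z t")
        case True
        then have xA: "x \<in> A" using ccube_mono[of t "3 * t" z] t by (auto simp: A_def)
        define p1 where "p1 = \<Lambda> * norm (T g x)"
        define p2 where "p2 = norm (T g1 x)"
        have p0: "0 \<le> p1" "0 \<le> p2" using \<Lambda> by (auto simp: p1_def p2_def)
        have "comm g x = (b x - c) * T g x - T g1 x" using e by (simp add: commutator_def algebra_simps)
        then have "norm (comm g x) \<le> norm ((b x - c) * T g x) + norm (T g1 x)" by (simp add: norm_triangle_ineq4)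
        also have "\<dots> \<le> p1 + p2" using bc[OF xS xA] by (simp add: p1_def p2_def norm_mult mult_right_mono)
        \<comment> \<open>Passing through the maximum works for every positive exponent
          \<open>s0\<close>, below 1 or above.\<close>
        also have "\<dots> \<le> 2 * max p1 p2" by simp
        finally have "norm (comm g x) powr s0 \<le> (2 * max p1 p2) powr s0" using s0_pos by (intro powr_mono2) auto
        also have "\<dots> = 2 powr s0 * (max p1 p2) powr s0" by (rule powr_mult)
        also have "\<dots> \<le> 2 powr s0 * (p1 powr s0 + p2 powr s0)"
          by (intro mult_left_mono) (auto simp: max_def)
        also have "\<dots> = 2 powr s0 * \<Lambda> powr s0 * norm (T g x) powr s0 + 2 powr s0 * norm (T g1 x) powr s0"
          by (simp add: p1_def p2_def powr_mult distrib_left)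
        finally have "ennreal (norm (comm g x) powr s0) \<le> ennreal (2 powr s0 * \<Lambda> powr s0 * norm (T g x) powr s0 + 2 powr s0 * norm (T g1 x) powr s0)"
          by (rule ennreal_leI)
        also have "\<dots> = ennreal (2 powr s0 * \<Lambda> powr s0) * ennreal (norm (T g x) powr s0) + ennreal (2 powr s0) * ennreal (norm (T g1 x) powr s0)"
          by (simp add: ennreal_mult)
        finally show ?thesis using True by simp
      qed simp
    qed
  qed
  also have "\<dots> = ennreal (2 powr s0 * \<Lambda> powr s0) * (\<integral>\<^sup>+x. ennreal (norm (T g x) powr s0) \<partial>lebesgue) + ennreal (2 powr s0) * (\<integral>\<^sup>+x. ennreal (norm (T g1 x) powr s0) \<partial>lebesgue)"
    by (simp add: nn_integral_add nn_integral_cmult)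
  also have "\<dots> \<le> ennreal (2 powr s0 * \<Lambda> powr s0) * ennreal (CT powr s0 * P) + ennreal (2 powr s0) * ennreal (CT powr s0 * (\<Lambda> powr s0 * P))"
    by (intro add_mono mult_left_mono I1 I2) auto
  also have "\<dots> = ennreal (2 powr s0 * \<Lambda> powr s0 * (CT powr s0 * P) + 2 powr s0 * (CT powr s0 * (\<Lambda> powr s0 * P)))"
    using P0 by (simp add: ennreal_mult'[symmetric] ennreal_plus[symmetric] del: ennreal_plus)
  also have "\<dots> \<le> ennreal (local_const * t powr (\<alpha> * s0) * as)"
  proof (rule ennreal_leI)
    have "\<Lambda> = L * (real CARD('n) * 6) powr \<alpha> * t powr \<alpha>"
      by (simp add: \<Lambda>_def powr_mult mult.assoc[symmetric])
    then have "\<Lambda> powr s0 = (L * (real CARD('n) * 6) powr \<alpha>) powr s0 * t powr (\<alpha> * s0)"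
      by (simp only: powr_mult powr_powr)
    moreover have alg: "x * (y * \<tau>) * (c * P) + x * (c * (y * \<tau> * P)) = 2 * x * y * c * \<tau> * P" for x y \<tau> c P :: real
      by (simp add: algebra_simps)
    ultimately have "2 powr s0 * \<Lambda> powr s0 * (CT powr s0 * P) + 2 powr s0 * (CT powr s0 * (\<Lambda> powr s0 * P))
       = local_const * t powr (\<alpha> * s0) * P"
      by (simp only: local_const_def alg)
    also have "\<dots> \<le> local_const * t powr (\<alpha> * s0) * as"
      by (intro mult_left_mono P mult_nonneg_nonneg local_const_nonneg) auto
    finally show "2 powr s0 * \<Lambda> powr s0 * (CT powr s0 * P) + 2 powr s0 * (CT powr s0 * (\<Lambda> powr s0 * P))
       \<le> local_const * t powr (\<alpha> * s0) * as" .
  qed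
  also have "\<dots> = ennreal (local_const * t powr (\<alpha> * s0)) * ennreal as"
    using as0 by (intro ennreal_mult'')
  finally show ?thesis unfolding asE g_def A_def .
qed

text \<open>On each cube of half-side t, Chebyshev's inequality and \<open>comm_local\<close> bound
  the exceptional set by a multiple of t^(\<alpha> s0) times the integral of a fixed function over
  the tripled cube. Averaging over all cubes gives a global bound with the same power of t, which
  tends to 0.\<close>

lemma comm_exceeds_null:
  assumes f: "f \<in> cdom" and \<delta>: "0 < \<delta>"
  defines "W \<equiv> {x. ennreal (norm (comm f x)) > of_nat CARD('m) * (ennreal (CK * L * 2 powr \<beta>) * frac_sum \<beta> (\<lambda>i y. norm (f i y)) x) + ennreal \<delta>}"
  shows "emeasure lebesgue W = 0"
proof -
  have [measurable]: "f i \<in> borel_measurable lebesgue" for i by (rule dom_measurable[OF f])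
  have [measurable]: "frac_sum \<beta> (\<lambda>i y. norm (f i y)) \<in> borel_measurable lebesgue"
    by (rule frac_sum_measurable) simp
  have [measurable]: "comm f \<in> borel_measurable lebesgue" by (rule comm_measurable[OF f])
  have "{x \<in> space lebesgue. ennreal (norm (comm f x)) > of_nat CARD('m) * (ennreal (CK * L * 2 powr \<beta>) * frac_sum \<beta> (\<lambda>i y. norm (f i y)) x) + ennreal \<delta>} \<in> sets lebesgue"
    by measurable
  then have W[measurable]: "W \<in> sets lebesgue"
    unfolding W_def by (simp only: space_completion space_lborel space_borel UNIV_I simp_thms)
  define \<nu> where "\<nu> y = ennreal (\<Sum>i\<in>UNIV. norm (f i y) powr s i)" for y
  have \<nu>m[measurable]: "\<nu> \<in> borel_measurable lebesgue" unfolding \<nu>_def by measurable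
  have \<nu>fin: "(\<integral>\<^sup>+y. \<nu> y \<partial>lebesgue) < top"
  proof -
    have "(\<integral>\<^sup>+y. \<nu> y \<partial>lebesgue) = (\<Sum>i\<in>UNIV. \<integral>\<^sup>+y. ennreal (norm (f i y) powr s i) \<partial>lebesgue)"
      unfolding \<nu>_def by (subst nn_integral_sum[symmetric]) (auto intro!: nn_integral_cong)
    also have "\<dots> < top" using domD(1)[OF f] by (simp add: Lp_space_iff)
    finally show ?thesis .
  qed
  define c where "c t = local_const * t powr (\<alpha> * s0) * \<delta> powr (- s0)" for t
  have le: "emeasure lebesgue (W \<inter> ccube z t) \<le> ennreal (c t) * (\<integral>\<^sup>+y\<in>ccube z (3 * t). \<nu> y \<partial>lebesgue)"
    if t: "0 < t" for z t
  proof -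
    define g where "g = cut (ccube z (3 * t)) UNIV f"
    have g: "g \<in> cdom" unfolding g_def by (intro cut_dom f) auto
    have [measurable]: "comm g \<in> borel_measurable lebesgue" by (rule comm_measurable[OF g])
    have "ennreal (\<delta> powr s0) * emeasure lebesgue (W \<inter> ccube z t)
        = (\<integral>\<^sup>+x. ennreal (\<delta> powr s0) * indicator (W \<inter> ccube z t) x \<partial>lebesgue)"
      by (rule nn_integral_cmult_indicator[symmetric]) simp
    also have "\<dots> \<le> (\<integral>\<^sup>+x\<in>ccube z t. ennreal (norm (comm g x) powr s0) \<partial>lebesgue)"
    proof (rule nn_integral_mono_AE)
      show "AE x in lebesgue. ennreal (\<delta> powr s0) * indicator (W \<inter> ccube z t) x
          \<le> ennreal (norm (comm g x) powr s0) * indicator (ccube z t) x"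
        using comm_cut_far[OF f t, where S = UNIV and z = z, OF finite]
      proof eventually_elim
        case (elim x)
        show ?case
        proof (cases "x \<in> W \<inter> ccube z t")
          case True
          define F where "F = of_nat CARD('m) * (ennreal (CK * L * 2 powr \<beta>) * frac_sum \<beta> (\<lambda>i y. norm (f i y)) x)"
          have h: "ennreal (norm (comm f x - comm g x)) \<le> F" using elim True by (simp add: g_def F_def)
          have w: "F + ennreal \<delta> < ennreal (norm (comm f x))" using True by (simp add: W_def F_def)
          \<comment> \<open>The far part is at most \<open>F\<close>, so on \<open>W\<close> the
            margin \<open>\<delta>\<close> has to come from the local part.\<close>
          have "\<delta> \<le> norm (comm g x)"
          proof (rule ccontr)
            assume "\<not> \<delta> \<le> norm (comm g x)"
            then have "norm (comm f x) \<le> norm (comm f x - comm g x) + \<delta>"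
              using norm_triangle_ineq2[of "comm f x" "comm g x"] by simp
            then have "ennreal (norm (comm f x)) \<le> ennreal (norm (comm f x - comm g x)) + ennreal \<delta>"
              using \<delta> by (simp add: ennreal_plus[symmetric] ennreal_leI del: ennreal_plus)
            also have "\<dots> \<le> F + ennreal \<delta>" using h by (rule add_right_mono)
            finally show False using w by simp
          qed
          then show ?thesis using True \<delta> s0_pos by (auto intro!: ennreal_leI powr_mono2)
        qed (auto split: split_indicator)
      qed
    qed
    also have "\<dots> \<le> ennreal (local_const * t powr (\<alpha> * s0)) * (\<integral>\<^sup>+y\<in>ccube z (3 * t). \<nu> y \<partial>lebesgue)"
      unfolding g_def \<nu>_def by (rule comm_local[OF f t])
    finally have "ennreal (\<delta> powr (- s0)) * (ennreal (\<delta> powr s0) * emeasure lebesgue (W \<inter> ccube z t))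
        \<le> ennreal (\<delta> powr (- s0)) * (ennreal (local_const * t powr (\<alpha> * s0)) * (\<integral>\<^sup>+y\<in>ccube z (3 * t). \<nu> y \<partial>lebesgue))"
      by (rule mult_left_mono) simp
    moreover have "ennreal (\<delta> powr (- s0)) * ennreal (\<delta> powr s0) = 1"
      using \<delta> by (simp add: ennreal_mult'[symmetric] powr_add[symmetric])
    moreover have "ennreal (\<delta> powr (- s0)) * ennreal (local_const * t powr (\<alpha> * s0)) = ennreal (c t)"
      using local_const_nonneg by (simp add: c_def ennreal_mult'[symmetric] mult.commute)
    ultimately show ?thesis by (simp add: mult.assoc[symmetric])
  qed
  have ub: "emeasure lebesgue W \<le> ennreal (c t * 3 ^ CARD('n)) * (\<integral>\<^sup>+y. \<nu> y \<partial>lebesgue)" if "0 < t" for t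
    by (rule emeasure_le_if_ccube_le[OF W \<nu>m that _ le[OF that]]) (use local_const_nonneg in \<open>simp add: c_def\<close>)
  define I where "I = enn2real (\<integral>\<^sup>+y. \<nu> y \<partial>lebesgue)"
  have I: "(\<integral>\<^sup>+y. \<nu> y \<partial>lebesgue) = ennreal I" using \<nu>fin by (simp add: I_def)
  have lim: "((\<lambda>t. ennreal (c t * 3 ^ CARD('n) * I)) \<longlongrightarrow> ennreal 0) (at_right 0)"
  proof (rule tendsto_ennrealI)
    have "((\<lambda>t::real. t powr (\<alpha> * s0)) \<longlongrightarrow> 0) (at_right 0)"
      by (rule tendsto_zero_powrI[where b = "\<alpha> * s0"])
         (use \<alpha> s0_pos in \<open>auto simp: eventually_at_right_less intro: tendsto_ident_at eventually_mono[OF eventually_at_right_less]\<close>)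
    then have "((\<lambda>t. (local_const * \<delta> powr (- s0) * 3 ^ CARD('n) * I) * t powr (\<alpha> * s0)) \<longlongrightarrow> 0) (at_right 0)"
      by (rule tendsto_mult_right_zero)
    then show "((\<lambda>t. c t * 3 ^ CARD('n) * I) \<longlongrightarrow> 0) (at_right 0)"
      by (simp add: c_def mult_ac)
  qed
  have "emeasure lebesgue W \<le> ennreal 0"
  proof (rule tendsto_lowerbound[OF lim])
    show "eventually (\<lambda>t. emeasure lebesgue W \<le> ennreal (c t * 3 ^ CARD('n) * I)) (at_right 0)"
      using eventually_at_right_less[of "0::real"]
    proof eventually_elim
      fix t :: real assume t: "0 < t"
      have "0 \<le> c t * 3 ^ CARD('n)" using local_const_nonneg by (simp add: c_def)
      then show "emeasure lebesgue W \<le> ennreal (c t * 3 ^ CARD('n) * I)"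
        using ub[OF t] unfolding I by (simp add: ennreal_mult')
    qed
  qed simp
  then show ?thesis by simp
qed

text \<open>The margin of \<open>comm_exceeds_null\<close> is removed along the sequence
  \<open>1 / Suc j\<close>; countably many null sets are discarded.\<close>

lemma comm_dominated:
  assumes f: "f \<in> cdom"
  shows "AE x in lebesgue. ennreal (norm (comm f x))
      \<le> ennreal (real CARD('m) * CK * L * 2 powr \<beta>) * frac_sum \<beta> (\<lambda>i y. norm (f i y)) x"
proof -
  define F where "F x = of_nat CARD('m) * (ennreal (CK * L * 2 powr \<beta>) * frac_sum \<beta> (\<lambda>i y. norm (f i y)) x)" for x
  have [measurable]: "f i \<in> borel_measurable lebesgue" for i by (rule dom_measurable[OF f])
  have [measurable]: "frac_sum \<beta> (\<lambda>i y. norm (f i y)) \<in> borel_measurable lebesgue"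
    by (rule frac_sum_measurable) simp
  have [measurable]: "comm f \<in> borel_measurable lebesgue" by (rule comm_measurable[OF f])
  have Fm[measurable]: "F \<in> borel_measurable lebesgue" unfolding F_def by measurable
  have "AE x in lebesgue. \<forall>j::nat. ennreal (norm (comm f x)) \<le> F x + ennreal (1 / Suc j)"
    unfolding AE_all_countable
  proof
    fix j :: nat
    have m: "{x. F x + ennreal (1 / Suc j) < ennreal (norm (comm f x))} \<in> sets lebesgue"
    proof -
      have "{x \<in> space lebesgue. F x + ennreal (1 / Suc j) < ennreal (norm (comm f x))} \<in> sets lebesgue" by measurable
      then show ?thesis by simp
    qed
    have "emeasure lebesgue {x. F x + ennreal (1 / Suc j) < ennreal (norm (comm f x))} = 0"
      unfolding F_def by (rule comm_exceeds_null[OF f]) simp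
    then show "AE x in lebesgue. ennreal (norm (comm f x)) \<le> F x + ennreal (1 / Suc j)"
      by (intro AE_I[OF _ _ m]) (auto simp: not_le)
  qed
  then show ?thesis
  proof eventually_elim
    fix x assume a: "\<forall>j::nat. ennreal (norm (comm f x)) \<le> F x + ennreal (1 / Suc j)"
    have lim: "(\<lambda>j. F x + ennreal (1 / Suc j)) \<longlonglongrightarrow> F x + ennreal 0"
      using LIMSEQ_inverse_real_of_nat
      by (intro tendsto_add tendsto_const tendsto_ennrealI) (simp add: inverse_eq_divide)
    have "ennreal (norm (comm f x)) \<le> F x + ennreal 0"
      by (rule tendsto_lowerbound[OF lim]) (use a in auto)
    also have "F x + ennreal 0 = ennreal (real CARD('m) * CK * L * 2 powr \<beta>) * frac_sum \<beta> (\<lambda>i y. norm (f i y)) x"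
      using CK L by (simp add: F_def ennreal_of_nat_eq_real_of_nat mult.assoc[symmetric] ennreal_mult'[symmetric])
    finally show "ennreal (norm (comm f x)) \<le> ennreal (real CARD('m) * CK * L * 2 powr \<beta>) * frac_sum \<beta> (\<lambda>i y. norm (f i y)) x" .
  qed
qed

end

section \<open>The upper bound\<close>

lemma locally_integrable_measurable:
  fixes b :: "'a::euclidean_space \<Rightarrow> complex"
  assumes "locally_integrable b"
  shows "b \<in> borel_measurable lebesgue"
proof (rule borel_measurable_LIMSEQ_metric)
  fix k :: nat
  have "b absolutely_integrable_on cball 0 (real k)"
    using assms by (simp add: locally_integrable_def)
  then show "(\<lambda>x. indicator (cball 0 (real k)) x *\<^sub>R b x) \<in> borel_measurable lebesgue"
    unfolding set_integrable_def by auto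
next
  fix x :: 'a
  obtain k0 :: nat where "norm x \<le> real k0" using real_arch_simple by blast
  then have "\<forall>\<^sub>F k in sequentially. b x = indicator (cball 0 (real k)) x *\<^sub>R b x"
    by (intro eventually_sequentiallyI[of k0]) (auto split: split_indicator)
  then show "(\<lambda>k. indicator (cball 0 (real k)) x *\<^sub>R b x) \<longlonglongrightarrow> b x"
    by (rule Lim_transform_eventually[OF tendsto_const])
qed

section \<open>Multiple weights as one balanced family\<close>

lemma UNIV_option_eq: "(UNIV :: 'a option set) = insert None (Some ` UNIV)"
  by (auto simp: image_iff)

lemma prod_option:
  fixes f :: "'m::finite option \<Rightarrow> 'b::comm_monoid_mult"
  shows "(\<Prod>k\<in>UNIV. f k) = f None * (\<Prod>i\<in>UNIV. f (Some i))"
  unfolding UNIV_option_eq by (subst prod.insert) (auto simp: prod.reindex)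

lemma sum_option:
  fixes f :: "'m::finite option \<Rightarrow> 'b::comm_monoid_add"
  shows "(\<Sum>k\<in>UNIV. f k) = f None + (\<Sum>i\<in>UNIV. f (Some i))"
  unfolding UNIV_option_eq by (subst sum.insert) (auto simp: sum.reindex)

lemma epowr_pos: "0 < x \<Longrightarrow> 0 < epowr x a"
  by (auto simp: epowr_def enn2real_eq_0_iff)

text \<open>In terms of the weight w = \<omega>^p this is the usual dual weight w^(1 - p').\<close>

definition dual_weight :: "('m \<Rightarrow> real) \<Rightarrow> ('m \<Rightarrow> 'a \<Rightarrow> real) \<Rightarrow> 'm \<Rightarrow> 'a \<Rightarrow> real" where
  "dual_weight p \<omega> i x = \<omega> i x powr (- conj_exp (p i))"

text \<open>\<open>None\<close> stands for the target weight. The option type puts it on the same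
  footing as the dual weights.\<close>

definition all_weights ::
  "('m::finite \<Rightarrow> real) \<Rightarrow> real \<Rightarrow> ('m \<Rightarrow> 'a \<Rightarrow> real) \<Rightarrow> 'm option \<Rightarrow> 'a \<Rightarrow> real" where
  "all_weights p q \<omega> k = (case k of None \<Rightarrow> mu_weight q \<omega> | Some i \<Rightarrow> dual_weight p \<omega> i)"

definition all_exponents :: "('m \<Rightarrow> real) \<Rightarrow> real \<Rightarrow> 'm option \<Rightarrow> real" where
  "all_exponents p q k = (case k of None \<Rightarrow> 1 / q | Some i \<Rightarrow> 1 - 1 / p i)"

text \<open>With these exponents the \<omega>_i cancel pointwise: \<mu>^(1/q) is their product and
  \<sigma>_i^(1/p_i') is 1/\<omega>_i. This gives \<open>prod1\<close>; the supremum in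
  \<open>A_class\<close>, evaluated on centred cubes, gives \<open>bal\<close>.\<close>

lemma A_class_balanced:
  fixes \<omega> :: "'m::finite \<Rightarrow> real^'n::finite \<Rightarrow> real"
  assumes \<omega>: "\<omega> \<in> A_class p q" and q: "0 < q"
  shows "\<exists>C. balanced_weights (all_weights p q \<omega>) (all_exponents p q) C"
proof -
  have p: "1 < p i" and w: "weight (\<omega> i)" and pos: "AE x in lebesgue. 0 < \<omega> i x" for i
    using \<omega> by (auto simp: A_class_def)
  define v where "v = all_weights p q \<omega>"
  define \<theta> where "\<theta> = all_exponents p q"
  have vN: "v None = mu_weight q \<omega>" and vS: "v (Some i) = dual_weight p \<omega> i" for i
    by (auto simp: v_def all_weights_def)
  have vS': "v (Some i) = (\<lambda>x. \<omega> i x powr (- conj_exp (p i)))" for i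
    by (simp add: vS dual_weight_def fun_eq_iff)
  have thN: "\<theta> None = 1 / q" and thS: "\<theta> (Some i) = 1 - 1 / p i" for i
    by (auto simp: \<theta>_def all_exponents_def)
  have cp: "1 / conj_exp (p i) = 1 - 1 / p i" "0 < conj_exp (p i)" for i
    using p[of i] by (auto simp: conj_exp_def field_simps)
  have th: "0 < \<theta> k" for k
  proof (cases k)
    case (Some i)
    then show ?thesis using p[of i] by (simp add: thS)
  qed (use q in \<open>simp add: thN\<close>)
  have posall: "AE x in lebesgue. \<forall>i\<in>UNIV. 0 < \<omega> i x"
    by (rule AE_finite_allI) (use pos in auto)
  have [measurable]: "\<omega> i \<in> borel_measurable lebesgue" for i using w by (simp add: weight_def)
  have wt: "weight (v k)" for k
  proof (cases k)
    case None
    have "(\<lambda>x. \<Prod>i\<in>UNIV. \<omega> i x powr q) \<in> borel_measurable lebesgue" by measurable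
    then show ?thesis by (simp add: None vN weight_def mu_weight_def[abs_def] prod_nonneg)
  next
    case (Some i)
    have "(\<lambda>x. \<omega> i x powr (- conj_exp (p i))) \<in> borel_measurable lebesgue" by measurable
    then show ?thesis by (simp add: Some vS weight_def dual_weight_def[abs_def])
  qed
  have vpos: "AE x in lebesgue. 0 < v k x" for k
  proof (cases k)
    case None
    show ?thesis using posall unfolding None vN
      by eventually_elim (auto simp: mu_weight_def less_imp_neq[symmetric] intro!: prod_pos)
  next
    case (Some i)
    show ?thesis using pos[of i] unfolding Some vS
      by eventually_elim (auto simp: dual_weight_def)
  qed
  have prod1: "AE x in lebesgue. (\<Prod>k\<in>UNIV. v k x powr \<theta> k) = 1"
    using posall
  proof eventually_elim
    fix x assume x: "\<forall>i\<in>UNIV. 0 < \<omega> i x"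
    have "(\<Prod>k\<in>UNIV. v k x powr \<theta> k) = (\<Prod>i\<in>UNIV. \<omega> i x powr q) powr (1 / q) * (\<Prod>i\<in>UNIV. (\<omega> i x powr (- conj_exp (p i))) powr (1 / conj_exp (p i)))"
      by (simp add: prod_option vN vS thN thS mu_weight_def dual_weight_def cp)
    also have "(\<Prod>i\<in>UNIV. \<omega> i x powr q) powr (1 / q) = (\<Prod>i\<in>UNIV. \<omega> i x)"
      using q x by (subst prod_powr_distrib) (auto simp: powr_powr less_imp_le)
    also have "(\<Prod>i\<in>UNIV. (\<omega> i x powr (- conj_exp (p i))) powr (1 / conj_exp (p i))) = (\<Prod>i\<in>UNIV. 1 / \<omega> i x)"
    proof (intro prod.cong refl)
      fix i
      have "conj_exp (p i) \<noteq> 0" using cp(2)[of i] by simp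
      then have "(\<omega> i x powr (- conj_exp (p i))) powr (1 / conj_exp (p i)) = \<omega> i x powr (- 1)"
        by (simp add: powr_powr)
      then show "(\<omega> i x powr (- conj_exp (p i))) powr (1 / conj_exp (p i)) = 1 / \<omega> i x"
        using bspec[OF x UNIV_I, of i] by (simp add: powr_minus_divide abs_of_pos)
    qed
    also have "(\<Prod>i\<in>UNIV. \<omega> i x) * (\<Prod>i\<in>UNIV. 1 / \<omega> i x) = 1"
      using x by (simp add: prod.distrib[symmetric] less_imp_neq[symmetric])
    finally show "(\<Prod>k\<in>UNIV. v k x powr \<theta> k) = 1" .
  qed
  define S where "S = (SUP Q\<in>cubes. epowr (average Q (mu_weight q \<omega>)) (1 / q) *
        (\<Prod>i\<in>UNIV. epowr (average Q (\<lambda>x. \<omega> i x powr (- conj_exp (p i)))) (1 / conj_exp (p i))))"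
  have S: "S < top" using \<omega> by (simp add: A_class_def S_def)
  have avg: "(\<Prod>k\<in>UNIV. epowr (emeasure (wdens (v k)) (ccube x t) / emeasure lebesgue (ccube x t)) (\<theta> k)) \<le> S"
    if t: "0 < t" for x t
  proof -
    have "average (ccube x t) (v k) = emeasure (wdens (v k)) (ccube x t) / emeasure lebesgue (ccube x t)" for k
      unfolding average_def by (simp add: emeasure_wdens[OF wt])
    then have "(\<Prod>k\<in>UNIV. epowr (emeasure (wdens (v k)) (ccube x t) / emeasure lebesgue (ccube x t)) (\<theta> k))
        = epowr (average (ccube x t) (mu_weight q \<omega>)) (1 / q) *
        (\<Prod>i\<in>UNIV. epowr (average (ccube x t) (\<lambda>x. \<omega> i x powr (- conj_exp (p i)))) (1 / conj_exp (p i)))"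
      by (simp only: prod_option thN thS cp vS'[symmetric] vN[symmetric])
    also have "\<dots> \<le> S" unfolding S_def by (rule SUP_upper[OF ccube_in_cubes[OF t]])
    finally show ?thesis .
  qed
  have vQ: "0 < emeasure (wdens (v k)) (ccube x t)" if t: "0 < t" for k x t
    using t by (intro emeasure_wdens_pos wt vpos) (auto simp: emeasure_ccube)
  have apos: "0 < emeasure (wdens (v k)) (ccube x t) / emeasure lebesgue (ccube x t)" if t: "0 < t" for k x t
    using vQ[OF t, of k x] emeasure_ccube_finite[of x t] by (auto simp: ennreal_zero_less_divide less_top)
  \<comment> \<open>A finite product without vanishing factors has only finite factors; the zeros
    are excluded by the positivity of the weights.\<close>
  have fin: "emeasure (wdens (v k)) (ccube x t) < \<infinity>" if t: "0 < t" for k x t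
  proof -
    have "(\<Prod>k\<in>UNIV. epowr (emeasure (wdens (v k)) (ccube x t) / emeasure lebesgue (ccube x t)) (\<theta> k)) \<noteq> top"
      using avg[OF t, of x] S by (auto simp: top_unique)
    then have "epowr (emeasure (wdens (v k)) (ccube x t) / emeasure lebesgue (ccube x t)) (\<theta> k) \<noteq> top"
      using epowr_pos[OF apos[OF t]] by (auto simp: ennreal_prod_eq_top less_imp_neq[symmetric])
    then have nt: "emeasure (wdens (v k)) (ccube x t) / emeasure lebesgue (ccube x t) \<noteq> top"
      by (auto simp: epowr_def split: if_splits)
    have "emeasure lebesgue (ccube x t) \<noteq> top"
      using emeasure_ccube_finite[of x t] by simp
    then have "emeasure (wdens (v k)) (ccube x t) \<noteq> top"
      using nt by (auto simp: ennreal_top_divide)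
    then show ?thesis by (simp add: less_top)
  qed
  define C where "C = max 1 (enn2real S)"
  have bal: "(\<Prod>k\<in>UNIV. measure (wdens (v k)) (ccube x t) powr \<theta> k) \<le> C * ((2 * t) ^ CARD('n)) powr (\<Sum>k\<in>UNIV. \<theta> k)"
    if t: "0 < t" for x t
  proof -
    define Q where "Q = (2 * t) ^ CARD('n)"
    have Q: "0 < Q" using t by (simp add: Q_def)
    define m where "m k = measure (wdens (v k)) (ccube x t)" for k
    have m0: "0 \<le> m k" for k by (simp add: m_def)
    have mE: "emeasure (wdens (v k)) (ccube x t) = ennreal (m k)" for k
      unfolding m_def using fin[OF t] by (intro emeasure_eq_ennreal_measure) (simp add: less_top)
    have QE: "emeasure lebesgue (ccube x t) = ennreal Q" using t by (simp add: emeasure_ccube Q_def)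
    have "ennreal (\<Prod>k\<in>UNIV. (m k / Q) powr \<theta> k) = (\<Prod>k\<in>UNIV. epowr (ennreal (m k) / ennreal Q) (\<theta> k))"
      using m0 Q by (simp add: prod_ennreal[symmetric] divide_ennreal epowr_def)
    also have "\<dots> \<le> S" using avg[OF t, of x] by (simp add: mE QE)
    finally have "ennreal (\<Prod>k\<in>UNIV. (m k / Q) powr \<theta> k) \<le> S" .
    then have "(\<Prod>k\<in>UNIV. (m k / Q) powr \<theta> k) \<le> enn2real S"
      using S enn2real_mono[of "ennreal (\<Prod>k\<in>UNIV. (m k / Q) powr \<theta> k)" S] by (simp add: prod_nonneg)
    also have "\<dots> \<le> C" by (simp add: C_def)
    also have "(\<Prod>k\<in>UNIV. (m k / Q) powr \<theta> k) = (\<Prod>k\<in>UNIV. m k powr \<theta> k) / Q powr (\<Sum>k\<in>UNIV. \<theta> k)"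
      using Q by (simp add: powr_divide powr_sum prod_dividef)
    finally have "(\<Prod>k\<in>UNIV. m k powr \<theta> k) \<le> C * Q powr (\<Sum>k\<in>UNIV. \<theta> k)"
      by (rule pos_divide_le_eq[THEN iffD1, rotated]) (use Q in simp)
    then show ?thesis unfolding m_def Q_def .
  qed
  have "balanced_weights v \<theta> C"
    by unfold_locales (use wt vpos th prod1 fin bal in \<open>auto simp: C_def\<close>)
  then show ?thesis unfolding v_def \<theta>_def by blast
qed

lemma Lip_sup_less_imp:
  assumes "Lip_sup \<alpha> g < ennreal L" "0 < L"
  shows "norm (g x - g y) \<le> L * norm (x - y) powr \<alpha>"
proof (cases "x = y")
  case False
  have "ennreal (norm (g (y + (x - y)) - g y) / norm (x - y) powr \<alpha>) \<le> Lip_sup \<alpha> g"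
    unfolding Lip_sup_def using False by (intro SUP_upper2[of "(y, x - y)"]) auto
  also note assms(1)
  finally have "ennreal (norm (g x - g y) / norm (x - y) powr \<alpha>) \<le> ennreal L"
    by simp
  then have "norm (g x - g y) / norm (x - y) powr \<alpha> \<le> L" using assms by (subst (asm) ennreal_le_iff) auto
  then show ?thesis using False by (simp add: field_simps)
qed simp

section \<open>The weighted setting and its scaling\<close>

locale weighted_CZ = CZ_op K CK \<gamma> M T s CT
  for K :: "('n::finite, 'm::finite) kernel" and CK \<gamma> M T s CT +
  fixes p :: "'m \<Rightarrow> real" and \<omega> :: "'m \<Rightarrow> real^'n \<Rightarrow> real" and l :: 'm and q \<alpha> CW :: real
  assumes \<alpha>: "0 < \<alpha>" and \<alpha>n: "\<alpha> < real CARD('n)" and p: "1 < p i" and q: "0 < q"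
    and exponents: "(\<Sum>i\<in>UNIV. 1 / p i) - 1 / q = \<alpha> / real CARD('n)"
    and weights: "\<omega> \<in> A_class p q"
    and balanced: "balanced_weights (all_weights p q \<omega>) (all_exponents p q) CW"
begin

abbreviation "\<mu> \<equiv> mu_weight q \<omega>"
abbreviation "\<sigma> \<equiv> dual_weight p \<omega>"

sublocale W: balanced_weights "all_weights p q \<omega>" "all_exponents p q" CW
  by (rule balanced)

lemma weights_simps:
  "all_weights p q \<omega> None = \<mu>" "all_weights p q \<omega> (Some i) = \<sigma> i"
  "all_exponents p q None = 1 / q" "all_exponents p q (Some i) = 1 - 1 / p i"
  by (simp_all add: all_weights_def all_exponents_def)

definition \<beta> :: real where "\<beta> = M - \<alpha>"

lemma \<beta>_pos: "0 < \<beta>"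
proof -
  have "real CARD('n) * 1 \<le> real CARD('n) * real CARD('m)"
    by (intro mult_left_mono) (simp_all add: Suc_leI)
  then have "real CARD('n) \<le> M" by (simp add: M mn_def mult.commute)
  then show ?thesis using \<alpha>n unfolding \<beta>_def by linarith
qed

text \<open>\<open>W.\<Theta>\<close> is the sum of 1/q and all 1/p_i', that is, m - \<alpha>/n by
  the relation between the exponents. The weight condition therefore scales like the fractional
  kernel of order \<open>\<beta>\<close>.\<close>

lemma homogeneity: "real CARD('n) * W.\<Theta> = \<beta>"
proof -
  have "W.\<Theta> = real CARD('m) - ((\<Sum>i\<in>UNIV. 1 / p i) - 1 / q)"
    by (simp add: sum_option weights_simps sum_subtractf)
  also have "\<dots> = real CARD('m) - \<alpha> / real CARD('n)" by (simp only: exponents)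
  finally show ?thesis unfolding \<beta>_def by (simp add: M mn_def field_simps)
qed

lemma \<omega>_pos: "AE x in lebesgue. 0 < \<omega> i x"
  and \<omega>_weight: "weight (\<omega> i)"
  using weights by (auto simp: A_class_def)

lemma \<sigma>_weight: "weight (\<sigma> i)" and \<mu>_weight: "weight \<mu>"
  using W.wt[of "Some i"] W.wt[of None] by (simp_all add: weights_simps)

text \<open>\<open>bal\<close> for a dyadic cube. Its side is \<open>2 * scale k\<close>, whence the
  factor \<open>2 powr \<beta>\<close>.\<close>

lemma cube_mass_balance:
  "cube_mass \<mu> x k powr (1 / q) * (\<Prod>i\<in>UNIV. cube_mass (\<sigma> i) x k powr (1 - 1 / p i)) \<le> CW * 2 powr \<beta> * scale k powr \<beta>"
proof -
  have "(\<Prod>j\<in>UNIV. measure (wdens (all_weights p q \<omega> j)) (ccube x (scale k)) powr all_exponents p q j)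
      \<le> CW * ((2 * scale k) ^ CARD('n)) powr W.\<Theta>"
    by (rule W.bal) simp
  also have "((2 * scale k) ^ CARD('n)) powr W.\<Theta> = (2 * scale k) powr \<beta>"
  proof -
    have "(u ^ CARD('n)) powr W.\<Theta> = u powr \<beta>" if "0 < u" for u :: real
      using that by (simp add: powr_realpow[symmetric] powr_powr homogeneity)
    then show ?thesis by (metis mult_pos_pos scale_pos zero_less_numeral)
  qed
  finally show ?thesis
    by (simp add: prod_option weights_simps cube_mass_def powr_mult mult.assoc)
qed

text \<open>By \<open>comm_dominated\<close> the commutator is at most a multiple of the Lipschitz
  constant times the fractional sum of the moduli, and the bound for that sum does not involve
  \<open>b\<close>.\<close>

lemma commutator_upper_bound:
  "\<exists>C>0. \<forall>b. locally_integrable b \<longrightarrow> commutator_norm s T l p q \<omega> b \<le> ennreal C * Lip_seminorm \<alpha> b"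
proof -
  obtain D0 \<rho>0 where D\<mu>: "doubling_weight D0 \<rho>0 \<mu>"
    using A_infinity_doubling[OF W.A_infinity_v[of None]] by (auto simp: weights_simps)
  have "\<forall>i. \<exists>D \<rho>. doubling_weight D \<rho> (\<sigma> i)"
    using A_infinity_doubling[OF W.A_infinity_v[of "Some _"]] by (auto simp: weights_simps)
  then obtain D \<rho> where D\<sigma>: "\<And>i. doubling_weight (D i) (\<rho> i) (\<sigma> i)" by metis
  have pq: "1 / q < (\<Sum>i\<in>UNIV. 1 / p i)" using exponents \<alpha> by (smt (verit) divide_pos_pos of_nat_0_less_iff zero_less_card_finite)
  have CA: "0 < CW * 2 powr \<beta>" using W.C by simp
  obtain Cf where Cf: "0 < Cf" and frac: "\<And>\<phi> N \<psi>. (\<forall>i. \<phi> i \<in> borel_measurable lebesgue) \<Longrightarrow> (\<forall>i x. 0 \<le> \<phi> i x) \<Longrightarrow> (\<forall>i. 0 < N i) \<Longrightarrow>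
     (\<forall>i. (\<integral>\<^sup>+x. ennreal ((\<phi> i x / \<sigma> i x) powr p i) \<partial>wdens (\<sigma> i)) \<le> ennreal (N i powr p i)) \<Longrightarrow>
     (\<forall>x. 0 \<le> \<psi> x) \<Longrightarrow> (AE x in lebesgue. ennreal (\<psi> x) \<le> frac_sum \<beta> \<phi> x) \<Longrightarrow>
     (\<integral>\<^sup>+x. ennreal (\<psi> x powr q) \<partial>wdens \<mu>) \<le> ennreal (Cf * (\<Prod>i\<in>UNIV. N i) powr q)"
    using fractional_sum_bound[OF D\<mu> D\<sigma> p q pq CA cube_mass_balance] by blast
  define cc where "cc = real CARD('m) * CK * 2 powr \<beta>"
  have cc: "0 < cc" using CK by (simp add: cc_def)
  define C where "C = cc * Cf powr (1 / q)"
  have C: "0 < C" using cc Cf by (simp add: C_def)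
  \<comment> \<open>\<open>L\<close> lies strictly above the infimum over all representatives, so
    some representative has the Lipschitz constant \<open>L\<close>, and \<open>L\<close> is
    positive.\<close>
  have main: "commutator_norm s T l p q \<omega> b \<le> ennreal (C * L)"
    if b: "locally_integrable b" and L: "Lip_seminorm \<alpha> b < ennreal L" for b L
  proof -
    have L0: "0 < L" using L by (cases "0 < L") (auto simp: ennreal_neg)
    have bm: "b \<in> borel_measurable lebesgue" by (rule locally_integrable_measurable[OF b])
    obtain g where g: "AE x in lebesgue. g x = b x" "Lip_sup \<alpha> g < ennreal L"
      using L unfolding Lip_seminorm_def INF_less_iff by auto
    interpret CZ_commutator K CK \<gamma> M T s CT b l L \<alpha> \<beta> "{x. g x = b x}"
    proof
      show "norm (b x - b y) \<le> L * norm (x - y) powr \<alpha>" if "x \<in> {x. g x = b x}" "y \<in> {x. g x = b x}" for x y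
        using Lip_sup_less_imp[OF g(2) L0, of x y] that by simp
    qed (use bm L0 \<alpha> \<beta>_pos g in \<open>auto simp: \<beta>_def\<close>)
    show ?thesis
      unfolding commutator_norm_def operator_norm_def
    proof (intro Inf_lower CollectI ballI impI)
      fix f assume f: "f \<in> commutator_domain s b l" and fL: "\<forall>i. f i \<in> Lp_space (p i) (\<lambda>x. \<omega> i x powr p i)"
      have [measurable]: "f i \<in> borel_measurable lebesgue" "\<omega> i \<in> borel_measurable lebesgue" "\<sigma> i \<in> borel_measurable lebesgue" for i
        using dom_measurable[OF f] \<omega>_weight \<sigma>_weight by (auto simp: weight_def)
      have cm[measurable]: "comm f \<in> borel_measurable lebesgue" by (rule comm_measurable[OF f])
      define n where "n i = enn2real (Lp_norm (p i) (\<lambda>x. \<omega> i x powr p i) (f i))" for i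
      have n0: "0 \<le> n i" for i by (simp add: n_def)
      have nE: "Lp_norm (p i) (\<lambda>x. \<omega> i x powr p i) (f i) = ennreal (n i)" for i
        unfolding n_def using fL by (simp add: Lp_space_def)
      have p0: "0 < p i" for i using p[of i] by simp
      have int_le: "(\<integral>\<^sup>+x. ennreal (norm (f i x) powr p i * \<omega> i x powr p i) \<partial>lebesgue) \<le> ennreal (n i powr p i)" for i
        using epowr_leD[of _ "1 / p i" "n i"] nE[of i] n0[of i] p0[of i] by (simp add: Lp_norm_def)
      \<comment> \<open>Since (p - 1) p' = p, the weight left over is \<sigma>^(1 - p) = \<omega>^p:
        the norm of |f|/\<sigma> with respect to \<sigma> dx is the given weighted norm of
        f.\<close>
      have quot: "(\<integral>\<^sup>+x. ennreal ((norm (f i x) / \<sigma> i x) powr p i) \<partial>wdens (\<sigma> i))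
          = (\<integral>\<^sup>+x. ennreal (norm (f i x) powr p i * \<omega> i x powr p i) \<partial>lebesgue)" for i
      proof (subst nn_integral_wdens[OF \<sigma>_weight])
        have "AE x in lebesgue. ennreal (\<sigma> i x) * ennreal ((norm (f i x) / \<sigma> i x) powr p i) = ennreal (norm (f i x) powr p i * \<omega> i x powr p i)"
          using \<omega>_pos[of i]
        proof eventually_elim
          fix x assume x: "0 < \<omega> i x"
          have e: "- conj_exp (p i) + conj_exp (p i) * p i = p i"
          proof -
            have "conj_exp (p i) * (p i - 1) = p i" using p[of i] by (simp add: conj_exp_def)
            then show ?thesis by (simp add: algebra_simps)
          qed
          have "\<sigma> i x * (norm (f i x) / \<sigma> i x) powr p i = norm (f i x) powr p i * (\<omega> i x powr (- conj_exp (p i)) * \<omega> i x powr (conj_exp (p i) * p i))"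
            using x by (simp add: dual_weight_def powr_divide powr_mult powr_powr powr_minus_divide)
          also have "\<dots> = norm (f i x) powr p i * \<omega> i x powr p i"
            by (simp only: powr_add[symmetric] e)
          finally show "ennreal (\<sigma> i x) * ennreal ((norm (f i x) / \<sigma> i x) powr p i) = ennreal (norm (f i x) powr p i * \<omega> i x powr p i)"
            using weight_nonneg[OF \<sigma>_weight] by (simp add: ennreal_mult'[symmetric])
        qed
        then show "(\<integral>\<^sup>+x. ennreal (\<sigma> i x) * ennreal ((norm (f i x) / \<sigma> i x) powr p i) \<partial>lebesgue)
          = (\<integral>\<^sup>+x. ennreal (norm (f i x) powr p i * \<omega> i x powr p i) \<partial>lebesgue)"
          by (rule nn_integral_cong_AE)
      qed simp
      \<comment> \<open>\<open>frac\<close> needs positive norms, but some \<open>n i\<close> may be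
        0. All of them are raised by \<open>\<epsilon>\<close>, which then tends to 0.\<close>
      have bound: "Lp_norm q \<mu> (comm f) \<le> ennreal (C * L * (\<Prod>i\<in>UNIV. n i + \<epsilon>))" if \<epsilon>: "0 < \<epsilon>" for \<epsilon>
      proof -
        define N where "N i = n i + \<epsilon>" for i
        have N: "0 < N i" for i using n0[of i] \<epsilon> by (simp add: N_def)
        define \<psi> where "\<psi> x = norm (comm f x) / (cc * L)" for x
        have \<psi>0: "0 \<le> \<psi> x" for x using cc L0 by (simp add: \<psi>_def)
        have "(\<integral>\<^sup>+x. ennreal (\<psi> x powr q) \<partial>wdens \<mu>) \<le> ennreal (Cf * (\<Prod>i\<in>UNIV. N i) powr q)"
        proof (rule frac[of "\<lambda>i x. norm (f i x)"])
          show "\<forall>i. (\<integral>\<^sup>+x. ennreal ((norm (f i x) / \<sigma> i x) powr p i) \<partial>wdens (\<sigma> i)) \<le> ennreal (N i powr p i)"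
          proof
            fix i
            have "n i powr p i \<le> N i powr p i" using n0[of i] \<epsilon> p0[of i] by (intro powr_mono2) (auto simp: N_def)
            then show "(\<integral>\<^sup>+x. ennreal ((norm (f i x) / \<sigma> i x) powr p i) \<partial>wdens (\<sigma> i)) \<le> ennreal (N i powr p i)"
              using int_le[of i] unfolding quot by (meson ennreal_leI order_trans)
          qed
          show "AE x in lebesgue. ennreal (\<psi> x) \<le> frac_sum \<beta> (\<lambda>i x. norm (f i x)) x"
            using comm_dominated[OF f]
          proof eventually_elim
            fix x
            have ne: "ennreal (cc * L) \<noteq> 0" using cc L0 by simp
            assume "ennreal (norm (comm f x)) \<le> ennreal (real CARD('m) * CK * L * 2 powr \<beta>) * frac_sum \<beta> (\<lambda>i y. norm (f i y)) x"
            moreover have "real CARD('m) * CK * L * 2 powr \<beta> = cc * L" by (simp add: cc_def)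
            moreover have "ennreal (norm (comm f x)) = ennreal (cc * L) * ennreal (\<psi> x)"
              using cc L0 by (simp add: \<psi>_def ennreal_mult'[symmetric])
            ultimately have "ennreal (cc * L) * ennreal (\<psi> x) \<le> ennreal (cc * L) * frac_sum \<beta> (\<lambda>i y. norm (f i y)) x"
              by simp
            then show "ennreal (\<psi> x) \<le> frac_sum \<beta> (\<lambda>i x. norm (f i x)) x"
              by (rule ennreal_mult_le_mult_iff[THEN iffD1, OF ne, rotated]) simp
          qed
        qed (use N \<psi>0 in auto)
        then have le1: "(\<integral>\<^sup>+x. ennreal (\<psi> x powr q) \<partial>wdens \<mu>) \<le> ennreal (Cf * (\<Prod>i\<in>UNIV. N i) powr q)" .
        have [measurable]: "\<mu> \<in> borel_measurable lebesgue" using \<mu>_weight by (simp add: weight_def)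
        have [measurable]: "\<psi> \<in> borel_measurable lebesgue" unfolding \<psi>_def by measurable
        have "(\<integral>\<^sup>+x. ennreal (norm (comm f x) powr q * \<mu> x) \<partial>lebesgue)
            = (\<integral>\<^sup>+x. ennreal ((cc * L) powr q) * (ennreal (\<mu> x) * ennreal (\<psi> x powr q)) \<partial>lebesgue)"
        proof (rule nn_integral_cong)
          fix x
          have "norm (comm f x) = cc * L * \<psi> x" using cc L0 by (simp add: \<psi>_def)
          then have "norm (comm f x) powr q * \<mu> x = (cc * L) powr q * (\<mu> x * \<psi> x powr q)"
            by (simp add: powr_mult mult_ac)
          then show "ennreal (norm (comm f x) powr q * \<mu> x) = ennreal ((cc * L) powr q) * (ennreal (\<mu> x) * ennreal (\<psi> x powr q))"
            using weight_nonneg[OF \<mu>_weight, of x] by (simp only: ennreal_mult powr_ge_zero mult_nonneg_nonneg)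
        qed
        also have "\<dots> = ennreal ((cc * L) powr q) * (\<integral>\<^sup>+x. ennreal (\<psi> x powr q) \<partial>wdens \<mu>)"
          by (subst nn_integral_cmult) (auto simp: nn_integral_wdens[OF \<mu>_weight])
        also have "\<dots> \<le> ennreal ((cc * L) powr q) * ennreal (Cf * (\<Prod>i\<in>UNIV. N i) powr q)"
          by (intro mult_left_mono le1) auto
        also have "\<dots> = ennreal ((cc * L) powr q * (Cf * (\<Prod>i\<in>UNIV. N i) powr q))"
          by (simp add: ennreal_mult')
        finally have "Lp_norm q \<mu> (comm f) \<le> ennreal (((cc * L) powr q * (Cf * (\<Prod>i\<in>UNIV. N i) powr q)) powr (1 / q))"
          unfolding Lp_norm_def using q Cf by (intro epowr_le) auto
        also have "((cc * L) powr q * (Cf * (\<Prod>i\<in>UNIV. N i) powr q)) powr (1 / q) = C * L * (\<Prod>i\<in>UNIV. N i)"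
        proof -
          have "0 < (\<Prod>i\<in>UNIV. N i)" using N by (simp add: prod_pos)
          then show ?thesis using q cc L0 by (simp add: powr_mult powr_powr C_def mult_ac)
        qed
        finally show ?thesis by (simp add: N_def)
      qed
      have lim: "((\<lambda>\<epsilon>. ennreal (C * L * (\<Prod>i\<in>UNIV. n i + \<epsilon>))) \<longlongrightarrow> ennreal (C * L * (\<Prod>i\<in>UNIV. n i + 0))) (at_right 0)"
        by (intro tendsto_ennrealI tendsto_intros)
      have "Lp_norm q \<mu> (comm f) \<le> ennreal (C * L * (\<Prod>i\<in>UNIV. n i + 0))"
        by (rule tendsto_lowerbound[OF lim])
           (use bound in \<open>auto intro: eventually_mono[OF eventually_at_right_less]\<close>)
      also have "\<dots> = ennreal (C * L) * (\<Prod>i\<in>UNIV. Lp_norm (p i) (\<lambda>x. \<omega> i x powr p i) (f i))"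
        using C L0 n0 by (simp add: nE ennreal_mult' prod_ennreal)
      finally show "Lp_norm q \<mu> (comm f) \<le> ennreal (C * L) * (\<Prod>i\<in>UNIV. Lp_norm (p i) (\<lambda>x. \<omega> i x powr p i) (f i))" .
    qed
  qed
  show ?thesis
  proof (intro exI[of _ C] conjI allI impI C)
    fix b :: "real^'n \<Rightarrow> complex" assume b: "locally_integrable b"
    show "commutator_norm s T l p q \<omega> b \<le> ennreal C * Lip_seminorm \<alpha> b"
    proof (cases "Lip_seminorm \<alpha> b")
      case (real a)
      have eps: "commutator_norm s T l p q \<omega> b \<le> ennreal (C * a) + ennreal \<epsilon>" if \<epsilon>: "0 < \<epsilon>" for \<epsilon>
      proof -
        have "commutator_norm s T l p q \<omega> b \<le> ennreal (C * (a + \<epsilon> / C))"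
          by (rule main[OF b]) (use real \<epsilon> C in \<open>simp add: ennreal_lessI\<close>)
        also have "C * (a + \<epsilon> / C) = C * a + \<epsilon>" using C by (simp add: field_simps)
        finally show ?thesis using real C \<epsilon> by simp
      qed
      have "commutator_norm s T l p q \<omega> b \<le> ennreal (C * a)"
        by (rule ennreal_le_epsilon, rule eps)
      then show ?thesis using real C by (simp add: ennreal_mult)
    qed (use C in \<open>simp add: ennreal_mult_top\<close>)
  qed
qed

end

section \<open>Hoelder continuity from oscillations in measure\<close>

definition exceed :: "(real^'n::finite \<Rightarrow> complex) \<Rightarrow> real^'n \<Rightarrow> real \<Rightarrow> complex \<Rightarrow> real \<Rightarrow> (real^'n) set" where
  "exceed b x t c \<tau> = {y \<in> ccube x t. \<tau> < norm (b y - c)}"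

lemma exceed_sets:
  assumes [measurable]: "b \<in> borel_measurable lebesgue"
  shows "exceed b x t c \<tau> \<in> sets lebesgue"
proof -
  have "{y \<in> space lebesgue. y \<in> ccube x t \<and> \<tau> < norm (b y - c)} \<in> sets lebesgue" by measurable
  then show ?thesis by (simp add: exceed_def)
qed

lemma exceed_lmeasurable: "b \<in> borel_measurable lebesgue \<Longrightarrow> exceed b x t c \<tau> \<in> lmeasurable"
  by (rule fmeasurableI2[OF ccube_lmeasurable _ exceed_sets]) (auto simp: exceed_def)

lemma exceed_mono: 
  assumes "b \<in> borel_measurable lebesgue" "\<tau> \<le> \<tau>'"
  shows "measure lebesgue (exceed b x t c \<tau>') \<le> measure lebesgue (exceed b x t c \<tau>)"
  by (rule measure_mono_fmeasurable) (use assms exceed_lmeasurable exceed_sets in \<open>auto simp: exceed_def\<close>)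

text \<open>If the two exceptional sets are too small to cover the inner cube, then at some point
  \<open>b\<close> is close to both constants at once.\<close>

lemma exceed_compare:
  fixes x x' :: "real^'n::finite"
  assumes b: "b \<in> borel_measurable lebesgue" and sub: "ccube x' t' \<subseteq> ccube x t" and t': "0 < t'"
    and le: "measure lebesgue (exceed b x t c \<tau>) + measure lebesgue (exceed b x' t' c' \<tau>') < (2 * t') ^ CARD('n)"
  shows "norm (c - c') \<le> \<tau> + \<tau>'"
proof (rule ccontr)
  assume no: "\<not> norm (c - c') \<le> \<tau> + \<tau>'"
  have "ccube x' t' \<subseteq> exceed b x t c \<tau> \<union> exceed b x' t' c' \<tau>'"
  proof
    fix y assume y: "y \<in> ccube x' t'"
    have "norm (c - c') \<le> norm (b y - c) + norm (b y - c')"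
      using norm_triangle_ineq4[of "b y - c'" "b y - c"] by (simp add: algebra_simps)
    then have "\<tau> < norm (b y - c) \<or> \<tau>' < norm (b y - c')" using no by linarith
    then show "y \<in> exceed b x t c \<tau> \<union> exceed b x' t' c' \<tau>'" using y sub by (auto simp: exceed_def)
  qed
  then have "measure lebesgue (ccube x' t') \<le> measure lebesgue (exceed b x t c \<tau> \<union> exceed b x' t' c' \<tau>')"
    by (intro measure_mono_fmeasurable fmeasurable.Un exceed_lmeasurable b) auto
  also have "\<dots> \<le> measure lebesgue (exceed b x t c \<tau>) + measure lebesgue (exceed b x' t' c' \<tau>')"
    by (intro measure_Un_le exceed_sets b)
  also have "\<dots> < measure lebesgue (ccube x' t')" using le t' by (simp add: measure_ccube)
  finally show False by simp
qed

text \<open>The solution C of 2 + C 2^(-\<alpha>) = C: twice the sum of the geometric series that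
  arises from repeated halving.\<close>

definition osc_const :: "real \<Rightarrow> real" where
  "osc_const \<alpha> = 2 / (1 - 2 powr (- \<alpha>))"

lemma osc_const: "0 < \<alpha> \<Longrightarrow> 2 + osc_const \<alpha> * 2 powr (- \<alpha>) = osc_const \<alpha>" "0 < \<alpha> \<Longrightarrow> 2 \<le> osc_const \<alpha>"
proof -
  assume \<alpha>: "0 < \<alpha>"
  have less: "2 powr (- \<alpha>) < (1::real)" using \<alpha> by (simp add: powr_less_one)
  then show "2 + osc_const \<alpha> * 2 powr (- \<alpha>) = osc_const \<alpha>"
  proof -
    have "2 + 2 / (1 - u) * u = 2 / (1 - u)" if "u < 1" for u :: real
      using that by (simp add: field_simps)
    from this[OF less] show ?thesis by (simp add: osc_const_def)
  qed
  have "2 \<le> 2 / (1 - u)" if "0 \<le> u" "u < 1" for u :: real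
    using that by (simp add: field_simps)
  from this[OF _ less] show "2 \<le> osc_const \<alpha>" by (simp add: osc_const_def)
qed

text \<open>The condition on \<open>\<eta>0\<close> ensures that the exceptional sets of two cubes
  whose sides differ by a factor of at most 4 cannot cover the smaller one. The constants
  \<open>c x t\<close> are arbitrary choices; nothing relates different cubes beforehand.\<close>

locale measure_oscillation =
  fixes b :: "real^'n::finite \<Rightarrow> complex" and \<alpha> M \<eta>0 :: real and c :: "real^'n \<Rightarrow> real \<Rightarrow> complex"
  assumes b: "b \<in> borel_measurable lebesgue" and \<alpha>: "0 < \<alpha>" and M: "0 < M" and \<eta>0: "0 < \<eta>0" "\<eta>0 * (4 ^ CARD('n) + 1) < 1"
    and osc: "0 < t \<Longrightarrow> measure lebesgue (exceed b x t (c x t) (M * t powr \<alpha>)) \<le> \<eta>0 * (2 * t) ^ CARD('n)"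
begin

lemma centre_step:
  assumes t: "0 < t'" "t \<le> 4 * t'" "t' \<le> t" and sub: "ccube x' t' \<subseteq> ccube x t"
  shows "norm (c x t - c x' t') \<le> 2 * M * t powr \<alpha>"
proof -
  have "norm (c x t - c x' t') \<le> M * t powr \<alpha> + M * t' powr \<alpha>"
  proof (rule exceed_compare[OF b sub t(1)])
    have p: "(2 * t) ^ CARD('n) \<le> 4 ^ CARD('n) * (2 * t') ^ CARD('n)"
    proof -
      have "(2 * t) ^ CARD('n) \<le> (4 * (2 * t')) ^ CARD('n)" using t by (intro power_mono) auto
      then show ?thesis by (simp only: power_mult_distrib)
    qed
    have "measure lebesgue (exceed b x t (c x t) (M * t powr \<alpha>)) + measure lebesgue (exceed b x' t' (c x' t') (M * t' powr \<alpha>))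
        \<le> \<eta>0 * (2 * t) ^ CARD('n) + \<eta>0 * (2 * t') ^ CARD('n)"
      using t by (intro add_mono osc) auto
    also have "\<dots> \<le> \<eta>0 * (4 ^ CARD('n) * (2 * t') ^ CARD('n)) + \<eta>0 * (2 * t') ^ CARD('n)"
      using p \<eta>0 by (intro add_mono mult_left_mono) auto
    also have "\<dots> = \<eta>0 * (4 ^ CARD('n) + 1) * (2 * t') ^ CARD('n)" by (simp only: distrib_left distrib_right mult.assoc mult_1 mult_1_right)
    also have "\<dots> < 1 * (2 * t') ^ CARD('n)" using \<eta>0 t by (intro mult_strict_right_mono) auto
    finally show "measure lebesgue (exceed b x t (c x t) (M * t powr \<alpha>)) + measure lebesgue (exceed b x' t' (c x' t') (M * t' powr \<alpha>)) < (2 * t') ^ CARD('n)"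
      by simp
  qed
  also have "\<dots> \<le> M * t powr \<alpha> + M * t powr \<alpha>"
    using M t \<alpha> by (intro add_left_mono mult_left_mono powr_mono2) auto
  finally show ?thesis by simp
qed

text \<open>Halve the cube until its size is within a factor 2 of \<open>t'\<close>. The steps cost
  powers of geometrically decreasing sizes, which sum up because \<open>\<alpha>\<close> is
  positive.\<close>

lemma centre_chain:
  assumes "0 < t'" "t' \<le> t"
  shows "norm (c x t - c x t') \<le> osc_const \<alpha> * M * t powr \<alpha>"
proof -
  have *: "norm (c x t - c x t') \<le> osc_const \<alpha> * M * t powr \<alpha>" if "t / 2 ^ k \<le> t'" "0 < t'" "t' \<le> t" for k t
    using that
  proof (induction k arbitrary: t)
    case 0
    then have "t = t'" by simp
    then show ?case using osc_const(2)[OF \<alpha>] M by simp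
  next
    case (Suc k)
    show ?case
    proof (cases "t / 2 \<le> t'")
      case True
      have "norm (c x t - c x t') \<le> 2 * M * t powr \<alpha>"
        using Suc True ccube_mono[of t' t x] by (intro centre_step) auto
      also have "\<dots> \<le> osc_const \<alpha> * M * t powr \<alpha>"
        using osc_const(2)[OF \<alpha>] M by (intro mult_right_mono) auto
      finally show ?thesis .
    next
      case False
      have 1: "norm (c x t - c x (t / 2)) \<le> 2 * M * t powr \<alpha>"
        using Suc False ccube_mono[of "t / 2" t x] by (intro centre_step) auto
      have 2: "norm (c x (t / 2) - c x t') \<le> osc_const \<alpha> * M * (t / 2) powr \<alpha>"
        using Suc False by (intro Suc.IH) auto
      have "norm (c x t - c x t') \<le> 2 * M * t powr \<alpha> + osc_const \<alpha> * M * (t / 2) powr \<alpha>"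
        by (rule norm_diff_triangle_le[OF 1 2])
      also have "\<dots> = (2 + osc_const \<alpha> * 2 powr (- \<alpha>)) * M * t powr \<alpha>"
        by (simp add: powr_divide powr_minus_divide algebra_simps)
      also have "\<dots> = osc_const \<alpha> * M * t powr \<alpha>" by (simp only: osc_const(1)[OF \<alpha>])
      finally show ?thesis .
    qed
  qed
  obtain k where "t / t' < 2 ^ k" using real_arch_pow[of 2 "t / t'"] by auto
  then have "t / 2 ^ k \<le> t'" using assms by (simp add: field_simps)
  then show ?thesis using * assms by blast
qed

text \<open>The candidate for the continuous representative. \<open>lim\<close> is meaningful only
  once \<open>centre_limit\<close> has shown convergence; the estimate there also makes the choice
  of radii immaterial.\<close>

definition g :: "real^'n \<Rightarrow> complex" where
  "g x = lim (\<lambda>j. c x (1 / real (Suc j)))"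

lemma centre_limit:
  assumes t: "0 < t"
  shows "norm (c x t - g x) \<le> osc_const \<alpha> * M * t powr \<alpha>"
proof -
  have l0: "(\<lambda>j. 1 / real (Suc j)) \<longlonglongrightarrow> 0"
    using LIMSEQ_inverse_real_of_nat by (simp add: inverse_eq_divide)
  have "(\<lambda>j. (1 / real (Suc j)) powr \<alpha>) \<longlonglongrightarrow> 0"
    by (rule tendsto_zero_powrI[OF l0 tendsto_const _ \<alpha>]) auto
  then have "(\<lambda>j. osc_const \<alpha> * M * (1 / real (Suc j)) powr \<alpha>) \<longlonglongrightarrow> 0"
    by (rule tendsto_mult_right_zero)
  then have small: "\<exists>N. \<forall>j\<ge>N. osc_const \<alpha> * M * (1 / real (Suc j)) powr \<alpha> < e" if "0 < e" for e
    using order_tendstoD(2)[of _ 0 sequentially e] that by (simp add: eventually_sequentially)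
  have "Cauchy (\<lambda>j. c x (1 / real (Suc j)))"
  proof (rule CauchyI')
    fix e :: real assume "0 < e"
    from small[OF this] obtain N where N: "\<And>j. N \<le> j \<Longrightarrow> osc_const \<alpha> * M * (1 / real (Suc j)) powr \<alpha> < e" by blast
    have "dist (c x (1 / real (Suc i))) (c x (1 / real (Suc j))) < e" if "N \<le> i" "i < j" for i j
    proof -
      have "norm (c x (1 / real (Suc i)) - c x (1 / real (Suc j))) \<le> osc_const \<alpha> * M * (1 / real (Suc i)) powr \<alpha>"
        using that by (intro centre_chain) (auto simp: field_simps)
      then show ?thesis using N[OF that(1)] by (simp add: dist_norm)
    qed
    then show "\<exists>N. \<forall>m\<ge>N. \<forall>n>m. dist (c x (1 / real (Suc m))) (c x (1 / real (Suc n))) < e" by blast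
  qed
  then have conv: "(\<lambda>j. c x (1 / real (Suc j))) \<longlonglongrightarrow> g x"
    unfolding g_def by (simp add: Cauchy_convergent convergent_LIMSEQ_iff[symmetric])
  have lim: "(\<lambda>j. norm (c x t - c x (1 / real (Suc j)))) \<longlonglongrightarrow> norm (c x t - g x)"
    by (intro tendsto_intros conv)
  have "\<forall>\<^sub>F j in sequentially. 1 / real (Suc j) < t" using order_tendstoD(2)[OF l0 t] .
  then have "\<forall>\<^sub>F j in sequentially. norm (c x t - c x (1 / real (Suc j))) \<le> osc_const \<alpha> * M * t powr \<alpha>"
    by eventually_elim (auto intro: centre_chain)
  then show ?thesis by (intro tendsto_upperbound[OF lim]) auto
qed

text \<open>The cubes of half-side \<open>t\<close> around \<open>x\<close> and \<open>y\<close>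
  both lie in \<open>ccube x (2 * t)\<close>. The two comparisons with this cube give the summand
  \<open>4 * 2 powr \<alpha>\<close>.\<close>

lemma g_near_centre:
  assumes t: "0 < t" and y: "y \<in> ccube x t"
  shows "norm (g y - c x t) \<le> (osc_const \<alpha> + 4 * 2 powr \<alpha>) * M * t powr \<alpha>"
proof -
  have s: "ccube y t \<subseteq> ccube x (2 * t)" using ccube_subset[OF y, of t] by simp
  have "norm (c y t - g y) \<le> osc_const \<alpha> * M * t powr \<alpha>" by (rule centre_limit[OF t])
  moreover have "norm (c x (2 * t) - c y t) \<le> 2 * M * (2 * t) powr \<alpha>"
    using t s by (intro centre_step) auto
  moreover have "norm (c x (2 * t) - c x t) \<le> 2 * M * (2 * t) powr \<alpha>"
    using t ccube_mono[of t "2 * t" x] by (intro centre_step) auto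
  moreover have "norm (g y - c x t) \<le> norm (c y t - g y) + norm (c x (2 * t) - c y t) + norm (c x (2 * t) - c x t)"
  proof -
    have "norm (g y - c x t) = norm ((c x (2 * t) - c x t) - ((c y t - g y) + (c x (2 * t) - c y t)))" by simp
    also have "\<dots> \<le> norm (c x (2 * t) - c x t) + norm ((c y t - g y) + (c x (2 * t) - c y t))"
      by (rule norm_triangle_ineq4)
    also have "\<dots> \<le> norm (c x (2 * t) - c x t) + (norm (c y t - g y) + norm (c x (2 * t) - c y t))"
      by (intro add_left_mono norm_triangle_ineq)
    finally show ?thesis by simp
  qed
  ultimately have "norm (g y - c x t) \<le> osc_const \<alpha> * M * t powr \<alpha> + 2 * (2 * M * (2 * t) powr \<alpha>)" by linarith
  also have "\<dots> = (osc_const \<alpha> + 4 * 2 powr \<alpha>) * M * t powr \<alpha>" by (simp add: powr_mult algebra_simps)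
  finally show ?thesis .
qed

lemma g_Hoelder: "norm (g x - g y) \<le> (2 * osc_const \<alpha> + 4 * 2 powr \<alpha>) * M * norm (x - y) powr \<alpha>"
proof (cases "x = y")
  case False
  define d where "d = norm (x - y)"
  have d: "0 < d" using False by (simp add: d_def)
  have y: "y \<in> ccube x d" by (rule norm_le_imp_ccube) (simp add: d_def norm_minus_commute)
  have "norm (g x - g y) \<le> norm (c x d - g x) + norm (g y - c x d)"
    using norm_triangle_ineq[of "g x - c x d" "c x d - g y"] by (simp add: norm_minus_commute)
  also have "\<dots> \<le> osc_const \<alpha> * M * d powr \<alpha> + (osc_const \<alpha> + 4 * 2 powr \<alpha>) * M * d powr \<alpha>"
    by (intro add_mono centre_limit g_near_centre d y)
  finally show ?thesis by (simp add: d_def algebra_simps)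
qed simp

text \<open>One fixed proportion \<open>\<eta>0\<close> determines \<open>g\<close> but leaves
  \<open>b\<close> free on a part of each cube. If every proportion is available, the set where
  \<open>b\<close> and \<open>g\<close> differ by more than \<open>\<delta>\<close> has density 0 at
  all points and is negligible. \<open>M'\<close> may depend on \<open>\<eta>\<close>, since it is
  multiplied by a vanishing power of the size.\<close>

lemma g_eq_b:
  assumes all: "\<And>\<eta>. 0 < \<eta> \<Longrightarrow> \<exists>M'. \<forall>x. \<forall>t>0. \<exists>c'. measure lebesgue (exceed b x t c' (M' * t powr \<alpha>)) \<le> \<eta> * (2 * t) ^ CARD('n)"
  shows "AE x in lebesgue. g x = b x"
proof -
  have neg: "negligible {x. \<delta> < norm (b x - g x)}" if \<delta>: "0 < \<delta>" for \<delta>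
    unfolding negligible_eq_zero_density
  proof (intro ballI allI impI)
    fix x and r e :: real
    assume r: "0 < r" and e: "0 < e"
    \<comment> \<open>The cube of half-side \<open>d / (2 * CARD('n))\<close> fits into
      \<open>ball x d\<close>, and \<open>\<kappa>\<close> is its share of the volume of
      \<open>ccube x d\<close>. This converts proportions of cubes into proportions of
      balls.\<close>
    define \<kappa> where "\<kappa> = (1 / (2 * real CARD('n))) ^ CARD('n)"
    have \<kappa>: "0 < \<kappa>" by (simp add: \<kappa>_def)
    define \<eta> where "\<eta> = min (1 / 2) (e * \<kappa> / 2)"
    have \<eta>: "0 < \<eta>" "\<eta> \<le> 1 / 2" "\<eta> < e * \<kappa>" using e \<kappa> by (auto simp: \<eta>_def min_less_iff_disj)
    obtain M' where M': "\<And>x t. 0 < t \<Longrightarrow> \<exists>c'. measure lebesgue (exceed b x t c' (M' * t powr \<alpha>)) \<le> \<eta> * (2 * t) ^ CARD('n)"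
      using all[OF \<eta>(1)] by blast
    \<comment> \<open>The sum of the three errors on the way from \<open>b y\<close> through
      \<open>c'\<close> and \<open>c x d\<close> to \<open>g y\<close>, per unit of
      \<open>d powr \<alpha>\<close>; the absolute value is there because the sign of
      \<open>M'\<close> is unknown.\<close>
    define Kt where "Kt = (osc_const \<alpha> + 4 * 2 powr \<alpha>) * M + M + 2 * \<bar>M'\<bar>"
    have Kt: "0 < Kt" using M osc_const(2)[OF \<alpha>] unfolding Kt_def by (intro add_pos_nonneg add_nonneg_pos mult_nonneg_nonneg) auto
    define d where "d = min r ((\<delta> / Kt) powr (1 / \<alpha>))"
    have d: "0 < d" "d \<le> r" using r \<delta> Kt by (auto simp: d_def)
    have "d powr \<alpha> \<le> ((\<delta> / Kt) powr (1 / \<alpha>)) powr \<alpha>" using d \<alpha> by (intro powr_mono2) (auto simp: d_def)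
    also have "\<dots> = \<delta> / Kt" using \<delta> Kt \<alpha> by (simp add: powr_powr)
    finally have Kd: "Kt * d powr \<alpha> \<le> \<delta>" using Kt by (simp add: field_simps)
    obtain c' where c': "measure lebesgue (exceed b x d c' (M' * d powr \<alpha>)) \<le> \<eta> * (2 * d) ^ CARD('n)"
      using M'[OF d(1)] by blast
    \<comment> \<open>Both exceptional sets belong to the same cube. Each takes at most half of it,
      and the one for \<open>c x d\<close> strictly less, so some point escapes both.\<close>
    have cc: "norm (c x d - c') \<le> M * d powr \<alpha> + M' * d powr \<alpha>"
    proof (rule exceed_compare[OF b subset_refl d(1)])
      have "(5::real) \<le> 4 ^ CARD('n) + 1" using self_le_power[of "4::real" "CARD('n)"] by simp
      then have "\<eta>0 * 5 \<le> \<eta>0 * (4 ^ CARD('n) + 1)" using \<eta>0(1) by (intro mult_left_mono) auto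
      then have e0: "\<eta>0 < 1 / 2" using \<eta>0 by linarith
      have "measure lebesgue (exceed b x d (c x d) (M * d powr \<alpha>)) + measure lebesgue (exceed b x d c' (M' * d powr \<alpha>))
          \<le> \<eta>0 * (2 * d) ^ CARD('n) + \<eta> * (2 * d) ^ CARD('n)"
        by (intro add_mono osc d c')
      also have "\<dots> = (\<eta>0 + \<eta>) * (2 * d) ^ CARD('n)" by (simp only: distrib_right)
      also have "\<dots> < 1 * (2 * d) ^ CARD('n)" using e0 \<eta> d by (intro mult_strict_right_mono) auto
      finally show "measure lebesgue (exceed b x d (c x d) (M * d powr \<alpha>)) + measure lebesgue (exceed b x d c' (M' * d powr \<alpha>)) < (2 * d) ^ CARD('n)"
        by simp
    qed
    have sub: "{x. \<delta> < norm (b x - g x)} \<inter> ball x d \<subseteq> exceed b x d c' (M' * d powr \<alpha>)"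
    proof
      fix y assume y: "y \<in> {x. \<delta> < norm (b x - g x)} \<inter> ball x d"
      then have yc: "y \<in> ccube x d" by (intro norm_le_imp_ccube) (auto simp: dist_norm norm_minus_commute)
      have "M' * d powr \<alpha> < norm (b y - c')"
      proof (rule ccontr)
        assume "\<not> M' * d powr \<alpha> < norm (b y - c')"
        moreover have "norm (b y - g y) \<le> norm (b y - c') + norm (c x d - c') + norm (g y - c x d)"
        proof -
          have "norm (b y - g y) = norm ((b y - c') - ((c x d - c') + (g y - c x d)))" by simp
          also have "\<dots> \<le> norm (b y - c') + norm ((c x d - c') + (g y - c x d))"
            by (rule norm_triangle_ineq4)
          also have "\<dots> \<le> norm (b y - c') + (norm (c x d - c') + norm (g y - c x d))"
            by (intro add_left_mono norm_triangle_ineq)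
          finally show ?thesis by simp
        qed
        moreover note cc g_near_centre[OF d(1) yc]
        ultimately have "norm (b y - g y) \<le> M' * d powr \<alpha> + (M * d powr \<alpha> + M' * d powr \<alpha>) + (osc_const \<alpha> + 4 * 2 powr \<alpha>) * M * d powr \<alpha>"
          by linarith
        also have "\<dots> = ((osc_const \<alpha> + 4 * 2 powr \<alpha>) * M + M + 2 * M') * d powr \<alpha>" by (simp add: algebra_simps)
        also have "\<dots> \<le> Kt * d powr \<alpha>" unfolding Kt_def by (intro mult_right_mono) auto
        also note Kd
        finally show False using y by simp
      qed
      then show "y \<in> exceed b x d c' (M' * d powr \<alpha>)" using yc by (simp add: exceed_def)
    qed
    have "measure lebesgue (exceed b x d c' (M' * d powr \<alpha>)) < e * measure lebesgue (ball x d)"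
    proof -
      define u where "u = d / (2 * real CARD('n))"
      have u: "0 < u" using d by (simp add: u_def)
      have "ccube x u \<subseteq> ball x d"
      proof
        fix y assume "y \<in> ccube x u"
        then have "norm (y - x) \<le> real CARD('n) * u" by (rule ccube_norm_le)
        also have "\<dots> = d / 2" by (simp add: u_def)
        finally show "y \<in> ball x d" using d by (simp add: dist_norm norm_minus_commute)
      qed
      then have "measure lebesgue (ccube x u) \<le> measure lebesgue (ball x d)"
        by (intro measure_mono_fmeasurable) auto
      moreover have "measure lebesgue (ccube x u) = \<kappa> * (2 * d) ^ CARD('n)"
      proof -
        have "2 * u = 1 / (2 * real CARD('n)) * (2 * d)" by (simp add: u_def)
        then show ?thesis using u by (simp only: measure_ccube less_imp_le \<kappa>_def power_mult_distrib)
      qed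
      ultimately have "e * (\<kappa> * (2 * d) ^ CARD('n)) \<le> e * measure lebesgue (ball x d)"
        using e by (intro mult_left_mono) auto
      moreover have "\<eta> * (2 * d) ^ CARD('n) < e * \<kappa> * (2 * d) ^ CARD('n)"
        using \<eta> d by (intro mult_strict_right_mono) auto
      ultimately show ?thesis using c' by (simp only: mult.assoc)
    qed
    then show "\<exists>d>0. d \<le> r \<and> (\<exists>U. {x. \<delta> < norm (b x - g x)} \<inter> ball x d \<subseteq> U \<and> U \<in> lmeasurable \<and>
        measure lebesgue U < e * measure lebesgue (ball x d))"
      using d sub exceed_lmeasurable[OF b] by blast
  qed
  have "{x. g x \<noteq> b x} = (\<Union>j::nat. {x. 1 / real (Suc j) < norm (b x - g x)})"
  proof (intro equalityI subsetI)
    fix x assume "x \<in> {x. g x \<noteq> b x}"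
    then have "0 < norm (b x - g x)" by auto
    then obtain j :: nat where "inverse (real (Suc j)) < norm (b x - g x)" using reals_Archimedean by blast
    then show "x \<in> (\<Union>j::nat. {x. 1 / real (Suc j) < norm (b x - g x)})" by (auto simp: inverse_eq_divide)
  next
    fix x assume "x \<in> (\<Union>j::nat. {x. 1 / real (Suc j) < norm (b x - g x)})"
    then obtain j :: nat where "1 / real (Suc j) < norm (b x - g x)" by auto
    then have "0 < norm (b x - g x)" by (rule less_trans[rotated]) simp
    then show "x \<in> {x. g x \<noteq> b x}" by auto
  qed
  then have "negligible {x. g x \<noteq> b x}"
    by (simp only:) (intro negligible_Union_nat neg, simp)
  then have "{x. g x \<noteq> b x} \<in> null_sets lebesgue" by (simp add: negligible_iff_null_sets)
  then show ?thesis by (intro AE_I') auto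
qed

end

lemma Lip_seminorm_le:
  fixes b g :: "'a::euclidean_space \<Rightarrow> complex"
  assumes "AE x in lebesgue. g x = b x" "\<And>x y. norm (g x - g y) \<le> L * norm (x - y) powr \<alpha>"
  shows "Lip_seminorm \<alpha> b \<le> ennreal L"
proof -
  have "Lip_seminorm \<alpha> b \<le> Lip_sup \<alpha> g"
    unfolding Lip_seminorm_def using assms(1) by (intro INF_lower) auto
  also have "\<dots> \<le> ennreal L"
    unfolding Lip_sup_def
  proof (intro SUP_least, clarify)
    fix x h :: 'a assume h: "h \<noteq> 0"
    have "norm (g (x + h) - g x) \<le> L * norm h powr \<alpha>" using assms(2)[of "x + h" x] by simp
    then show "ennreal (norm (g (x + h) - g x) / norm h powr \<alpha>) \<le> ennreal L"
      using h by (intro ennreal_leI) (simp add: field_simps)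
  qed
  finally show ?thesis .
qed

section \<open>The lower bound\<close>

text \<open>Continuity from above on a set of finite measure. It supplies the truncation levels of
  the dual weights and the first, uncontrolled, oscillation bound for \<open>b\<close>.\<close>

lemma measure_superlevel_small:
  fixes u :: "'a::euclidean_space \<Rightarrow> real"
  assumes u[measurable]: "u \<in> borel_measurable lebesgue" and Q: "Q \<in> lmeasurable" and e: "0 < e"
  shows "\<exists>k>0. measure lebesgue {y \<in> Q. k < u y} \<le> e"
proof -
  have Qs[measurable]: "Q \<in> sets lebesgue" using Q by blast
  define A where "A j = {y \<in> Q. real (Suc j) < u y}" for j
  have As: "A j \<in> sets lebesgue" for j
  proof -
    have "{y \<in> space lebesgue. y \<in> Q \<and> real (Suc j) < u y} \<in> sets lebesgue" by measurable
    then show ?thesis by (simp add: A_def)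
  qed
  have AQ: "A j \<subseteq> Q" for j by (auto simp: A_def)
  have Af: "A j \<in> lmeasurable" for j by (rule fmeasurableI2[OF Q AQ As])
  have fin: "emeasure lebesgue (A j) \<noteq> \<infinity>" for j using Af[of j] by (auto simp: fmeasurable_def)
  have "(\<lambda>j. emeasure lebesgue (A j)) \<longlonglongrightarrow> emeasure lebesgue (\<Inter>j. A j)"
  proof (rule Lim_emeasure_decseq)
    show "decseq A" by (auto simp: decseq_def A_def)
  qed (use As fin in auto)
  also have "(\<Inter>j. A j) = {}"
  proof (intro equals0I)
    fix y assume "y \<in> (\<Inter>j. A j)"
    then have "real (Suc j) < u y" for j by (auto simp: A_def)
    moreover obtain j :: nat where "u y \<le> real j" using real_arch_simple by blast
    ultimately show False by (metis less_le_trans less_irrefl of_nat_Suc add.commute less_add_one order_less_trans)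
  qed
  finally have "(\<lambda>j. emeasure lebesgue (A j)) \<longlonglongrightarrow> 0" by simp
  then have "\<forall>\<^sub>F j in sequentially. emeasure lebesgue (A j) < ennreal e"
    using e by (intro order_tendstoD(2)) auto
  then obtain j where j: "emeasure lebesgue (A j) < ennreal e"
    by (auto simp: eventually_sequentially)
  then have "measure lebesgue (A j) \<le> e" using e unfolding measure_def by (intro enn2real_leI) auto
  then show ?thesis by (intro exI[of _ "real (Suc j)"]) (simp add: A_def)
qed

section \<open>Distant cubes on which the kernel is nearly constant\<close>

context CZ_kernel_bounds
begin

text \<open>Homogeneity with \<open>A = 1\<close> gives |K| at least c (N t)^(-M) at the centres.
  Regularity bounds the change of K over the cubes by the same power times a constant multiple of
  N^(-\<gamma>), which is below an eighth of the former for large N.\<close>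

lemma homogeneous_kernel_pairs:
  assumes hom: "mn_homogeneous K"
  shows "\<exists>N c. 6 * real CARD('n) \<le> N \<and> 0 < c \<and> (\<forall>t>0. \<forall>x0 x0'. norm (x0 - x0') = N * t \<longrightarrow>
     c * (N * t) powr (- M) \<le> norm (K x0 (\<chi> i. x0')) \<and>
     (\<forall>x\<in>ccube x0 t. \<forall>y. (\<forall>i. y $ i \<in> ccube x0' t) \<longrightarrow>
        norm (K x y - K x0 (\<chi> i. x0')) \<le> norm (K x0 (\<chi> i. x0')) / 8))"
proof -
  have "\<exists>C>0. \<exists>N0. \<forall>N\<ge>N0. \<forall>r>0. \<forall>y0 y.
     (\<forall>k. N * r / 1 \<le> norm (y0 - y $ k) \<and> norm (y0 - y $ k) \<le> 1 * N * r) \<longrightarrow>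
     (\<forall>x0 x. x0 \<in> ball y0 r \<and> (\<forall>k. x $ k \<in> ball (y $ k) r) \<longrightarrow>
        C * (N * r) powr (- M) \<le> norm (K x0 x))"
    using hom unfolding mn_homogeneous_def M by (elim allE[of _ 1]) simp
  then obtain c N0 where c: "0 < c" and raw: "\<forall>N\<ge>N0. \<forall>r>0. \<forall>y0 y.
     (\<forall>k. N * r / 1 \<le> norm (y0 - y $ k) \<and> norm (y0 - y $ k) \<le> 1 * N * r) \<longrightarrow>
     (\<forall>x0 x. x0 \<in> ball y0 r \<and> (\<forall>k. x $ k \<in> ball (y $ k) r) \<longrightarrow>
        c * (N * r) powr (- M) \<le> norm (K x0 x))"
    by blast
  have low: "c * (N * r) powr (- M) \<le> norm (K y0 y)"
    if "N0 \<le> N" "0 < r" "\<forall>k. norm (y0 - y $ k) = N * r" for N r y0 y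
    using raw[rule_format, OF that(1,2), of y0 y y0 y] that by simp
  define n where "n = real CARD('n)"
  have n: "1 \<le> n" by (simp add: n_def Suc_leI)
  define cK where "cK = (real CARD('m) + 1) * CK * 2 powr M"
  have cK: "0 < cK" using CK by (simp add: cK_def)
  \<comment> \<open>The solution N of \<open>cK * (2 * n / N) powr \<gamma> = c / 8\<close>. The
    other lower bound \<open>6 * n\<close> for \<open>N\<close> is what
    \<open>kernel_oscillation\<close> needs for cubes of norm radius \<open>n * t\<close>.\<close>
  define N1 where "N1 = 2 * n * (8 * cK / c) powr (1 / \<gamma>)"
  have N1: "0 < N1" using n cK c by (simp add: N1_def)
  define N where "N = max N0 (max (6 * n) N1)"
  have N: "N0 \<le> N" "6 * n \<le> N" "N1 \<le> N" by (auto simp: N_def)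
  have Np: "0 < N" using N n by linarith
  have small: "cK * (2 * n / N) powr \<gamma> \<le> c / 8"
  proof -
    have "(2 * n / N) powr \<gamma> \<le> (2 * n / N1) powr \<gamma>"
      using N N1 n Np \<gamma> by (intro powr_mono2 divide_left_mono) auto
    also have "\<dots> = ((8 * cK / c) powr (- (1 / \<gamma>))) powr \<gamma>"
      using n by (simp add: N1_def powr_minus_divide)
    also have "\<dots> = (8 * cK / c) powr (- 1)" unfolding powr_powr using \<gamma> by simp
    also have "\<dots> = c / (8 * cK)"
      using c cK by (simp add: powr_minus_divide)
    finally have "cK * (2 * n / N) powr \<gamma> \<le> cK * (c / (8 * cK))" using cK by (intro mult_left_mono) auto
    then show ?thesis using cK by simp
  qed
  have l: "c * (N * t) powr (- M) \<le> norm (K x0 (\<chi> i. x0'))"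
    if "0 < t" "norm (x0 - x0') = N * t" for t and x0 x0' :: "real^'n"
    by (rule low[OF N(1) that(1)]) (simp add: that)
  have osc: "norm (K x y - K x0 (\<chi> i. x0')) \<le> norm (K x0 (\<chi> i. x0')) / 8"
    if t: "0 < t" and d: "norm (x0 - x0') = N * t" and x: "x \<in> ccube x0 t" and y: "\<forall>i. y $ i \<in> ccube x0' t"
    for t and x0 x0' x :: "real^'n" and y :: "(real^'n)^'m"
  proof -
    have md: "max_dist x0 ((\<chi> i. x0') :: (real^'n)^'m) = N * t"
      unfolding max_dist_def using d by simp
    have "norm (K x0 (\<chi> i. x0') - K x y) \<le> (real CARD('m) + 1) * CK * (n * t) powr \<gamma> * (max_dist x0 ((\<chi> i. x0') :: (real^'n)^'m) / 2) powr (- M - \<gamma>)"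
    proof (rule kernel_oscillation)
      show "norm (x0 - x) \<le> n * t" using ccube_norm_le[OF x] by (simp add: n_def norm_minus_commute)
      show "norm ((\<chi> i. x0') $ i - y $ i) \<le> n * t" for i
        using ccube_norm_le[of "y $ i" x0' t] y by (simp add: n_def norm_minus_commute)
      show "6 * (n * t) \<le> max_dist x0 ((\<chi> i. x0') :: (real^'n)^'m)"
        unfolding md using N t by (simp add: mult.assoc[symmetric])
      show "0 < max_dist x0 ((\<chi> i. x0') :: (real^'n)^'m)" unfolding md using Np t by simp
    qed
    also have "\<dots> = cK * (2 * n / N) powr \<gamma> * (N * t) powr (- M)"
    proof -
      have "(n * t) powr \<gamma> * (N * t / 2) powr (- M - \<gamma>) = (n * t / (N * t / 2)) powr \<gamma> * (N * t / 2) powr (- M)"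
      proof -
        have "a powr \<gamma> * b powr (- M - \<gamma>) = (a / b) powr \<gamma> * b powr (- M)" for a b :: real
          by (simp add: powr_diff powr_divide)
        then show ?thesis .
      qed
      also have "n * t / (N * t / 2) = 2 * n / N" using t Np by (simp add: field_simps)
      also have "(N * t / 2) powr (- M) = 2 powr M * (N * t) powr (- M)"
        by (simp add: powr_divide powr_minus_divide)
      finally show ?thesis unfolding md cK_def by (simp only: mult_ac)
    qed
    also have "\<dots> \<le> c / 8 * (N * t) powr (- M)" by (intro mult_right_mono small) auto
    also have "\<dots> \<le> norm (K x0 (\<chi> i. x0')) / 8" using l[OF t d] by simp
    finally show ?thesis by (simp add: norm_minus_commute)
  qed
  show ?thesis
    by (intro exI[of _ N] exI[of _ c] conjI allI impI ballI)
       (use N(2) c l osc in \<open>simp_all add: n_def\<close>)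
qed

end

section \<open>Testing the commutator on pairs of distant cubes\<close>

context weighted_CZ
begin

definition comm_bounded :: "(real^'n \<Rightarrow> complex) \<Rightarrow> real \<Rightarrow> bool" where
  "comm_bounded b C \<longleftrightarrow> (\<forall>f\<in>commutator_domain s b l. (\<forall>i. f i \<in> Lp_space (p i) (\<lambda>x. \<omega> i x powr p i)) \<longrightarrow>
     Lp_norm q \<mu> (commutator b T l f) \<le> ennreal C * (\<Prod>i\<in>UNIV. Lp_norm (p i) (\<lambda>x. \<omega> i x powr p i) (f i)))"

text \<open>The reason for testing with \<sigma>: restricted to a set, its p-th power integral
  against \<omega>^p equals its plain integral, the \<sigma>-mass of the set.\<close>

lemma \<sigma>_power: "\<sigma> i y powr p i * \<omega> i y powr p i = \<sigma> i y"
proof -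
  have "conj_exp (p i) * (p i - 1) = p i" using p[of i] by (simp add: conj_exp_def)
  then have e: "- conj_exp (p i) * p i + p i = - conj_exp (p i)" by (simp add: algebra_simps)
  have "\<sigma> i y powr p i * \<omega> i y powr p i = \<omega> i y powr (- conj_exp (p i) * p i + p i)"
    by (simp only: dual_weight_def powr_powr powr_add)
  then show ?thesis unfolding e by (simp add: dual_weight_def)
qed

text \<open>
  Testing the commutator on truncations of the dual weights, supported where \<open>b\<close> is within \<open>\<tau>\<close> of
  a constant. The kernel is nearly constant on the two cubes, so the commutator at \<open>z\<close> is
  essentially \<open>b z\<close> minus the weighted mean of \<open>b\<close> over the support; the error \<open>\<tau> / 2\<close> is absorbed
  afterwards by exchanging the two cubes.
\<close>

lemma oscillation_step:
  assumes N: "6 * real CARD('n) \<le> N" and ch: "0 < ch" and \<eta>: "0 < \<eta>" "\<eta> \<le> 1 / 4"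
    and kern: "\<And>t x0 x0'. 0 < t \<Longrightarrow> norm (x0 - x0') = N * t \<Longrightarrow> ch * (N * t) powr (- M) \<le> norm (K x0 (\<chi> i. x0'))"
      "\<And>t x0 x0' x y. 0 < t \<Longrightarrow> norm (x0 - x0') = N * t \<Longrightarrow> x \<in> ccube x0 t \<Longrightarrow> (\<forall>i. y $ i \<in> ccube x0' t) \<Longrightarrow>
        norm (K x y - K x0 (\<chi> i. x0')) \<le> norm (K x0 (\<chi> i. x0')) / 8"
  shows "\<exists>C>0. \<forall>b C' t x0 x0' c' \<tau>. b \<in> borel_measurable lebesgue \<longrightarrow> 0 < C' \<longrightarrow> comm_bounded b C' \<longrightarrow> 0 < t \<longrightarrow>
     norm (x0 - x0') = N * t \<longrightarrow> 0 \<le> \<tau> \<longrightarrow> measure lebesgue (exceed b x0' t c' \<tau>) \<le> \<eta> * (2 * t) ^ CARD('n) \<longrightarrow>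
     (\<exists>c. measure lebesgue (exceed b x0 t c (C * C' * t powr \<alpha> + \<tau> / 2)) \<le> \<eta> * (2 * t) ^ CARD('n))"
proof -
  have "1 \<le> real CARD('n)" by (simp add: Suc_leI)
  then have Np: "0 < N" using N by linarith
  \<comment> \<open>A set that fills a proportion \<open>\<eta>\<close> of a cube of half-side t
    fills the proportion \<open>\<eta>1\<close> of a cube of half-side \<open>(N + 1) * t\<close>,
    which contains both cubes of the pair.\<close>
  define \<eta>1 where "\<eta>1 = \<eta> / (N + 1) ^ CARD('n)"
  have \<eta>1: "0 < \<eta>1" using \<eta> Np by (simp add: \<eta>1_def)
  obtain c1 where c1: "0 < c1" and raw: "\<forall>x R (F :: 'm option \<Rightarrow> (real^'n) set). 0 < R \<longrightarrow> (\<forall>k. F k \<in> sets lebesgue \<and>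
      F k \<subseteq> ccube x R \<and> \<eta>1 * (2 * R) ^ CARD('n) \<le> measure lebesgue (F k)) \<longrightarrow>
      c1 * ((2 * R) ^ CARD('n)) powr W.\<Theta> \<le> (\<Prod>k\<in>UNIV. W.vm k (F k) powr all_exponents p q k)"
    using W.prod_lower_bound[OF \<eta>1] by (elim exE conjE)
  have low: "c1 * ((2 * R) ^ CARD('n)) powr W.\<Theta> \<le> (\<Prod>k\<in>UNIV. W.vm k (F k) powr all_exponents p q k)"
    if "0 < R" "\<And>k. F k \<in> sets lebesgue" "\<And>k. F k \<subseteq> ccube x R"
      "\<And>k. \<eta>1 * (2 * R) ^ CARD('n) \<le> measure lebesgue (F k)" for x R and F :: "'m option \<Rightarrow> (real^'n) set"
    using raw[rule_format, of R F x] that by simp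
  \<comment> \<open>What remains of the final estimate once all powers of \<open>t\<close> have
    cancelled. \<open>C = 2 / \<kappa>2\<close> then yields \<open>2 * C' \<le> C'\<close>, the
    contradiction.\<close>
  define \<kappa>2 where "\<kappa>2 = ch * c1 * N powr (- M) * (2 * (N + 1)) powr \<beta> / 2"
  have \<kappa>2: "0 < \<kappa>2" using ch c1 Np by (simp add: \<kappa>2_def)
  define C where "C = 2 / \<kappa>2"
  show ?thesis
  proof (intro exI[of _ C] conjI allI impI)
    show "0 < C" using \<kappa>2 by (simp add: C_def)
    fix b C' t x0 x0' c' \<tau>
    assume b[measurable]: "b \<in> borel_measurable lebesgue" and C': "0 < C'" and cb: "comm_bounded b C'" and t: "0 < t"
      and dist: "norm (x0 - x0') = N * t" and \<tau>: "0 \<le> (\<tau>::real)"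
      and ex: "measure lebesgue (exceed b x0' t c' \<tau>) \<le> \<eta> * (2 * t) ^ CARD('n)"
    define V where "V = (2 * t) ^ CARD('n)"
    have V: "0 < V" using t by (simp add: V_def)
    define Q' where "Q' = ccube x0' t"
    have Q's[measurable]: "Q' \<in> sets lebesgue" and Q'm: "measure lebesgue Q' = V" and Q'l: "Q' \<in> lmeasurable"
      using t by (simp_all add: Q'_def measure_ccube V_def ccube_lmeasurable)
    have [measurable]: "\<sigma> i \<in> borel_measurable lebesgue" "\<omega> i \<in> borel_measurable lebesgue" "\<mu> \<in> borel_measurable lebesgue" for i
      using \<sigma>_weight \<omega>_weight \<mu>_weight by (auto simp: weight_def)
    have \<sigma>0: "0 \<le> \<sigma> i y" for i y using weight_nonneg[OF \<sigma>_weight] .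
    \<comment> \<open>Truncated at \<open>k i\<close>, the dual weights are bounded and hence belong
      to the unweighted spaces on which \<open>T\<close> is defined. Truncation and the exceptional
      set of \<open>b\<close> cost at most \<open>V / 4\<close> each, so half of the cube is
      left.\<close>
    have "\<forall>i. \<exists>k>0. measure lebesgue {y \<in> Q'. k < \<sigma> i y} \<le> V / 4"
      using measure_superlevel_small[OF _ Q'l, of "\<sigma> _" "V / 4"] V by auto
    then obtain k where k: "\<And>i. 0 < k i" and km: "\<And>i. measure lebesgue {y \<in> Q'. k i < \<sigma> i y} \<le> V / 4"
      by metis
    \<comment> \<open>Only the argument in slot \<open>l\<close> is multiplied by \<open>b\<close>,
      so only there the exceptional set of \<open>b\<close> has to be avoided.\<close>
    define G where "G i = Q' - {y \<in> Q'. k i < \<sigma> i y} - (if i = l then exceed b x0' t c' \<tau> else {})" for i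
    have sup_sets: "{y \<in> Q'. k i < \<sigma> i y} \<in> sets lebesgue" for i
    proof -
      have "{y \<in> space lebesgue. y \<in> Q' \<and> k i < \<sigma> i y} \<in> sets lebesgue" by measurable
      then show ?thesis by simp
    qed
    have Gs[measurable]: "G i \<in> sets lebesgue" for i
      unfolding G_def using sup_sets[of i] exceed_sets[OF b] Q's by auto
    have GQ: "G i \<subseteq> Q'" for i by (auto simp: G_def)
    have Gm: "V / 2 \<le> measure lebesgue (G i)" for i
    proof -
      have cov: "Q' \<subseteq> G i \<union> ({y \<in> Q'. k i < \<sigma> i y} \<union> exceed b x0' t c' \<tau>)" by (auto simp: G_def)
      have lm: "G i \<in> lmeasurable" "{y \<in> Q'. k i < \<sigma> i y} \<in> lmeasurable" "exceed b x0' t c' \<tau> \<in> lmeasurable"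
        using fmeasurableI2[OF Q'l GQ Gs] fmeasurableI2[OF Q'l _ sup_sets] exceed_lmeasurable[OF b] by auto
      have "measure lebesgue Q' \<le> measure lebesgue (G i \<union> ({y \<in> Q'. k i < \<sigma> i y} \<union> exceed b x0' t c' \<tau>))"
        using cov lm by (intro measure_mono_fmeasurable fmeasurable.Un) auto
      also have "\<dots> \<le> measure lebesgue (G i) + (measure lebesgue {y \<in> Q'. k i < \<sigma> i y} + measure lebesgue (exceed b x0' t c' \<tau>))"
        using lm by (intro order_trans[OF measure_Un_le] add_left_mono measure_Un_le) auto
      also have "\<dots> \<le> measure lebesgue (G i) + (V / 4 + V / 4)"
      proof -
        have "\<eta> * V \<le> 1 / 4 * V" using \<eta>(2) V by (intro mult_right_mono) auto
        then have "measure lebesgue (exceed b x0' t c' \<tau>) \<le> V / 4" using ex[folded V_def] by linarith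
        then show ?thesis using km[of i] by (intro add_left_mono add_mono)
      qed
      finally show ?thesis using Q'm by simp
    qed
    have Gb: "norm (b y - c') \<le> \<tau>" if "y \<in> G l" for y
      using that by (auto simp: G_def exceed_def Q'_def)
    define f where "f i y = complex_of_real (if y \<in> G i then \<sigma> i y else 0)" for i y
    have fm[measurable]: "f i \<in> borel_measurable lebesgue" for i unfolding f_def by measurable
    have fnorm: "norm (f i y) = (if y \<in> G i then \<sigma> i y else 0)" for i y
      using \<sigma>0[of i y] by (simp add: f_def)
    have f_le: "norm (f i y) \<le> k i" for i y
      unfolding fnorm using k[of i] by (auto simp: G_def not_less)
    have f_supp: "y \<in> Q'" if "f i y \<noteq> 0" for i y
      using that GQ[of i] by (auto simp: f_def split: if_splits)
    obtain R0 where R0: "\<And>y. y \<in> Q' \<Longrightarrow> norm y \<le> R0"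
      using bounded_ccube[of x0' t] unfolding bounded_iff Q'_def by blast
    have f_out: "f i y = 0" if "R0 < norm y" for i y using that R0[of y] f_supp[of i y] by fastforce
    have si: "0 < s i" for i using s1[of i] by simp
    have f_Lp: "f i \<in> Lp_space (s i) (\<lambda>_. 1)" for i
      by (rule Lp_space_bounded_support[OF fm f_le f_out si])
    have u_Lp: "(\<lambda>y. (b y - c) * f l y) \<in> Lp_space (s l) (\<lambda>_. 1)" for c
    proof (rule Lp_space_bounded_support[OF _ _ _ si])
      show "(\<lambda>y. (b y - c) * f l y) \<in> borel_measurable lebesgue" by measurable
      show "norm ((b y - c) * f l y) \<le> (\<tau> + norm (c' - c)) * k l" for y
      proof (cases "y \<in> G l")
        case True
        have "norm (b y - c) \<le> norm (b y - c') + norm (c' - c)" using norm_triangle_ineq[of "b y - c'" "c' - c"] by simp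
        then have "norm (b y - c) \<le> \<tau> + norm (c' - c)" using Gb[OF True] by linarith
        then show ?thesis unfolding norm_mult using f_le[of l y] \<tau> by (intro mult_mono) auto
      next
        case False
        then show ?thesis using k[of l] \<tau> by (simp add: f_def)
      qed
      show "(b y - c) * f l y = 0" if "R0 < norm y" for y using f_out[OF that] by simp
    qed
    have fT: "f \<in> Lp_tuples s" using f_Lp by (simp add: Lp_tuples_def)
    have bfT: "f(l := \<lambda>z. b z * f l z) \<in> Lp_tuples s"
      using Lp_tuples_upd[OF fT u_Lp[of 0]] by simp
    have dom: "f \<in> commutator_domain s b l" using fT bfT by (simp add: commutator_domain_def)
    define S where "S i = measure (wdens (\<sigma> i)) (G i)" for i
    have GE: "emeasure (wdens (\<sigma> i)) (G i) = ennreal (S i)" for i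
      using W.vm_emeasure[of "G i" x0' t "Some i"] GQ[of i] t by (simp add: S_def weights_simps Q'_def)
    have Sp: "0 < S i" for i
      using W.vm_pos[of "G i" x0' t "Some i"] GQ[of i] t Gm[of i] V by (simp add: S_def weights_simps Q'_def)
    have fint: "(\<integral>\<^sup>+y. ennreal (norm (f i y)) \<partial>lebesgue) = ennreal (S i)" for i
    proof -
      have "(\<integral>\<^sup>+y. ennreal (norm (f i y)) \<partial>lebesgue) = (\<integral>\<^sup>+y\<in>G i. ennreal (\<sigma> i y) \<partial>lebesgue)"
        by (intro nn_integral_cong) (auto simp: fnorm split: split_indicator)
      then show ?thesis using GE[of i] by (simp add: emeasure_wdens[OF \<sigma>_weight])
    qed
    have f_integrable: "integrable lebesgue (f i)" for i
      by (rule integrableI_bounded) (auto simp: fint)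
    have norm_int: "(LINT y|lebesgue. norm (f i y)) = S i" for i
      using fint[of i] Sp[of i] by (subst integral_eq_nn_integral) auto
    have f_int: "(LINT y|lebesgue. f i y) = complex_of_real (S i)" for i
    proof -
      have "f i y = complex_of_real (norm (f i y))" for y unfolding fnorm by (simp add: f_def)
      then have "(LINT y|lebesgue. f i y) = (LINT y|lebesgue. complex_of_real (norm (f i y)))" by metis
      then show ?thesis by (simp add: norm_int)
    qed
    have Lp_f: "Lp_norm (p i) (\<lambda>x. \<omega> i x powr p i) (f i) = ennreal (S i powr (1 / p i))" for i
    proof -
      have "(\<integral>\<^sup>+x. ennreal (norm (f i x) powr p i * \<omega> i x powr p i) \<partial>lebesgue) = (\<integral>\<^sup>+x. ennreal (norm (f i x)) \<partial>lebesgue)"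
        by (intro nn_integral_cong) (auto simp: fnorm \<sigma>_power)
      then show ?thesis using Sp[of i] by (simp add: Lp_norm_def fint epowr_def)
    qed
    have f_Lpw: "f i \<in> Lp_space (p i) (\<lambda>x. \<omega> i x powr p i)" for i
      using fm by (simp add: Lp_space_def Lp_f)
    define P where "P = (\<Prod>i\<in>UNIV. S i)"
    have P: "0 < P" unfolding P_def using Sp by (simp add: prod_pos)
    define K0 where "K0 = K x0 (\<chi> i. x0')"
    define \<kappa> where "\<kappa> = norm K0"
    have \<kappa>: "ch * (N * t) powr (- M) \<le> \<kappa>" unfolding \<kappa>_def K0_def by (rule kern(1)[OF t dist])
    have \<kappa>p: "0 < \<kappa>" using \<kappa> ch Np t by (smt (verit) mult_pos_pos powr_gt_zero)
    \<comment> \<open>The \<sigma>-weighted mean of \<open>b\<close> over \<open>G l\<close>. It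
      makes the integral of \<open>u\<close> vanish, so that a constant kernel would annihilate
      \<open>T g\<close>.\<close>
    define c where "c = (LINT y|lebesgue. b y * f l y) / complex_of_real (S l)"
    define u where "u y = (b y - c) * f l y" for y
    have um[measurable]: "u \<in> borel_measurable lebesgue" unfolding u_def by measurable
    have bint: "integrable lebesgue (\<lambda>y. (b y - a) * f l y)" for a
    proof (rule Bochner_Integration.integrable_bound[of _ "\<lambda>y. (\<tau> + norm (c' - a)) * norm (f l y)"])
      show "AE y in lebesgue. norm ((b y - a) * f l y) \<le> norm ((\<tau> + norm (c' - a)) * norm (f l y))"
      proof (rule AE_I2)
        fix y
        show "norm ((b y - a) * f l y) \<le> norm ((\<tau> + norm (c' - a)) * norm (f l y))"
        proof (cases "y \<in> G l")
          case True
          have "norm (b y - a) \<le> norm (b y - c') + norm (c' - a)" using norm_triangle_ineq[of "b y - c'" "c' - a"] by simp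
          then have "norm (b y - a) \<le> \<tau> + norm (c' - a)" using Gb[OF True] by linarith
          then show ?thesis using \<tau> by (simp add: norm_mult abs_mult mult_right_mono)
        qed (simp add: f_def)
      qed
    qed (use f_integrable in auto)
    have cc': "norm (c' - c) \<le> \<tau>"
    proof -
      have "(LINT y|lebesgue. (b y - c') * f l y) = (LINT y|lebesgue. b y * f l y) - c' * complex_of_real (S l)"
        using bint[of 0] f_integrable[of l] by (simp add: left_diff_distrib f_int)
      also have "\<dots> = (c - c') * complex_of_real (S l)"
        using Sp[of l] by (simp add: c_def left_diff_distrib)
      finally have "norm (c - c') * S l = norm (LINT y|lebesgue. (b y - c') * f l y)"
        using Sp[of l] by (simp add: norm_mult)
      also have "\<dots> \<le> (LINT y|lebesgue. \<tau> * norm (f l y))"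
      proof (rule Bochner_Integration.integral_norm_bound_integral[OF bint])
        show "norm ((b y - c') * f l y) \<le> \<tau> * norm (f l y)" for y
          using Gb[of y] by (cases "y \<in> G l") (auto simp: norm_mult mult_right_mono f_def)
      qed (use f_integrable in auto)
      also have "\<dots> = \<tau> * S l" by (simp add: norm_int)
      finally show ?thesis using Sp[of l] by (simp add: norm_minus_commute)
    qed
    have u_le: "norm (u y) \<le> 2 * \<tau> * norm (f l y)" for y
    proof (cases "y \<in> G l")
      case True
      have "norm (b y - c) \<le> norm (b y - c') + norm (c' - c)" using norm_triangle_ineq[of "b y - c'" "c' - c"] by simp
      then have "norm (b y - c) \<le> 2 * \<tau>" using Gb[OF True] cc' by linarith
      then show ?thesis by (simp add: u_def norm_mult mult_right_mono)
    qed (simp add: u_def f_def)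
    have u_integrable: "integrable lebesgue u" unfolding u_def by (rule bint)
    have u_int: "(LINT y|lebesgue. u y) = 0"
      unfolding u_def using bint[of 0] f_integrable[of l] Sp[of l]
      by (simp add: left_diff_distrib f_int c_def)
    have u_norm_int: "(LINT y|lebesgue. norm (u y)) \<le> 2 * \<tau> * S l"
    proof -
      have "(LINT y|lebesgue. norm (u y)) \<le> (LINT y|lebesgue. 2 * \<tau> * norm (f l y))"
        by (intro integral_mono) (use u_integrable f_integrable u_le in auto)
      then show ?thesis by (simp add: norm_int)
    qed
    define g where "g = f(l := u)"
    have gT: "g \<in> Lp_tuples s" unfolding g_def u_def by (rule Lp_tuples_upd[OF fT u_Lp])
    have g_integrable: "integrable lebesgue (g i)" for i
      using f_integrable u_integrable by (simp add: g_def)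
    \<comment> \<open>The commutator becomes \<open>(b z - c) * T f z - T g z\<close>, where
      \<open>g\<close> has the mean-zero function \<open>u\<close> in slot \<open>l\<close>.\<close>
    have add: "AE x in lebesgue. T (f(l := \<lambda>z. b z * f l z)) x = c * T f x + T g x"
    proof -
      have cL: "(\<lambda>y. c * f l y) \<in> Lp_space (s l) (\<lambda>_. 1)"
        by (rule cmult_Lp_space(1)[OF f_Lp[of l], where c = "norm c"]) (use si in \<open>auto simp: norm_mult\<close>)
      define g2 where "g2 = f(l := \<lambda>y. c * f l y)"
      have g2T: "g2 \<in> Lp_tuples s" unfolding g2_def by (rule Lp_tuples_upd[OF fT cL])
      have e: "g2(l := \<lambda>y. g2 l y + u y) = f(l := \<lambda>z. b z * f l z)" by (auto simp: g2_def u_def algebra_simps)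
      have e1: "g2(l := u) = g" by (auto simp: g2_def g_def)
      have uL: "u \<in> Lp_space (s l) (\<lambda>_. 1)" using u_Lp[of c] by (simp add: u_def[abs_def])
      show ?thesis
        using T_add[OF g2T uL] T_scale[OF fT, of l c]
        unfolding e e1 by eventually_elim (simp add: g2_def)
    qed
    have Km: "K z \<in> borel_measurable lebesgue" for z
      by (rule measurable_completion) (simp add: kernel_measurable)
    \<comment> \<open>The centres are at distance at least \<open>6 * CARD('n) * t\<close>, while
      each cube has norm radius at most \<open>CARD('n) * t\<close>. So \<open>z\<close> stays off
      the closed cube \<open>Q'\<close>, and the kernel represents \<open>T\<close>.\<close>
    have off: "z \<notin> (\<Inter>i. closure {y. h i y \<noteq> 0})" if z: "z \<in> ccube x0 t" and h: "\<And>i y. h i y \<noteq> 0 \<Longrightarrow> y \<in> Q'" for z and h :: "'m \<Rightarrow> real^'n \<Rightarrow> complex"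
    proof
      assume "z \<in> (\<Inter>i. closure {y. h i y \<noteq> 0})"
      then have "z \<in> closure {y. h l y \<noteq> 0}" by blast
      moreover have "closure {y. h l y \<noteq> 0} \<subseteq> Q'"
        using h unfolding Q'_def by (intro closure_minimal closed_ccube) auto
      ultimately have "norm (z - x0') \<le> real CARD('n) * t" unfolding Q'_def using ccube_norm_le by blast
      moreover have "norm (z - x0) \<le> real CARD('n) * t" by (rule ccube_norm_le[OF z])
      moreover have "norm (x0 - x0') \<le> norm (z - x0') + norm (z - x0)"
        using norm_triangle_ineq4[of "z - x0'" "z - x0"] by simp
      ultimately have "N * t \<le> (2 * real CARD('n)) * t" using dist by simp
      then have "N \<le> 2 * real CARD('n)" using t by simp
      then show False using N \<open>1 \<le> real CARD('n)\<close> by linarith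
    qed
    define F where "F = exceed b x0 t c (C * C' * t powr \<alpha> + \<tau> / 2)"
    define A where "A = C * C' * t powr \<alpha>"
    have A: "0 < A" using \<kappa>2 C' t by (simp add: A_def C_def)
    have large: "AE z in lebesgue. z \<in> F \<longrightarrow> A * \<kappa> * P / 2 \<le> norm (commutator b T l f z)"
      using T_repr[OF fT] T_repr[OF gT] add
    proof eventually_elim
      fix z
      assume r1: "z \<notin> (\<Inter>i. closure {z. f i z \<noteq> 0}) \<longrightarrow> T f z = (LINT y|lebesgue. K z y * (\<Prod>i\<in>UNIV. f i (y $ i)))"
        and r2: "z \<notin> (\<Inter>i. closure {z. g i z \<noteq> 0}) \<longrightarrow> T g z = (LINT y|lebesgue. K z y * (\<Prod>i\<in>UNIV. g i (y $ i)))"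
        and r3: "T (f(l := \<lambda>z. b z * f l z)) z = c * T f z + T g z"
      show "z \<in> F \<longrightarrow> A * \<kappa> * P / 2 \<le> norm (commutator b T l f z)"
      proof
        assume zF: "z \<in> F"
        then have z: "z \<in> ccube x0 t" and bz: "A + \<tau> / 2 < norm (b z - c)" by (auto simp: F_def exceed_def A_def)
        have g_supp: "y \<in> Q'" if "g i y \<noteq> 0" for i y
          using that f_supp by (auto simp: g_def u_def split: if_splits)
        have Tf: "T f z = (LINT y|lebesgue. K z y * (\<Prod>i\<in>UNIV. f i (y $ i)))"
          using r1 off[of z f] z f_supp by blast
        have Tg: "T g z = (LINT y|lebesgue. K z y * (\<Prod>i\<in>UNIV. g i (y $ i)))"
          using r2 off[of z g] z g_supp by blast
        have near: "norm (K z y - K0) \<le> \<kappa> / 8" if "\<forall>i. y $ i \<in> Q'" for y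
          unfolding K0_def \<kappa>_def using that by (intro kern(2)[OF t dist z]) (simp add: Q'_def)
        have nearf: "norm (K z y - K0) \<le> \<kappa> / 8" if "\<forall>i. f i (y $ i) \<noteq> 0" for y
          by (rule near) (use f_supp that in blast)
        have nearg: "norm (K z y - K0) \<le> \<kappa> / 8" if "\<forall>i. g i (y $ i) \<noteq> 0" for y
          by (rule near) (use g_supp that in blast)
        have "norm (T f z - K0 * (\<Prod>i\<in>UNIV. (LINT x|lebesgue. f i x))) \<le> \<kappa> / 8 * (\<Prod>i\<in>UNIV. (LINT x|lebesgue. norm (f i x)))"
          unfolding Tf by (rule integral_near_constant_kernel[OF Km f_integrable nearf]) (use \<kappa>p in simp_all)
        then have 1: "norm (T f z - K0 * complex_of_real P) \<le> \<kappa> / 8 * P"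
          by (simp add: f_int norm_int P_def)
        have "norm (K0 * complex_of_real P) \<le> norm (T f z) + norm (T f z - K0 * complex_of_real P)"
          using norm_triangle_ineq4[of "T f z" "T f z - K0 * complex_of_real P"] by simp
        then have Tf_ge: "7 / 8 * \<kappa> * P \<le> norm (T f z)" using 1 P by (simp add: norm_mult \<kappa>_def)
        have "norm (T g z - K0 * (\<Prod>i\<in>UNIV. (LINT x|lebesgue. g i x))) \<le> \<kappa> / 8 * (\<Prod>i\<in>UNIV. (LINT x|lebesgue. norm (g i x)))"
          unfolding Tg by (rule integral_near_constant_kernel[OF Km g_integrable nearg]) (use \<kappa>p in simp_all)
        moreover have "(\<Prod>i\<in>UNIV. (LINT x|lebesgue. g i x)) = 0"
          using u_int by (intro prod_zero bexI[of _ l]) (auto simp: g_def)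
        moreover have "(\<Prod>i\<in>UNIV. (LINT x|lebesgue. norm (g i x))) \<le> 2 * \<tau> * P"
        proof -
          have "(\<Prod>i\<in>UNIV. (LINT x|lebesgue. norm (g i x))) = (LINT x|lebesgue. norm (u x)) * (\<Prod>i\<in>UNIV - {l}. S i)"
            by (subst prod.remove[of UNIV l]) (auto simp: g_def norm_int intro!: prod.cong)
          also have "\<dots> \<le> 2 * \<tau> * S l * (\<Prod>i\<in>UNIV - {l}. S i)"
            using u_norm_int Sp by (intro mult_right_mono prod_nonneg) (auto simp: less_imp_le)
          also have "\<dots> = 2 * \<tau> * P" unfolding P_def by (subst prod.remove[of UNIV l]) auto
          finally show ?thesis .
        qed
        ultimately have "norm (T g z) \<le> \<kappa> / 8 * (2 * \<tau> * P)"
          using \<kappa>p by (smt (verit) mult_left_mono mult_zero_right diff_zero divide_nonneg_nonneg)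
        then have Tg_le: "norm (T g z) \<le> \<tau> / 4 * \<kappa> * P" by (simp add: mult_ac)
        have "commutator b T l f z = (b z - c) * T f z - T g z"
          unfolding commutator_def r3 by (simp add: algebra_simps)
        then have "norm (b z - c) * norm (T f z) \<le> norm (commutator b T l f z) + norm (T g z)"
          using norm_triangle_ineq[of "commutator b T l f z" "T g z"] by (simp add: norm_mult)
        moreover have "(A + \<tau> / 2) * (7 / 8 * \<kappa> * P) \<le> norm (b z - c) * norm (T f z)"
          using bz Tf_ge A \<tau> \<kappa>p P by (intro mult_mono) auto
        \<comment> \<open>The kernel error of one eighth leaves 7/8 in the main term and 1/4 in
          front of \<open>\<tau>\<close> in the error term. Since 7/16 exceeds 1/4, all of
          \<open>\<tau>\<close> is absorbed, and more than half of \<open>A\<close> remains.\<close>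
        ultimately have "(A + \<tau> / 2) * (7 / 8 * \<kappa> * P) - \<tau> / 4 * \<kappa> * P \<le> norm (commutator b T l f z)"
          using Tg_le by linarith
        moreover have "(A + \<tau> / 2) * (7 / 8 * \<kappa> * P) - \<tau> / 4 * \<kappa> * P = A * \<kappa> * P / 2 + (3 / 8 * A + 3 / 16 * \<tau>) * (\<kappa> * P)"
          by (simp add: field_simps)
        moreover have "0 \<le> (3 / 8 * A + 3 / 16 * \<tau>) * (\<kappa> * P)"
          using A \<tau> \<kappa>p P by (intro mult_nonneg_nonneg) auto
        ultimately show "A * \<kappa> * P / 2 \<le> norm (commutator b T l f z)" by linarith
      qed
    qed
    have Fs[measurable]: "F \<in> sets lebesgue" unfolding F_def by (rule exceed_sets[OF b])
    have F_sub: "F \<subseteq> ccube x0 t" by (auto simp: F_def exceed_def)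
    \<comment> \<open>Otherwise \<open>F\<close> and all the \<open>G i\<close> are sizeable parts
      of one larger cube. The balanced weights then have masses too large for the assumed bound of
      the commutator.\<close>
    have "measure lebesgue F \<le> \<eta> * V"
    proof (rule ccontr)
      assume no: "\<not> measure lebesgue F \<le> \<eta> * V"
      define R where "R = (N + 1) * t"
      have R: "0 < R" using Np t by (simp add: R_def)
      have tR: "t \<le> R" "N * t + t = R" using Np t by (auto simp: R_def algebra_simps)
      have QR: "Q' \<subseteq> ccube x0 R"
      proof -
        have "x0' \<in> ccube x0 (N * t)" using dist by (intro norm_le_imp_ccube) (simp add: norm_minus_commute)
        from ccube_subset[OF this, of t] show ?thesis by (simp add: Q'_def tR)
      qed
      have \<eta>R: "\<eta>1 * (2 * R) ^ CARD('n) = \<eta> * V"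
      proof -
        have e: "2 * R = (N + 1) * (2 * t)" by (simp add: R_def)
        have e': "(2 * R) ^ CARD('n) = (N + 1) ^ CARD('n) * V"
          unfolding e V_def by (rule power_mult_distrib)
        show ?thesis unfolding \<eta>1_def e' using Np by simp
      qed
      define FF where "FF j = (case j of None \<Rightarrow> F | Some i \<Rightarrow> G i)" for j
      have "c1 * ((2 * R) ^ CARD('n)) powr W.\<Theta> \<le> (\<Prod>j\<in>UNIV. W.vm j (FF j) powr all_exponents p q j)"
      proof (rule low[OF R])
        show "FF j \<in> sets lebesgue" for j by (cases j) (simp_all add: FF_def)
        show "FF j \<subseteq> ccube x0 R" for j
        proof (cases j)
          case None
          then show ?thesis using F_sub ccube_mono[OF tR(1), of x0] by (simp add: FF_def)
        next
          case (Some i)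
          then show ?thesis using GQ[of i] QR by (simp add: FF_def)
        qed
        show "\<eta>1 * (2 * R) ^ CARD('n) \<le> measure lebesgue (FF j)" for j
        proof (cases j)
          case None
          then show ?thesis unfolding \<eta>R using no by (simp add: FF_def)
        next
          case (Some i)
          have "\<eta> * V \<le> V / 2" using mult_right_mono[OF \<eta>(2), of V] V by simp
          then show ?thesis unfolding \<eta>R Some using Gm[of i] by (simp add: FF_def)
        qed
      qed
      also have "(\<Prod>j\<in>UNIV. W.vm j (FF j) powr all_exponents p q j)
          = measure (wdens \<mu>) F powr (1 / q) * (\<Prod>i\<in>UNIV. S i powr (1 - 1 / p i))"
        by (simp add: prod_option FF_def weights_simps S_def)
      also have "((2 * R) ^ CARD('n)) powr W.\<Theta> = (2 * R) powr \<beta>"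
      proof -
        have "(w ^ CARD('n)) powr W.\<Theta> = w powr \<beta>" if "0 < w" for w :: real
          using that by (simp add: powr_realpow[symmetric] powr_powr homogeneity)
        then show ?thesis using R by (metis mult_pos_pos zero_less_numeral)
      qed
      finally have lowb: "c1 * (2 * R) powr \<beta> \<le> measure (wdens \<mu>) F powr (1 / q) * (\<Prod>i\<in>UNIV. S i powr (1 - 1 / p i))" .
      define m where "m = measure (wdens \<mu>) F"
      have m0: "0 \<le> m" by (simp add: m_def)
      have mE: "emeasure (wdens \<mu>) F = ennreal m"
        using W.vm_emeasure[OF F_sub t Fs, of None] by (simp add: m_def weights_simps)
      define E where "E = A * \<kappa> * P / 2"
      have E: "0 < E" using A \<kappa>p P by (simp add: E_def)
      define Sp' where "Sp' = (\<Prod>i\<in>UNIV. S i powr (1 / p i))"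
      have Sp'0: "0 < Sp'" unfolding Sp'_def using Sp by (intro prod_pos) (auto simp: less_imp_neq[symmetric])
      have "Lp_norm q \<mu> (commutator b T l f) \<le> ennreal C' * (\<Prod>i\<in>UNIV. Lp_norm (p i) (\<lambda>x. \<omega> i x powr p i) (f i))"
        using cb dom f_Lpw unfolding comm_bounded_def by blast
      also have "\<dots> = ennreal (C' * Sp')"
        using C' by (simp add: Lp_f prod_ennreal ennreal_mult' Sp'_def)
      finally have "(\<integral>\<^sup>+x. ennreal (norm (commutator b T l f x) powr q * \<mu> x) \<partial>lebesgue) \<le> ennreal ((C' * Sp') powr (1 / (1 / q)))"
        unfolding Lp_norm_def using q C' Sp'0 by (intro epowr_leD) auto
      then have ub: "(\<integral>\<^sup>+x. ennreal (norm (commutator b T l f x) powr q * \<mu> x) \<partial>lebesgue) \<le> ennreal ((C' * Sp') powr q)"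
        using q by simp
      have "ennreal (E powr q) * ennreal m = (\<integral>\<^sup>+x. ennreal (E powr q) * (ennreal (\<mu> x) * indicator F x) \<partial>lebesgue)"
        unfolding mE[symmetric] emeasure_wdens[OF \<mu>_weight Fs] by (rule nn_integral_cmult[symmetric]) measurable
      also have "\<dots> \<le> (\<integral>\<^sup>+x. ennreal (norm (commutator b T l f x) powr q * \<mu> x) \<partial>lebesgue)"
      proof (rule nn_integral_mono_AE)
        show "AE x in lebesgue. ennreal (E powr q) * (ennreal (\<mu> x) * indicator F x) \<le> ennreal (norm (commutator b T l f x) powr q * \<mu> x)"
          using large
        proof eventually_elim
          fix x assume lx: "x \<in> F \<longrightarrow> A * \<kappa> * P / 2 \<le> norm (commutator b T l f x)"
          show "ennreal (E powr q) * (ennreal (\<mu> x) * indicator F x) \<le> ennreal (norm (commutator b T l f x) powr q * \<mu> x)"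
          proof (cases "x \<in> F")
            case True
            then have "E powr q \<le> norm (commutator b T l f x) powr q"
              using lx E q by (intro powr_mono2) (auto simp: E_def)
            then show ?thesis using True weight_nonneg[OF \<mu>_weight, of x]
              by (simp add: ennreal_mult'[symmetric] ennreal_leI mult_right_mono)
          qed simp
        qed
      qed
      also note ub
      finally have "E powr q * m \<le> (C' * Sp') powr q"
        using m0 by (simp add: ennreal_mult'[symmetric])
      then have "(E powr q * m) powr (1 / q) \<le> ((C' * Sp') powr q) powr (1 / q)"
        using q m0 by (intro powr_mono2) auto
      then have le1: "E * m powr (1 / q) \<le> C' * Sp'"
        using q E C' Sp'0 by (simp add: powr_mult powr_powr)
      define D where "D = (\<Prod>i\<in>UNIV. S i powr (1 - 1 / p i))"
      have PD: "P = Sp' * D"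
        unfolding P_def Sp'_def D_def prod.distrib[symmetric]
      proof (intro prod.cong refl)
        show "S i = S i powr (1 / p i) * S i powr (1 - 1 / p i)" for i
          using Sp[of i] by (simp add: powr_add[symmetric])
      qed
      \<comment> \<open>The norms of the test functions cancel against the part \<open>Sp'\<close>
        of \<open>P\<close>. What is left is the product over all weights, for which
        \<open>lowb\<close> is the lower bound.\<close>
      have "A * \<kappa> / 2 * (m powr (1 / q) * D) * Sp' \<le> C' * Sp'"
        using le1 unfolding E_def PD by (simp add: mult_ac)
      then have "A * \<kappa> / 2 * (m powr (1 / q) * D) \<le> C'" using Sp'0 by simp
      moreover have "A * (ch * (N * t) powr (- M)) / 2 * (c1 * (2 * R) powr \<beta>) \<le> A * \<kappa> / 2 * (m powr (1 / q) * D)"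
      proof (rule mult_mono)
        show "A * (ch * (N * t) powr (- M)) / 2 \<le> A * \<kappa> / 2" using A \<kappa> by simp
        show "c1 * (2 * R) powr \<beta> \<le> m powr (1 / q) * D" using lowb by (simp add: m_def D_def)
      qed (use A \<kappa>p c1 in auto)
      ultimately have "A * (ch * (N * t) powr (- M)) / 2 * (c1 * (2 * R) powr \<beta>) \<le> C'" by linarith
      moreover have "A * (ch * (N * t) powr (- M)) / 2 * (c1 * (2 * R) powr \<beta>) = 2 * C'"
      proof -
        have e1: "(N * t) powr (- M) = N powr (- M) * t powr (- M)" by (rule powr_mult)
        have "2 * R = (2 * (N + 1)) * t" by (simp add: R_def)
        then have e2: "(2 * R) powr \<beta> = (2 * (N + 1)) powr \<beta> * t powr \<beta>" by (simp only: powr_mult)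
        \<comment> \<open>The powers of \<open>t\<close> cancel because
          \<open>\<beta> = M - \<alpha>\<close>; this fixes the power \<open>t powr \<alpha>\<close>
          in the oscillation.\<close>
        have e3: "t powr \<alpha> * (t powr (- M) * t powr \<beta>) = 1"
          using t by (simp add: powr_add[symmetric] \<beta>_def)
        have "A * (ch * (N * t) powr (- M)) / 2 * (c1 * (2 * R) powr \<beta>)
            = C * C' * \<kappa>2 * (t powr \<alpha> * (t powr (- M) * t powr \<beta>))"
          unfolding e1 e2 A_def \<kappa>2_def by (simp only: times_divide_eq_left times_divide_eq_right mult_ac)
        also have "\<dots> = 2 * C'" unfolding e3 using \<kappa>2 by (simp add: C_def)
        finally show ?thesis .
      qed
      ultimately show False using C' by simp
    qed
    then show "\<exists>c. measure lebesgue (exceed b x0 t c (C * C' * t powr \<alpha> + \<tau> / 2)) \<le> \<eta> * (2 * t) ^ CARD('n)"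
      unfolding F_def V_def by blast
  qed
qed

text \<open>Going to a distant cube and back improves a bound \<open>\<tau>\<close> to
  \<open>3/2 * A + \<tau> / 4\<close>. Iteration forgets the initial bound, which depends on
  \<open>b\<close> and on the cube, and leaves a multiple of \<open>A\<close>.\<close>

lemma oscillation_bound:
  assumes hom: "mn_homogeneous K" and \<eta>: "0 < \<eta>" "\<eta> \<le> 1 / 4"
  shows "\<exists>C>0. \<forall>b C' t x0. b \<in> borel_measurable lebesgue \<longrightarrow> 0 < C' \<longrightarrow> comm_bounded b C' \<longrightarrow> 0 < t \<longrightarrow>
     (\<exists>c. measure lebesgue (exceed b x0 t c (C * C' * t powr \<alpha>)) \<le> \<eta> * (2 * t) ^ CARD('n))"
proof -
  obtain N ch where N: "6 * real CARD('n) \<le> N" and ch: "0 < ch"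
    and kern: "\<And>t x0 x0'. 0 < t \<Longrightarrow> norm (x0 - x0') = N * t \<Longrightarrow> ch * (N * t) powr (- M) \<le> norm (K x0 (\<chi> i. x0'))"
      "\<And>t x0 x0' x y. 0 < t \<Longrightarrow> norm (x0 - x0') = N * t \<Longrightarrow> x \<in> ccube x0 t \<Longrightarrow> (\<forall>i. y $ i \<in> ccube x0' t) \<Longrightarrow>
        norm (K x y - K x0 (\<chi> i. x0')) \<le> norm (K x0 (\<chi> i. x0')) / 8"
    using homogeneous_kernel_pairs[OF hom] by blast
  have Np: "0 \<le> N" using N of_nat_0_le_iff[of "CARD('n)", where 'a = real] by linarith
  have "\<exists>C>0. \<forall>b C' t x0 x0' c' \<tau>. b \<in> borel_measurable lebesgue \<longrightarrow> 0 < C' \<longrightarrow> comm_bounded b C' \<longrightarrow> 0 < t \<longrightarrow>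
     norm (x0 - x0') = N * t \<longrightarrow> 0 \<le> \<tau> \<longrightarrow> measure lebesgue (exceed b x0' t c' \<tau>) \<le> \<eta> * (2 * t) ^ CARD('n) \<longrightarrow>
     (\<exists>c. measure lebesgue (exceed b x0 t c (C * C' * t powr \<alpha> + \<tau> / 2)) \<le> \<eta> * (2 * t) ^ CARD('n))"
    by (rule oscillation_step[OF N ch \<eta>]) (rule kern; assumption)+
  then obtain C where C: "0 < C" and raw: "\<forall>b C' t x0 x0' c' \<tau>. b \<in> borel_measurable lebesgue \<longrightarrow> 0 < C' \<longrightarrow> comm_bounded b C' \<longrightarrow> 0 < t \<longrightarrow>
     norm (x0 - x0') = N * t \<longrightarrow> 0 \<le> \<tau> \<longrightarrow> measure lebesgue (exceed b x0' t c' \<tau>) \<le> \<eta> * (2 * t) ^ CARD('n) \<longrightarrow>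
     (\<exists>c. measure lebesgue (exceed b x0 t c (C * C' * t powr \<alpha> + \<tau> / 2)) \<le> \<eta> * (2 * t) ^ CARD('n))"
    by (elim exE conjE)
  note step = raw[rule_format]
  show ?thesis
  proof (intro exI[of _ "4 * C"] conjI allI impI)
    show "0 < 4 * C" using C by simp
    fix b :: "real^'n \<Rightarrow> complex" and C' t :: real and x0 :: "real^'n"
    assume b[measurable]: "b \<in> borel_measurable lebesgue" and C': "0 < C'" and cb: "comm_bounded b C'" and t: "0 < t"
    define A where "A = C * C' * t powr \<alpha>"
    have A: "0 < A" using C C' t by (simp add: A_def)
    obtain i0 :: 'n where True by blast
    define x0' where "x0' = x0 + (N * t) *\<^sub>R axis i0 1"
    have dist: "norm (x0 - x0') = N * t" "norm (x0' - x0) = N * t"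
      using Np t by (simp_all add: x0'_def norm_axis_1)
    define small where "small x \<tau> \<longleftrightarrow> (\<exists>c. measure lebesgue (exceed b x t c \<tau>) \<le> \<eta> * (2 * t) ^ CARD('n))" for x \<tau>
    have small_mono: "small x \<tau>'" if "small x \<tau>" "\<tau> \<le> \<tau>'" for x \<tau> \<tau>'
      using that exceed_mono[OF b that(2)] order_trans unfolding small_def by blast
    have two: "small x0 (A + (A + \<tau> / 2) / 2)" if "small x0 \<tau>" "0 \<le> \<tau>" for \<tau>
    proof -
      have 1: "small x0' (A + \<tau> / 2)"
        using that step[OF b C' cb t dist(2), of \<tau>] unfolding small_def A_def by blast
      then show ?thesis
        using step[OF b C' cb t dist(1), of "A + \<tau> / 2"] A that(2) unfolding small_def A_def by auto
    qed
    \<comment> \<open>Some finite bound exists by measurability alone; its size is irrelevant. This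
      is where a merely locally integrable \<open>b\<close> gets started.\<close>
    obtain \<tau>0 where \<tau>0: "0 < \<tau>0" "small x0 \<tau>0"
    proof -
      have nb: "(\<lambda>y. norm (b y)) \<in> borel_measurable lebesgue" by measurable
      have e0: "0 < \<eta> * (2 * t) ^ CARD('n)" using \<eta> t by simp
      obtain k where "0 < k" "measure lebesgue {y \<in> ccube x0 t. k < norm (b y)} \<le> \<eta> * (2 * t) ^ CARD('n)"
        using measure_superlevel_small[OF nb ccube_lmeasurable[of x0 t] e0] by blast
      then have "0 < k \<and> small x0 k" unfolding small_def by (auto intro!: exI[of _ 0] simp: exceed_def)
      then show thesis using that by blast
    qed
    have iter: "small x0 (3 * A + \<tau>0 / 4 ^ j)" for j
    proof (induction j)
      case 0
      show ?case by (rule small_mono[OF \<tau>0(2)]) (use A in simp)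
    next
      \<comment> \<open>The fixed point of the iteration is \<open>2 * A\<close>. The slightly
        larger \<open>3 * A\<close> makes the induction close with room to spare.\<close>
      case (Suc j)
      have "small x0 (A + (A + (3 * A + \<tau>0 / 4 ^ j) / 2) / 2)"
        by (rule two[OF Suc]) (use A \<tau>0 in simp)
      moreover have "A + (A + (3 * A + \<tau>0 / 4 ^ j) / 2) / 2 \<le> 3 * A + \<tau>0 / 4 ^ Suc j"
        using A by (simp add: field_simps)
      ultimately show ?case by (rule small_mono)
    qed
    obtain j where "\<tau>0 / A < 4 ^ j" using real_arch_pow[of 4 "\<tau>0 / A"] by auto
    then have "\<tau>0 / 4 ^ j \<le> A" using A by (simp add: field_simps)
    then have "small x0 (4 * A)" by (intro small_mono[OF iter[of j]]) simp
    then show "\<exists>c. measure lebesgue (exceed b x0 t c (4 * C * C' * t powr \<alpha>)) \<le> \<eta> * (2 * t) ^ CARD('n)"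
      unfolding small_def A_def by (simp add: mult.assoc)
  qed
qed

text \<open>Only the oscillation bound for the single proportion \<open>\<eta>0\<close> enters the
  Lipschitz constant, and it is linear in the bound \<open>C'\<close> of the commutator.\<close>

lemma commutator_lower_bound:
  assumes hom: "mn_homogeneous K"
  shows "\<exists>c>0. \<forall>b. locally_integrable b \<longrightarrow> ennreal c * Lip_seminorm \<alpha> b \<le> commutator_norm s T l p q \<omega> b"
proof -
  \<comment> \<open>Small enough both for \<open>oscillation_bound\<close>, which needs at most 1/4,
    and for comparing cubes in \<open>measure_oscillation\<close>.\<close>
  define \<eta>0 :: real where "\<eta>0 = 1 / (4 ^ CARD('n) + 2)"
  have f4: "(4::real) \<le> 4 ^ CARD('n)" using self_le_power[of "4::real" "CARD('n)"] by simp
  have \<eta>0: "0 < \<eta>0" "\<eta>0 \<le> 1 / 4" "\<eta>0 * (4 ^ CARD('n) + 1) < 1"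
    using f4 by (auto simp: \<eta>0_def field_simps add_pos_pos)
  obtain C0 where C0: "0 < C0" and osc0: "\<And>b C' t x0. b \<in> borel_measurable lebesgue \<Longrightarrow> 0 < C' \<Longrightarrow> comm_bounded b C' \<Longrightarrow> 0 < t \<Longrightarrow>
     \<exists>c. measure lebesgue (exceed b x0 t c (C0 * C' * t powr \<alpha>)) \<le> \<eta>0 * (2 * t) ^ CARD('n)"
    using oscillation_bound[OF hom \<eta>0(1,2)] by blast
  define CC where "CC = (2 * osc_const \<alpha> + 4 * 2 powr \<alpha>) * C0"
  have CC: "0 < CC" using C0 osc_const(2)[OF \<alpha>] unfolding CC_def by (intro mult_pos_pos add_pos_pos) auto
  have main: "Lip_seminorm \<alpha> b \<le> ennreal (CC * C')" if b: "locally_integrable b" and C': "0 < C'" and cb: "comm_bounded b C'" for b C'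
  proof -
    have bm: "b \<in> borel_measurable lebesgue" by (rule locally_integrable_measurable[OF b])
    have "\<forall>x t. \<exists>c. 0 < t \<longrightarrow> measure lebesgue (exceed b x t c (C0 * C' * t powr \<alpha>)) \<le> \<eta>0 * (2 * t) ^ CARD('n)"
      using osc0[OF bm C' cb] by blast
    then obtain c where c: "\<And>x t. 0 < t \<Longrightarrow> measure lebesgue (exceed b x t (c x t) (C0 * C' * t powr \<alpha>)) \<le> \<eta>0 * (2 * t) ^ CARD('n)"
      by metis
    interpret measure_oscillation b \<alpha> "C0 * C'" \<eta>0 c
      by unfold_locales (use bm \<alpha> C0 C' \<eta>0 c in auto)
    \<comment> \<open>Other proportions merely identify \<open>g\<close> with \<open>b\<close>, so
      here the constant \<open>D\<close> may depend on \<open>\<eta>\<close>.\<close>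
    have all: "\<exists>M'. \<forall>x. \<forall>t>0. \<exists>c'. measure lebesgue (exceed b x t c' (M' * t powr \<alpha>)) \<le> \<eta> * (2 * t) ^ CARD('n)" if \<eta>: "0 < \<eta>" for \<eta>
    proof -
      have "0 < min \<eta> (1 / 4)" "min \<eta> (1 / 4) \<le> 1 / 4" using \<eta> by auto
      from oscillation_bound[OF hom this] obtain D where D: "\<And>t x. 0 < t \<Longrightarrow>
          \<exists>c. measure lebesgue (exceed b x t c (D * C' * t powr \<alpha>)) \<le> min \<eta> (1 / 4) * (2 * t) ^ CARD('n)"
        using bm C' cb by blast
      have "min \<eta> (1 / 4) * (2 * t) ^ CARD('n) \<le> \<eta> * (2 * t) ^ CARD('n)" if "0 < t" for t :: real
        using that by (intro mult_right_mono) auto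
      then show ?thesis using D by (intro exI[of _ "D * C'"]) (meson order_trans)
    qed
    show ?thesis
    proof (rule Lip_seminorm_le[OF g_eq_b])
      show "norm (g x - g y) \<le> CC * C' * norm (x - y) powr \<alpha>" for x y
        using g_Hoelder[of x y] by (simp add: CC_def mult_ac)
    qed (rule all)
  qed
  show ?thesis
  proof (intro exI[of _ "1 / CC"] conjI allI impI)
    show "0 < 1 / CC" using CC by simp
    fix b :: "real^'n \<Rightarrow> complex" assume b: "locally_integrable b"
    show "ennreal (1 / CC) * Lip_seminorm \<alpha> b \<le> commutator_norm s T l p q \<omega> b"
      unfolding commutator_norm_def operator_norm_def
    proof (rule Inf_greatest)
      fix B assume "B \<in> {C. \<forall>f\<in>commutator_domain s b l. (\<forall>i. f i \<in> Lp_space (p i) (\<lambda>x. \<omega> i x powr p i)) \<longrightarrow>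
               Lp_norm q \<mu> (commutator b T l f) \<le> C * (\<Prod>i\<in>UNIV. Lp_norm (p i) (\<lambda>x. \<omega> i x powr p i) (f i))}"
      then have B: "\<And>f. f \<in> commutator_domain s b l \<Longrightarrow> (\<forall>i. f i \<in> Lp_space (p i) (\<lambda>x. \<omega> i x powr p i)) \<Longrightarrow>
               Lp_norm q \<mu> (commutator b T l f) \<le> B * (\<Prod>i\<in>UNIV. Lp_norm (p i) (\<lambda>x. \<omega> i x powr p i) (f i))"
        by blast
      show "ennreal (1 / CC) * Lip_seminorm \<alpha> b \<le> B"
      proof (cases B)
        case (real r)
        \<comment> \<open>The bound \<open>r\<close> may be 0, whereas the oscillation estimates
          need a positive constant; so \<open>e\<close> is added and removed afterwards.\<close>
        have eps: "ennreal (1 / CC) * Lip_seminorm \<alpha> b \<le> ennreal r + ennreal e" if e: "0 < e" for e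
        proof -
          have "comm_bounded b (r + e)"
            unfolding comm_bounded_def
          proof (intro ballI impI)
            fix f assume f: "f \<in> commutator_domain s b l" "\<forall>i. f i \<in> Lp_space (p i) (\<lambda>x. \<omega> i x powr p i)"
            have "Lp_norm q \<mu> (commutator b T l f) \<le> B * (\<Prod>i\<in>UNIV. Lp_norm (p i) (\<lambda>x. \<omega> i x powr p i) (f i))"
              by (rule B[OF f])
            also have "\<dots> \<le> ennreal (r + e) * (\<Prod>i\<in>UNIV. Lp_norm (p i) (\<lambda>x. \<omega> i x powr p i) (f i))"
              using e real by (intro mult_right_mono) (auto intro: ennreal_leI)
            finally show "Lp_norm q \<mu> (commutator b T l f) \<le> ennreal (r + e) * (\<Prod>i\<in>UNIV. Lp_norm (p i) (\<lambda>x. \<omega> i x powr p i) (f i))" .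
          qed
          then have "ennreal (1 / CC) * Lip_seminorm \<alpha> b \<le> ennreal (1 / CC) * ennreal (CC * (r + e))"
            using e real by (intro mult_left_mono main[OF b]) auto
          also have "\<dots> = ennreal (r + e)" using CC by (simp add: ennreal_mult'[symmetric])
          also have "\<dots> = ennreal r + ennreal e" using real e by (intro ennreal_plus) auto
          finally show ?thesis .
        qed
        have "ennreal (1 / CC) * Lip_seminorm \<alpha> b \<le> ennreal r"
          by (rule ennreal_le_epsilon, rule eps)
        then show ?thesis using real by simp
      qed simp
    qed
  qed
qed

end

theorem theorem5p2:
  fixes T :: "('n::finite, 'm::finite) operator" and K :: "('n, 'm) kernel"
    and s p :: "'m \<Rightarrow> real" and \<omega> :: "'m \<Rightarrow> real^'n \<Rightarrow> real"
    and l :: 'm and q \<alpha> :: real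
  assumes "CZ_operator s T K" and "mn_homogeneous K"
    and "0 < \<alpha>" and "\<alpha> < real CARD('n)"
    and "\<And>i. 1 < p i" and "0 < q"
    and "(\<Sum>i\<in>UNIV. 1 / p i) - 1 / q = \<alpha> / real CARD('n)"
    and "\<omega> \<in> A_class p q"
  shows "\<exists>c>0. \<exists>C>0. \<forall>b. locally_integrable b \<longrightarrow>
           ennreal c * Lip_seminorm \<alpha> b \<le> commutator_norm s T l p q \<omega> b \<and>
           commutator_norm s T l p q \<omega> b \<le> ennreal C * Lip_seminorm \<alpha> b"
proof -
  have "CZ_kernel K" using assms(1) by (simp add: CZ_operator_def)
  then obtain CK \<gamma> where kernel: "CZ_kernel_bounds K CK \<gamma> (mn TYPE('n) TYPE('m))"
    unfolding CZ_kernel_def CZ_kernel_bounds_def by blast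
  obtain CT where "0 < CT" and CT: "\<forall>f\<in>Lp_tuples s. T f \<in> borel_measurable lebesgue \<and>
      Lp_norm (1 / (\<Sum>i\<in>UNIV. 1 / s i)) (\<lambda>_. 1) (T f) \<le> ennreal CT * (\<Prod>i\<in>UNIV. Lp_norm (s i) (\<lambda>_. 1) (f i))"
    using assms(1) unfolding CZ_operator_def by blast
  interpret CZ_kernel_bounds K CK \<gamma> "mn TYPE('n) TYPE('m)" by (rule kernel)
  interpret CZ_op K CK \<gamma> "mn TYPE('n) TYPE('m)" T s CT
    by unfold_locales (use assms(1) \<open>0 < CT\<close> CT in \<open>auto simp: CZ_operator_def\<close>)
  obtain CW where CW: "balanced_weights (all_weights p q \<omega>) (all_exponents p q) CW"
    using A_class_balanced[OF assms(8,6)] by blast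
  interpret weighted_CZ K CK \<gamma> "mn TYPE('n) TYPE('m)" T s CT p \<omega> l q \<alpha> CW
    by (intro weighted_CZ.intro weighted_CZ_axioms.intro CZ_op_axioms assms CW)
  show ?thesis
    using commutator_lower_bound[OF assms(2)] commutator_upper_bound by blast
qed

end
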